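(* Let $G$ be a group and let $V$ be a $d$-dimensional representation of $G$ over an arbitrary field $K$. Let $s \in \mathbb{N}$, and let $\lambda$ be a partition with $\ell(\lambda) \leq d$ and first part at most $s$. Let $\lambda^\circ$ denote the complement of $\lambda$ in the $d \times s$ rectangle. Then there is an isomorphism of representations of $G$ $$\nabla^\lambda V \cong \nabla^{\lambda^\circ} V^\star \otimes (\det V)^{\otimes s}.$$
   Context: A partition is a weakly decreasing finite sequence of natural numbers (its parts); $\ell(\lambda)$ is the number of parts. The complement of $\lambda$ in the $d\times s$ rectangle ($d$ rows, $s$ columns) is the partition $\lambda^\circ$ whose parts are the non-zero entries of $(s-\lambda_d, s-\lambda_{d-1},\ldots,s-\lambda_1)$, where $\lambda_i=0$ for $i>\ell(\lambda)$. $V^\star$ is the dual representation, and $\det V=\bigwedge^{\dim V}V$ is the 1-dimensional determinant representation. Schur functor $\nabla^\lambda$: let $V$ be a $KG$-module with basis $\{v_i : i\in\mathcal{B}\}$, $\mathcal{B}\subseteq \mathbb{N}_0$. $\mathrm{Sym}^r V$ is the usual symmetric power (the quotient of $V^{\otimes r}$ by the span of all $w\cdot\sigma-w$, for $w \in V^{\otimes r}$, $\sigma\in S_r$ acting by place permutation). The Young diagram is $[\lambda]=\{(i,j): 1\le i\le \ell(\lambda), 1\le j\le\lambda_i\}$; a $\lambda$-tableau is a function $t:[\lambda]\to\mathcal{B}$. Permutations $\sigma$ of $[\lambda]$ act on the right on tableaux by $(t\cdot\sigma)(i,j)=t((i,j)\sigma^{-1})$. Let $\mathrm{CPP}(\lambda)$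 be the group of permutations of $[\lambda]$ preserving each column setwise. Let $\mathrm{Sym}^\lambda V=\mathrm{Sym}^{\lambda_1}V\otimes\cdots\otimes\mathrm{Sym}^{\lambda_{\ell(\lambda)}}V$, let $\mathbf{s}(t)=\bigotimes_{i=1}^{\ell(\lambda)}\prod_{j=1}^{\lambda_i}v_{t(i,j)}\in\mathrm{Sym}^\lambda V$, and let $\mathbf{e}(t)=\sum_{\sigma\in\mathrm{CPP}(\lambda)}\mathrm{sgn}(\sigma)\,\mathbf{s}(t\cdot\sigma)$. Then $\nabla^\lambda V$ is the subspace of $\mathrm{Sym}^\lambda V$ spanned by all $\mathbf{e}(t)$, $t$ a $\lambda$-tableau with entries in $\mathcal{B}$; it is a $KG$-submodule of $\mathrm{Sym}^\lambda V$. *)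

theory Defs
  imports
    "Jordan_Normal_Form.VS_Connect"
    "HOL-Algebra.AbelCoset"
    "HOL-Combinatorics.Permutations"
    "HOL-Library.Poly_Mapping"
begin

section \<open>Representations\<close>

text \<open>
  The ground field is an arbitrary type of class \<^class>\<open>field\<close>, seen as a ring record through
  \<^term>\<open>class_ring\<close>. Vector spaces are the carrier-based ones of the AFP entry VectorSpace; a
  representation record adds the action of a group to a vector space record. The fields
  \<^term>\<open>mult\<close> and \<^term>\<open>one\<close>, which module records inherit from ring records, are never used.
\<close>

record ('k, 'v, 'g) rep = "('k, 'v) module" +
  act :: "'g \<Rightarrow> 'v \<Rightarrow> 'v"

locale representation =
  fixes G :: "('g, 'm) monoid_scheme" and V :: "('k::field, 'v, 'g) rep"
  assumes group: "group G"
    and vectorspace: "vectorspace class_ring V"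
    and act_linear: "g \<in> carrier G \<Longrightarrow> act V g \<in> LinearCombinations.module_hom class_ring V V"
    and act_one: "x \<in> carrier V \<Longrightarrow> act V \<one>\<^bsub>G\<^esub> x = x"
    and act_mult: "\<lbrakk>g \<in> carrier G; h \<in> carrier G; x \<in> carrier V\<rbrakk>
      \<Longrightarrow> act V (g \<otimes>\<^bsub>G\<^esub> h) x = act V g (act V h x)"

definition isomorphic_reps ::
  "('g, 'm) monoid_scheme \<Rightarrow> ('k::field, 'v, 'g) rep \<Rightarrow> ('k, 'w, 'g) rep \<Rightarrow> bool" where
  "isomorphic_reps G V W \<longleftrightarrow> representation G V \<and> representation G W \<and>
    (\<exists>f. linear_map class_ring V W f \<and> bij_betw f (carrier V) (carrier W) \<and>
         (\<forall>g\<in>carrier G. \<forall>x\<in>carrier V. f (act V g x) = act W g (f x)))"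

abbreviation vs_span :: "('k::field, 'v, 'm) module_scheme \<Rightarrow> 'v set \<Rightarrow> 'v set" where
  "vs_span V S \<equiv> LinearCombinations.module.span class_ring V S"

definition indexed_basis ::
  "('k::field, 'v, 'm) module_scheme \<Rightarrow> nat set \<Rightarrow> (nat \<Rightarrow> 'v) \<Rightarrow> bool" where
  "indexed_basis V B v \<longleftrightarrow> inj_on v B \<and> vectorspace.basis class_ring V (v ` B)"


section \<open>Dual and quotient representations\<close>

text \<open>Linear functionals are made extensional, so that they are determined by their values on
  the carrier.\<close>

definition dual_rep ::
  "('g, 'm) monoid_scheme \<Rightarrow> ('k::field, 'v, 'g) rep \<Rightarrow> ('k, 'v \<Rightarrow> 'k, 'g) rep" where
  "dual_rep G V = \<lparr>
    carrier = {\<phi> \<in> extensional (carrier V).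
      (\<forall>x\<in>carrier V. \<forall>y\<in>carrier V. \<phi> (x \<oplus>\<^bsub>V\<^esub> y) = \<phi> x + \<phi> y) \<and>
      (\<forall>a. \<forall>x\<in>carrier V. \<phi> (a \<odot>\<^bsub>V\<^esub> x) = a * \<phi> x)},
    mult = undefined, one = undefined,
    zero = (\<lambda>x\<in>carrier V. 0),
    add = (\<lambda>\<phi> \<psi>. \<lambda>x\<in>carrier V. \<phi> x + \<psi> x),
    smult = (\<lambda>a \<phi>. \<lambda>x\<in>carrier V. a * \<phi> x),
    act = (\<lambda>g \<phi>. \<lambda>x\<in>carrier V. \<phi> (act V (inv\<^bsub>G\<^esub> g) x))\<rparr>"

text \<open>
  The quotient by an invariant subspace \<open>U\<close>. For scalars the image of the coset \<open>x + U\<close> under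
  multiplication by \<open>a\<close> has to be enlarged by \<open>U\<close>, because it is not a coset when \<open>a = 0\<close>. Group
  elements act bijectively and map \<open>U\<close> onto \<open>U\<close>, so there the image is the coset of \<open>g x\<close>.
\<close>

definition quot_rep :: "('k::field, 'v, 'g) rep \<Rightarrow> 'v set \<Rightarrow> ('k, 'v set, 'g) rep" where
  "quot_rep V U = \<lparr>
    carrier = a_rcosets\<^bsub>V\<^esub> U,
    mult = undefined, one = undefined,
    zero = U,
    add = (\<lambda>X Y. X <+>\<^bsub>V\<^esub> Y),
    smult = (\<lambda>a X. U <+>\<^bsub>V\<^esub> ((\<lambda>x. a \<odot>\<^bsub>V\<^esub> x) ` X)),
    act = (\<lambda>g X. act V g ` X)\<rparr>"


section \<open>Tensor products\<close>

definition push :: "('x \<Rightarrow> 'y) \<Rightarrow> ('x \<Rightarrow>\<^sub>0 'k::field) \<Rightarrow> ('y \<Rightarrow>\<^sub>0 'k)" where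
  "push h f = (\<Sum>x\<in>Poly_Mapping.keys f. Poly_Mapping.single (h x) (Poly_Mapping.lookup f x))"

text \<open>The free vector space on a set \<open>S\<close> on which the group acts by \<open>h\<close>.\<close>

definition free_rep :: "'x set \<Rightarrow> ('g \<Rightarrow> 'x \<Rightarrow> 'x) \<Rightarrow> ('k::field, 'x \<Rightarrow>\<^sub>0 'k, 'g) rep" where
  "free_rep S h = \<lparr>
    carrier = {f. Poly_Mapping.keys f \<subseteq> S},
    mult = undefined, one = undefined,
    zero = 0,
    add = (+),
    smult = (\<lambda>a. Poly_Mapping.map ((*) a)),
    act = (\<lambda>g. push (h g))\<rparr>"

text \<open>The tensor product of a list of representations with the same underlying type: the free
  vector space on tuples modulo the relations of multilinearity.\<close>

definition free_tuples ::
  "('k::field, 'v, 'g) rep list \<Rightarrow> ('k, 'v list \<Rightarrow>\<^sub>0 'k, 'g) rep" where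
  "free_tuples Vs =
    free_rep (listset (map carrier Vs)) (\<lambda>g xs. map2 (\<lambda>V x. act V g x) Vs xs)"

definition multilinear_rels ::
  "('k::field, 'v, 'g) rep list \<Rightarrow> ('v list \<Rightarrow>\<^sub>0 'k) set" where
  "multilinear_rels Vs = vs_span (free_tuples Vs)
    {Poly_Mapping.single (xs[i := a \<odot>\<^bsub>Vs ! i\<^esub> x \<oplus>\<^bsub>Vs ! i\<^esub> b \<odot>\<^bsub>Vs ! i\<^esub> y]) 1
       - Poly_Mapping.single (xs[i := x]) a - Poly_Mapping.single (xs[i := y]) b
     | xs i a b x y. xs \<in> listset (map carrier Vs) \<and> i < length Vs \<and>
         x \<in> carrier (Vs ! i) \<and> y \<in> carrier (Vs ! i)}"

definition tensor_list ::
  "('k::field, 'v, 'g) rep list \<Rightarrow> ('k, ('v list \<Rightarrow>\<^sub>0 'k) set, 'g) rep" where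
  "tensor_list Vs = quot_rep (free_tuples Vs) (multilinear_rels Vs)"

definition pure_tensor ::
  "('k::field, 'v, 'g) rep list \<Rightarrow> 'v list \<Rightarrow> ('v list \<Rightarrow>\<^sub>0 'k) set" where
  "pure_tensor Vs xs = multilinear_rels Vs +>\<^bsub>free_tuples Vs\<^esub> Poly_Mapping.single xs 1"

abbreviation tensor_power ::
  "nat \<Rightarrow> ('k::field, 'v, 'g) rep \<Rightarrow> ('k, ('v list \<Rightarrow>\<^sub>0 'k) set, 'g) rep" where
  "tensor_power r V \<equiv> tensor_list (replicate r V)"

text \<open>The tensor product of two representations whose underlying types may differ.\<close>

definition free_pairs ::
  "('k::field, 'v, 'g) rep \<Rightarrow> ('k, 'w, 'g) rep \<Rightarrow> ('k, 'v \<times> 'w \<Rightarrow>\<^sub>0 'k, 'g) rep" where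
  "free_pairs V W = free_rep (carrier V \<times> carrier W) (\<lambda>g (x, y). (act V g x, act W g y))"

definition bilinear_rels ::
  "('k::field, 'v, 'g) rep \<Rightarrow> ('k, 'w, 'g) rep \<Rightarrow> ('v \<times> 'w \<Rightarrow>\<^sub>0 'k) set" where
  "bilinear_rels V W = vs_span (free_pairs V W)
    ({Poly_Mapping.single (a \<odot>\<^bsub>V\<^esub> x \<oplus>\<^bsub>V\<^esub> b \<odot>\<^bsub>V\<^esub> x', y) 1
        - Poly_Mapping.single (x, y) a - Poly_Mapping.single (x', y) b
      | a b x x' y. x \<in> carrier V \<and> x' \<in> carrier V \<and> y \<in> carrier W} \<union>
     {Poly_Mapping.single (x, a \<odot>\<^bsub>W\<^esub> y \<oplus>\<^bsub>W\<^esub> b \<odot>\<^bsub>W\<^esub> y') 1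
        - Poly_Mapping.single (x, y) a - Poly_Mapping.single (x, y') b
      | a b x y y'. x \<in> carrier V \<and> y \<in> carrier W \<and> y' \<in> carrier W})"

definition tensor_prod ::
  "('k::field, 'v, 'g) rep \<Rightarrow> ('k, 'w, 'g) rep \<Rightarrow> ('k, ('v \<times> 'w \<Rightarrow>\<^sub>0 'k) set, 'g) rep" where
  "tensor_prod V W = quot_rep (free_pairs V W) (bilinear_rels V W)"


section \<open>Symmetric and exterior powers, determinant\<close>

text \<open>Place permutation of a tensor, i.e. of a coset in a tensor power.\<close>

definition place_perm ::
  "(nat \<Rightarrow> nat) \<Rightarrow> ('v list \<Rightarrow>\<^sub>0 'k::field) set \<Rightarrow> ('v list \<Rightarrow>\<^sub>0 'k) set" where
  "place_perm \<sigma> w = push (permute_list \<sigma>) ` w"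

definition sym_rels ::
  "nat \<Rightarrow> ('k::field, 'v, 'g) rep \<Rightarrow> ('v list \<Rightarrow>\<^sub>0 'k) set set" where
  "sym_rels r V = vs_span (tensor_power r V)
    {place_perm \<sigma> w \<ominus>\<^bsub>tensor_power r V\<^esub> w
     | w \<sigma>. w \<in> carrier (tensor_power r V) \<and> \<sigma> permutes {..<r}}"

definition sym_power ::
  "nat \<Rightarrow> ('k::field, 'v, 'g) rep \<Rightarrow> ('k, ('v list \<Rightarrow>\<^sub>0 'k) set set, 'g) rep" where
  "sym_power r V = quot_rep (tensor_power r V) (sym_rels r V)"

text \<open>The product of a list of vectors in the symmetric power of degree its length.\<close>

definition sym_product ::
  "('k::field, 'v, 'g) rep \<Rightarrow> 'v list \<Rightarrow> ('v list \<Rightarrow>\<^sub>0 'k) set set" where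
  "sym_product V xs = sym_rels (length xs) V +>\<^bsub>tensor_power (length xs) V\<^esub>
    pure_tensor (replicate (length xs) V) xs"

definition alt_rels ::
  "nat \<Rightarrow> ('k::field, 'v, 'g) rep \<Rightarrow> ('v list \<Rightarrow>\<^sub>0 'k) set set" where
  "alt_rels r V = vs_span (tensor_power r V)
    {pure_tensor (replicate r V) xs
     | xs. set xs \<subseteq> carrier V \<and> length xs = r \<and> \<not> distinct xs}"

definition ext_power ::
  "nat \<Rightarrow> ('k::field, 'v, 'g) rep \<Rightarrow> ('k, ('v list \<Rightarrow>\<^sub>0 'k) set set, 'g) rep" where
  "ext_power r V = quot_rep (tensor_power r V) (alt_rels r V)"

definition det_rep ::
  "('k::field, 'v, 'g) rep \<Rightarrow> ('k, ('v list \<Rightarrow>\<^sub>0 'k) set set, 'g) rep" where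
  "det_rep V = ext_power (vectorspace.dim class_ring V) V"


section \<open>Partitions and tableaux\<close>

text \<open>Parts are positive; rows and columns are numbered from 1.\<close>

definition is_partition :: "nat list \<Rightarrow> bool" where
  "is_partition lam \<longleftrightarrow> sorted_wrt (\<ge>) lam \<and> 0 \<notin> set lam"

definition part :: "nat list \<Rightarrow> nat \<Rightarrow> nat" where
  "part lam i = (if 1 \<le> i \<and> i \<le> length lam then lam ! (i - 1) else 0)"

definition complement :: "nat \<Rightarrow> nat \<Rightarrow> nat list \<Rightarrow> nat list" where
  "complement d s lam = filter (\<lambda>p. p \<noteq> 0) (map (\<lambda>i. s - part lam i) (rev [1..<d + 1]))"

definition young :: "nat list \<Rightarrow> (nat \<times> nat) set" where
  "young lam = {(i, j). 1 \<le> i \<and> i \<le> length lam \<and> 1 \<le> j \<and> j \<le> part lam i}"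

definition tableaux :: "nat list \<Rightarrow> nat set \<Rightarrow> (nat \<times> nat \<Rightarrow> nat) set" where
  "tableaux lam B = young lam \<rightarrow>\<^sub>E B"

definition CPP :: "nat list \<Rightarrow> (nat \<times> nat \<Rightarrow> nat \<times> nat) set" where
  "CPP lam = {\<sigma>. \<sigma> permutes young lam \<and> (\<forall>b\<in>young lam. snd (\<sigma> b) = snd b)}"


section \<open>The Schur functor\<close>

definition sym_multi :: "nat list \<Rightarrow> ('k::field, 'v, 'g) rep \<Rightarrow>
    ('k, (('v list \<Rightarrow>\<^sub>0 'k) set set list \<Rightarrow>\<^sub>0 'k) set, 'g) rep" where
  "sym_multi lam V = tensor_list (map (\<lambda>r. sym_power r V) lam)"

definition s_tab :: "nat list \<Rightarrow> ('k::field, 'v, 'g) rep \<Rightarrow> (nat \<Rightarrow> 'v) \<Rightarrow> (nat \<times> nat \<Rightarrow> nat) \<Rightarrow>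
    (('v list \<Rightarrow>\<^sub>0 'k) set set list \<Rightarrow>\<^sub>0 'k) set" where
  "s_tab lam V v t = pure_tensor (map (\<lambda>r. sym_power r V) lam)
    (map (\<lambda>i. sym_product V (map (\<lambda>j. v (t (i, j))) [1..<part lam i + 1])) [1..<length lam + 1])"

definition e_tab :: "nat list \<Rightarrow> ('k::field, 'v, 'g) rep \<Rightarrow> (nat \<Rightarrow> 'v) \<Rightarrow> (nat \<times> nat \<Rightarrow> nat) \<Rightarrow>
    (('v list \<Rightarrow>\<^sub>0 'k) set set list \<Rightarrow>\<^sub>0 'k) set" where
  "e_tab lam V v t = (\<Oplus>\<^bsub>sym_multi lam V\<^esub>\<sigma>\<in>CPP lam.
    of_int (sign \<sigma>) \<odot>\<^bsub>sym_multi lam V\<^esub> s_tab lam V v (\<lambda>b. t (inv_into UNIV \<sigma> b)))"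

definition schur :: "nat list \<Rightarrow> ('k::field, 'v, 'g) rep \<Rightarrow> nat set \<Rightarrow> (nat \<Rightarrow> 'v) \<Rightarrow>
    ('k, (('v list \<Rightarrow>\<^sub>0 'k) set set list \<Rightarrow>\<^sub>0 'k) set, 'g) rep" where
  "schur lam V B v = (sym_multi lam V)
    \<lparr>carrier := vs_span (sym_multi lam V) {e_tab lam V v t | t. t \<in> tableaux lam B}\<rparr>"

end

theory Submission
  imports
    Defs
    "HOL-Computational_Algebra.Fraction_Field"
    "HOL-Combinatorics.List_Permutation"
    "HOL-Library.Nat_Bijection"
begin

text \<open>
  Fix a basis of \<open>V\<close> and its dual basis, and let \<open>M\<close> be a \<open>d \<times> d\<close> matrix over an extension field with
  inverse transpose \<open>N\<close>. Reading the rows of \<open>M\<close> as linear forms on \<open>V\<close> and applying the \<open>i\<close>-th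
  form to the \<open>i\<close>-th symmetric power turns \<open>e(t)\<close> into a product over the columns of \<open>t\<close> of initial
  minors of \<open>M\<close>; doing the same on \<open>V\<^sup>\<star>\<close> with the rows of \<open>N\<close> in reverse order yields final minors of
  \<open>N\<close>. By Jacobi's theorem an initial minor of \<open>M\<close> is \<open>det M\<close> times the complementary minor of \<open>N\<close>, so
  \<open>e(t)\<close> and the tensor of the complementary tableau with \<open>s\<close> volume elements have equal evaluations.
  When \<open>M\<close>, respectively \<open>N\<close>, is generic, evaluation is injective on the whole of \<open>Sym\<^sup>\<lambda>\<close>, since it
  sends the monomial basis to distinct monomials. Hence matching elements with equal evaluations is
  a well-defined isomorphism. Working with a family of bases, one for each column, makes the
  correspondence free of signs and visibly equivariant.
\<close>

text \<open>A map prescribed on the elements \<open>e(t)\<close> would have to respect all linear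
  relations among them, and over an arbitrary field these are awkward to describe. Comparing values
  of functionals bypasses them. The field may be finite, and then matrices over it need not separate
  elements, whence rational functions in the matrix entries. The functionals are indexed by all dual
  pairs \<open>(M, N)\<close> over that field: in a single pair only one of the two matrices can
  have independent variables as entries, so each side of the isomorphism is separated by a pair of
  its own. Signs would come from completing the entries of a column to a basis. Here the column
  becomes part of a permuted basis, whose dual basis supplies the complementary column and which
  itself supplies the volume element, so each sign occurs twice. A group element moves a basis and
  its dual basis together, and the identity of evaluations holds for every basis; this gives
  equivariance. The rows of \<open>N\<close> are reversed because Jacobi's theorem yields its last
  rows, whereas a diagram starts from its first.\<close>

no_notation Polynomial.smult (infixl \<open>\<odot>\<close> 70)

section \<open>Vector spaces over a field type: spans, homomorphisms and finite sums\<close>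

locale kspace = vectorspace "class_ring :: 'k::field ring" V
  for V :: "('k::field, 'v, 'm) module_scheme" (structure)

text \<open>Additive inverses come from the scalars: x + (-1) x = 0 x.\<close>

lemma kspaceI:
  fixes V :: "('k::field, 'v, 'm) module_scheme" (structure)
  assumes zero: "\<zero> \<in> carrier V"
    and add: "\<And>x y. x \<in> carrier V \<Longrightarrow> y \<in> carrier V \<Longrightarrow> x \<oplus> y \<in> carrier V"
    and smult: "\<And>a x. x \<in> carrier V \<Longrightarrow> a \<odot>\<^bsub>V\<^esub> x \<in> carrier V"
    and comm: "\<And>x y. x \<in> carrier V \<Longrightarrow> y \<in> carrier V \<Longrightarrow> x \<oplus> y = y \<oplus> x"
    and assoc: "\<And>x y z. x \<in> carrier V \<Longrightarrow> y \<in> carrier V \<Longrightarrow> z \<in> carrier V \<Longrightarrow>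
      (x \<oplus> y) \<oplus> z = x \<oplus> (y \<oplus> z)"
    and r_zero: "\<And>x. x \<in> carrier V \<Longrightarrow> x \<oplus> \<zero> = x"
    and zero_smult: "\<And>x. x \<in> carrier V \<Longrightarrow> 0 \<odot>\<^bsub>V\<^esub> x = \<zero>"
    and mult: "\<And>a b x. x \<in> carrier V \<Longrightarrow> (a * b) \<odot>\<^bsub>V\<^esub> x = a \<odot>\<^bsub>V\<^esub> (b \<odot>\<^bsub>V\<^esub> x)"
    and one: "\<And>x. x \<in> carrier V \<Longrightarrow> 1 \<odot>\<^bsub>V\<^esub> x = x"
    and l_distr: "\<And>a b x. x \<in> carrier V \<Longrightarrow> (a + b) \<odot>\<^bsub>V\<^esub> x = a \<odot>\<^bsub>V\<^esub> x \<oplus> b \<odot>\<^bsub>V\<^esub> x"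
    and r_distr: "\<And>a x y. x \<in> carrier V \<Longrightarrow> y \<in> carrier V \<Longrightarrow>
      a \<odot>\<^bsub>V\<^esub> (x \<oplus> y) = a \<odot>\<^bsub>V\<^esub> x \<oplus> a \<odot>\<^bsub>V\<^esub> y"
  shows "kspace V"
proof -
  have neg: "\<exists>y\<in>carrier V. x \<oplus> y = \<zero>" if x: "x \<in> carrier V" for x
  proof
    show "(- 1) \<odot>\<^bsub>V\<^esub> x \<in> carrier V" using smult x by blast
    show "x \<oplus> (- 1) \<odot>\<^bsub>V\<^esub> x = \<zero>"
      using l_distr[OF x, of 1 "- 1"] one[OF x] zero_smult[OF x] by simp
  qed
  have "vectorspace class_ring V"
    by (rule vs_criteria) (use class_field assms neg in auto)
  then show ?thesis by (simp add: kspace_def)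
qed

lemma hom_kI:
  assumes "\<And>x. x \<in> carrier V \<Longrightarrow> f x \<in> carrier W"
    and "\<And>x y. x \<in> carrier V \<Longrightarrow> y \<in> carrier V \<Longrightarrow> f (x \<oplus>\<^bsub>V\<^esub> y) = f x \<oplus>\<^bsub>W\<^esub> f y"
    and "\<And>a x. x \<in> carrier V \<Longrightarrow> f (a \<odot>\<^bsub>V\<^esub> x) = a \<odot>\<^bsub>W\<^esub> f x"
  shows "f \<in> LinearCombinations.module_hom class_ring V W"
  unfolding LinearCombinations.module_hom_def using assms by auto

lemma
  assumes "f \<in> LinearCombinations.module_hom class_ring V W"
  shows hom_k_closed: "x \<in> carrier V \<Longrightarrow> f x \<in> carrier W"
    and hom_k_add: "x \<in> carrier V \<Longrightarrow> y \<in> carrier V \<Longrightarrow> f (x \<oplus>\<^bsub>V\<^esub> y) = f x \<oplus>\<^bsub>W\<^esub> f y"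
    and hom_k_smult: "x \<in> carrier V \<Longrightarrow> f (a \<odot>\<^bsub>V\<^esub> x) = a \<odot>\<^bsub>W\<^esub> f x"
  using assms by (auto simp: LinearCombinations.module_hom_def)

context kspace
begin

lemma smult_closed' [simp, intro]: "x \<in> carrier V \<Longrightarrow> a \<odot>\<^bsub>V\<^esub> x \<in> carrier V"
  using smult_closed[of a x] by simp

lemma smult_zero_left [simp]: "x \<in> carrier V \<Longrightarrow> 0 \<odot>\<^bsub>V\<^esub> x = \<zero>"
  using smult_l_null[of x] by simp

lemma smult_zero_right [simp]: "a \<odot>\<^bsub>V\<^esub> \<zero> = \<zero>"
  using smult_r_null[of a] by simp

lemma smult_one_left [simp]: "x \<in> carrier V \<Longrightarrow> 1 \<odot>\<^bsub>V\<^esub> x = x"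
  using smult_one[of x] by simp

lemma smult_distrib_left: "x \<in> carrier V \<Longrightarrow> (a + b) \<odot>\<^bsub>V\<^esub> x = a \<odot>\<^bsub>V\<^esub> x \<oplus> b \<odot>\<^bsub>V\<^esub> x"
  using smult_l_distr[of a b x] by simp

lemma smult_distrib_right:
  "x \<in> carrier V \<Longrightarrow> y \<in> carrier V \<Longrightarrow> a \<odot>\<^bsub>V\<^esub> (x \<oplus> y) = a \<odot>\<^bsub>V\<^esub> x \<oplus> a \<odot>\<^bsub>V\<^esub> y"
  using smult_r_distr[of a x y] by simp

lemma smult_smult: "x \<in> carrier V \<Longrightarrow> a \<odot>\<^bsub>V\<^esub> (b \<odot>\<^bsub>V\<^esub> x) = (a * b) \<odot>\<^bsub>V\<^esub> x"
  using smult_assoc1[of a b x] by simp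

lemma minus_eq_smult: "x \<in> carrier V \<Longrightarrow> \<ominus> x = (- 1) \<odot>\<^bsub>V\<^esub> x"
  using smult_minus_1[of x] by (simp add: class_ring_simps)

lemma submoduleI:
  assumes "U \<subseteq> carrier V" "\<zero> \<in> U" "\<And>x y. x \<in> U \<Longrightarrow> y \<in> U \<Longrightarrow> x \<oplus> y \<in> U"
    "\<And>a x. x \<in> U \<Longrightarrow> a \<odot>\<^bsub>V\<^esub> x \<in> U"
  shows "submodule class_ring U V"
  using assms by (unfold_locales) auto

text \<open>The vectors satisfying \<open>P\<close> form a submodule, which contains the span by
  minimality. This replaces most reasoning about linear combinations.\<close>

lemma span_gen_induct [consumes 2, case_names zero gen add smult]:
  assumes "x \<in> vs_span V S" "S \<subseteq> carrier V"
    and "P \<zero>" "\<And>x. x \<in> S \<Longrightarrow> P x"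
    and "\<And>x y. x \<in> carrier V \<Longrightarrow> y \<in> carrier V \<Longrightarrow> P x \<Longrightarrow> P y \<Longrightarrow> P (x \<oplus> y)"
    and "\<And>a x. x \<in> carrier V \<Longrightarrow> P x \<Longrightarrow> P (a \<odot>\<^bsub>V\<^esub> x)"
  shows "P x"
proof -
  have "submodule class_ring {x \<in> carrier V. P x} V"
    by (rule submoduleI) (use assms in auto)
  then have "vs_span V S \<subseteq> {x \<in> carrier V. P x}"
    by (intro span_is_subset) (use assms in auto)
  then show ?thesis using assms(1) by auto
qed

lemma span_submodule: "S \<subseteq> carrier V \<Longrightarrow> submodule class_ring (vs_span V S) V"
  by (rule span_is_submodule)

lemma span_closed: "S \<subseteq> carrier V \<Longrightarrow> x \<in> vs_span V S \<Longrightarrow> x \<in> carrier V"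
  using span_is_subset2 by blast

lemma span_base: "S \<subseteq> carrier V \<Longrightarrow> x \<in> S \<Longrightarrow> x \<in> vs_span V S"
  using in_own_span by blast

lemma
  assumes "S \<subseteq> carrier V"
  shows span_zero: "\<zero> \<in> vs_span V S"
    and span_add: "x \<in> vs_span V S \<Longrightarrow> y \<in> vs_span V S \<Longrightarrow> x \<oplus> y \<in> vs_span V S"
    and span_smult: "x \<in> vs_span V S \<Longrightarrow> a \<odot>\<^bsub>V\<^esub> x \<in> vs_span V S"
  using span_submodule[OF assms] by (auto simp: submodule_def)

lemma span_minimal:
  assumes "submodule class_ring U V" "S \<subseteq> U"
  shows "vs_span V S \<subseteq> U"
  using span_is_subset assms by blast

lemma hom_image_span:
  assumes W: "kspace W" and f: "f \<in> LinearCombinations.module_hom class_ring V W"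
    and S: "S \<subseteq> carrier V" and U: "submodule class_ring U W" and fS: "f ` S \<subseteq> U"
    and x: "x \<in> vs_span V S"
  shows "f x \<in> U"
proof -
  interpret W: kspace W by (rule W)
  interpret U: submodule class_ring U W by (rule U)
  have f0: "f \<zero> = \<zero>\<^bsub>W\<^esub>"
    using hom_k_smult[OF f, of \<zero> 0] hom_k_closed[OF f, of \<zero>] by simp
  show ?thesis
    using x S by (induction rule: span_gen_induct)
      (use fS in \<open>auto simp: f0 hom_k_add[OF f] hom_k_smult[OF f]\<close>)
qed

lemma hom_zero:
  assumes W: "kspace W" and f: "f \<in> LinearCombinations.module_hom class_ring V W"
  shows "f \<zero> = \<zero>\<^bsub>W\<^esub>"
proof -
  interpret W: kspace W by (rule W)
  show ?thesis using hom_k_smult[OF f, of \<zero> 0] hom_k_closed[OF f, of \<zero>] by simp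
qed

lemma hom_finsum:
  assumes W: "kspace W" and f: "f \<in> LinearCombinations.module_hom class_ring V W"
    and g: "\<And>i. i \<in> A \<Longrightarrow> g i \<in> carrier V"
  shows "f (finsum V g A) = finsum W (\<lambda>i. f (g i)) A"
proof -
  interpret W: kspace W by (rule W)
  show ?thesis
    using g
  proof (induction A rule: infinite_finite_induct)
    case (insert i A)
    then have "finsum V g (insert i A) = g i \<oplus> finsum V g A" "finsum V g A \<in> carrier V"
      "finsum W (\<lambda>i. f (g i)) (insert i A) = f (g i) \<oplus>\<^bsub>W\<^esub> finsum W (\<lambda>i. f (g i)) A"
      by (auto simp: Pi_def hom_k_closed[OF f])
    then show ?case using insert by (simp add: hom_k_add[OF f])
  qed (auto simp: hom_zero[OF W f])
qed

lemma span_finsum: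
  assumes S: "S \<subseteq> carrier V" and g: "\<And>i. i \<in> A \<Longrightarrow> g i \<in> vs_span V S"
  shows "finsum V g A \<in> vs_span V S"
  using g
proof (induction A rule: infinite_finite_induct)
  case (insert i A)
  then have "finsum V g (insert i A) = g i \<oplus> finsum V g A"
    by (auto simp: Pi_def span_closed[OF S])
  then show ?case using insert by (auto intro: span_add[OF S])
qed (auto simp: span_zero[OF S])

end


subsection \<open>Quotients\<close>

locale kspace_sub = kspace V for V :: "('k::field, 'v, 'g) rep" (structure) +
  fixes U
  assumes U: "submodule class_ring U V"
begin

interpretation U: submodule class_ring U V by (rule U)

lemma U_closed [intro]: "x \<in> U \<Longrightarrow> x \<in> carrier V" using U.subset by blast

lemma abelian_subgroup_U: "abelian_subgroup U V"
proof (rule abelian_subgroupI3)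
  show "abelian_group V" by (rule abelian_group_axioms)
  show "additive_subgroup U V"
  proof (rule additive_subgroup.intro, rule add.subgroupI)
    show "U \<subseteq> carrier V" by (rule U.subset)
    show "U \<noteq> {}" using U.zero_closed by blast
    show "\<ominus> x \<in> U" if "x \<in> U" for x
      using that U.smult_closed[of "- 1" x] U_closed[OF that] by (simp add: minus_eq_smult)
    show "x \<oplus> y \<in> U" if "x \<in> U" "y \<in> U" for x y using that by simp
  qed
qed

interpretation U: abelian_subgroup U V by (rule abelian_subgroup_U)

lemma mem_coset_iff:
  assumes x: "x \<in> carrier V"
  shows "z \<in> U +> x \<longleftrightarrow> z \<in> carrier V \<and> z \<ominus> x \<in> U"
proof
  assume "z \<in> U +> x"
  then obtain u where u: "u \<in> U" "z = u \<oplus> x" by (auto simp: a_r_coset_def')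
  then show "z \<in> carrier V \<and> z \<ominus> x \<in> U"
    using x by (auto simp: minus_eq add.m_assoc r_neg)
next
  assume z: "z \<in> carrier V \<and> z \<ominus> x \<in> U"
  then have "z = (z \<ominus> x) \<oplus> x" using x by (simp add: minus_eq add.m_assoc l_neg)
  then show "z \<in> U +> x" using z by (auto simp: a_r_coset_def')
qed

lemma coset_self: "x \<in> carrier V \<Longrightarrow> x \<in> U +> x"
  by (simp add: mem_coset_iff minus_eq r_neg)

lemma coset_eq_iff:
  assumes "x \<in> carrier V" "y \<in> carrier V"
  shows "U +> x = U +> y \<longleftrightarrow> x \<ominus> y \<in> U"
proof
  assume "U +> x = U +> y"
  then show "x \<ominus> y \<in> U" using coset_self[of x] assms by (simp add: mem_coset_iff)
next
  assume "x \<ominus> y \<in> U"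
  then have "x \<in> U +> y" using assms by (simp add: mem_coset_iff)
  then show "U +> x = U +> y"
    using a_repr_independence[of x U y] assms U.a_subgroup by simp
qed

lemma carrier_quot: "carrier (quot_rep V U) = (\<lambda>x. U +> x) ` carrier V"
  by (auto simp: quot_rep_def A_RCOSETS_def')

lemma quot_cases [consumes 1, case_names coset]:
  assumes "X \<in> carrier (quot_rep V U)"
  obtains x where "x \<in> carrier V" "X = U +> x"
  using assms by (auto simp: carrier_quot)

lemma quot_closed: "x \<in> carrier V \<Longrightarrow> U +> x \<in> carrier (quot_rep V U)"
  by (simp add: carrier_quot)

lemma quot_add:
  assumes "x \<in> carrier V" "y \<in> carrier V"
  shows "(U +> x) \<oplus>\<^bsub>quot_rep V U\<^esub> (U +> y) = U +> (x \<oplus> y)"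
  using U.a_rcos_sum[OF assms] by (simp add: quot_rep_def)

lemma quot_zero: "\<zero>\<^bsub>quot_rep V U\<^esub> = U +> \<zero>"
  using U.subset by (simp add: quot_rep_def)

lemma quot_smult:
  assumes x: "x \<in> carrier V"
  shows "a \<odot>\<^bsub>quot_rep V U\<^esub> (U +> x) = U +> (a \<odot>\<^bsub>V\<^esub> x)"
proof -
  have "z \<in> U <+>\<^bsub>V\<^esub> (\<lambda>x. a \<odot>\<^bsub>V\<^esub> x) ` (U +> x) \<longleftrightarrow> z \<in> U +> (a \<odot>\<^bsub>V\<^esub> x)" for z
  proof
    assume "z \<in> U <+>\<^bsub>V\<^esub> (\<lambda>x. a \<odot>\<^bsub>V\<^esub> x) ` (U +> x)"
    then obtain u w where "u \<in> U" "w \<in> U" "z = u \<oplus> a \<odot>\<^bsub>V\<^esub> (w \<oplus> x)"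
      by (auto simp: set_add_def' a_r_coset_def')
    then have "u \<oplus> a \<odot>\<^bsub>V\<^esub> w \<in> U" "z = (u \<oplus> a \<odot>\<^bsub>V\<^esub> w) \<oplus> a \<odot>\<^bsub>V\<^esub> x"
      using x by (auto simp: smult_distrib_right add.m_assoc U_closed)
    then show "z \<in> U +> (a \<odot>\<^bsub>V\<^esub> x)" by (auto simp: a_r_coset_def')
  next
    assume "z \<in> U +> (a \<odot>\<^bsub>V\<^esub> x)"
    then obtain u where "u \<in> U" "z = u \<oplus> a \<odot>\<^bsub>V\<^esub> x" by (auto simp: a_r_coset_def')
    then show "z \<in> U <+>\<^bsub>V\<^esub> (\<lambda>x. a \<odot>\<^bsub>V\<^esub> x) ` (U +> x)"
      using coset_self[OF x] unfolding set_add_def' by blast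
  qed
  then show ?thesis by (auto simp: quot_rep_def)
qed

lemma quot_kspace: "kspace (quot_rep V U)"
  by (rule kspaceI; (elim quot_cases)?)
    (simp_all add: quot_add quot_smult quot_zero quot_closed a_comm a_assoc a_lcomm smult_smult
      smult_distrib_left smult_distrib_right)

lemma quot_hom: "(\<lambda>x. U +> x) \<in> LinearCombinations.module_hom class_ring V (quot_rep V U)"
  by (rule hom_kI) (auto simp: quot_add quot_smult quot_closed)

lemma quot_eq_zero: "x \<in> U \<Longrightarrow> U +> x = \<zero>\<^bsub>quot_rep V U\<^esub>"
  using coset_eq_iff[of x \<zero>] U_closed[of x] by (simp add: quot_zero minus_eq)

text \<open>Invariance of \<open>U\<close> would only put the image of a coset inside a coset. It is
  a full coset because \<open>f\<close> maps \<open>U\<close> onto \<open>U\<close>.\<close>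

lemma hom_image_coset:
  assumes f: "f \<in> LinearCombinations.module_hom class_ring V V" and fU: "f ` U = U"
    and x: "x \<in> carrier V"
  shows "f ` (U +> x) = U +> f x"
proof -
  have "f ` (U +> x) = (\<lambda>u. f u \<oplus> f x) ` U"
    using x U_closed by (auto simp: a_r_coset_def' hom_k_add[OF f] image_iff)
  also have "\<dots> = (\<lambda>u. u \<oplus> f x) ` (f ` U)" by (auto simp: image_iff)
  finally show ?thesis using fU by (auto simp: a_r_coset_def')
qed

lemma coset_image_hom:
  assumes f: "f \<in> LinearCombinations.module_hom class_ring V V" and fU: "f ` U = U"
  shows "(\<lambda>X. f ` X) \<in> LinearCombinations.module_hom class_ring (quot_rep V U) (quot_rep V U)"
  by (rule hom_kI; elim quot_cases)
    (simp_all add: hom_image_coset[OF f fU] quot_add quot_smult quot_closed hom_k_add[OF f]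
      hom_k_smult[OF f] hom_k_closed[OF f])

lemma quot_span:
  assumes S: "S \<subseteq> carrier V" and span: "vs_span V S = carrier V"
  shows "vs_span (quot_rep V U) ((\<lambda>x. U +> x) ` S) = carrier (quot_rep V U)"
proof -
  interpret Q: kspace "quot_rep V U" by (rule quot_kspace)
  have S': "(\<lambda>x. U +> x) ` S \<subseteq> carrier (quot_rep V U)" using S by (auto simp: carrier_quot)
  have "U +> x \<in> vs_span (quot_rep V U) ((\<lambda>x. U +> x) ` S)" if "x \<in> carrier V" for x
    by (rule hom_image_span[OF quot_kspace quot_hom S Q.span_submodule[OF S']])
      (use that span Q.span_base[OF S'] in auto)
  then show ?thesis using Q.span_closed[OF S'] by (auto simp: carrier_quot)
qed

end


subsection \<open>Representations\<close>

lemma representation_kspace: "representation G V \<Longrightarrow> kspace V"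
  by (simp add: representation_def kspace_def)

lemma quot_representation:
  assumes V: "representation G V" and U: "submodule class_ring U V"
    and inv: "\<And>g x. g \<in> carrier G \<Longrightarrow> x \<in> U \<Longrightarrow> act V g x \<in> U"
  shows "representation G (quot_rep V U)"
    and "\<And>g x. g \<in> carrier G \<Longrightarrow> x \<in> carrier V \<Longrightarrow>
      act (quot_rep V U) g (U +>\<^bsub>V\<^esub> x) = U +>\<^bsub>V\<^esub> act V g x"
proof -
  interpret V: representation G V by (rule V)
  interpret G: group G by (rule V.group)
  interpret kspace_sub V U
    using representation_kspace[OF V] U by (simp add: kspace_sub_def kspace_sub_axioms_def)
  \<comment> \<open>Invariance under the inverse of \<open>g\<close> gives surjectivity on
    \<open>U\<close>.\<close>
  have img: "act V g ` U = U" if g: "g \<in> carrier G" for g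
  proof
    show "act V g ` U \<subseteq> U" using inv g by auto
    show "U \<subseteq> act V g ` U"
    proof
      fix x assume x: "x \<in> U"
      then have "x = act V g (act V (inv\<^bsub>G\<^esub> g) x)"
        using g V.act_mult[of g "inv\<^bsub>G\<^esub> g" x] V.act_one[of x] U_closed[of x] by simp
      then show "x \<in> act V g ` U" using inv[of "inv\<^bsub>G\<^esub> g" x] g x by auto
    qed
  qed
  show act: "act (quot_rep V U) g (U +>\<^bsub>V\<^esub> x) = U +>\<^bsub>V\<^esub> act V g x"
    if "g \<in> carrier G" "x \<in> carrier V" for g x
    using hom_image_coset[OF V.act_linear[OF that(1)] img[OF that(1)] that(2)]
    by (simp add: quot_rep_def)
  show "representation G (quot_rep V U)"
  proof (rule representation.intro)
    show "vectorspace class_ring (quot_rep V U)" using quot_kspace by (simp add: kspace_def)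
    show "act (quot_rep V U) g \<in> LinearCombinations.module_hom class_ring (quot_rep V U) (quot_rep V U)"
      if g: "g \<in> carrier G" for g
      using coset_image_hom[OF V.act_linear[OF g] img[OF g]] by (simp add: quot_rep_def)
    show "act (quot_rep V U) \<one>\<^bsub>G\<^esub> X = X" if "X \<in> carrier (quot_rep V U)" for X
      using that by (elim quot_cases) (simp add: act V.act_one)
    show "act (quot_rep V U) (g \<otimes>\<^bsub>G\<^esub> h) X = act (quot_rep V U) g (act (quot_rep V U) h X)"
      if "g \<in> carrier G" "h \<in> carrier G" "X \<in> carrier (quot_rep V U)" for g h X
      using that(3) by (elim quot_cases)
        (simp add: act V.act_mult hom_k_closed[OF V.act_linear] that(1,2))
  qed (rule V.group)
qed

lemma sub_kspace:
  fixes V :: "('k::field, 'v, 'm) module_scheme"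
  assumes "kspace V" "submodule class_ring U V"
  shows "kspace (V\<lparr>carrier := U\<rparr>)"
proof -
  interpret kspace V by (rule assms(1))
  have "subspace class_ring U V"
    using assms(2) vectorspace_axioms by (simp add: VectorSpace.subspace_def)
  then show ?thesis using subspace_is_vs by (simp add: kspace_def)
qed

lemma sub_representation:
  assumes V: "representation G V" and U: "submodule class_ring U V"
    and inv: "\<And>g x. g \<in> carrier G \<Longrightarrow> x \<in> U \<Longrightarrow> act V g x \<in> U"
  shows "representation G (V\<lparr>carrier := U\<rparr>)"
proof -
  interpret V: representation G V by (rule V)
  interpret U: submodule class_ring U V by (rule U)
  have [simp]: "x \<in> U \<Longrightarrow> x \<in> carrier V" for x using U.subset by auto
  show ?thesis
  proof (rule representation.intro)
    show "vectorspace class_ring (V\<lparr>carrier := U\<rparr>)"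
      using sub_kspace[OF representation_kspace[OF V] U] by (simp add: kspace_def)
    show "act (V\<lparr>carrier := U\<rparr>) g
      \<in> LinearCombinations.module_hom class_ring (V\<lparr>carrier := U\<rparr>) (V\<lparr>carrier := U\<rparr>)"
      if "g \<in> carrier G" for g
      by (rule hom_kI) (use that inv hom_k_add[OF V.act_linear] hom_k_smult[OF V.act_linear] in auto)
  qed (auto simp: V.group V.act_one V.act_mult)
qed


subsection \<open>Free vector spaces\<close>

lemma push_sum:
  assumes "finite A" "Poly_Mapping.keys f \<subseteq> A"
  shows "push h f = (\<Sum>x\<in>A. Poly_Mapping.single (h x) (Poly_Mapping.lookup f x))"
  unfolding push_def
  by (rule sum.mono_neutral_left) (use assms in \<open>auto simp: in_keys_iff\<close>)

lemma push_add: "push h (f + g) = push h f + push h g"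
proof -
  let ?A = "Poly_Mapping.keys f \<union> Poly_Mapping.keys g"
  have "finite ?A" "Poly_Mapping.keys (f + g) \<subseteq> ?A" by (use Poly_Mapping.keys_add[of f g] in auto)
  then show ?thesis
    by (simp add: push_sum[of ?A] lookup_add single_add sum.distrib)
qed

lemma push_zero [simp]: "push h 0 = 0"
  by (simp add: push_def)

lemma push_single [simp]: "push h (Poly_Mapping.single x c) = Poly_Mapping.single (h x) c"
  by (cases "c = 0") (auto simp: push_def)

lemma push_minus: "push h (f - g) = push h f - push h g"
  using push_add[of h "f - g" g] by (simp add: algebra_simps)

lemma push_sum_distrib: "push h (\<Sum>i\<in>I. f i) = (\<Sum>i\<in>I. push h (f i))"
  by (induction I rule: infinite_finite_induct) (auto simp: push_add)

lemma push_push: "push h (push h' f) = push (\<lambda>x. h (h' x)) f"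
  by (simp add: push_def[of h' f] push_sum_distrib push_def[of _ f])

lemma push_cong: "(\<And>x. x \<in> Poly_Mapping.keys f \<Longrightarrow> h x = h' x) \<Longrightarrow> push h f = push h' f"
  by (simp add: push_def)

lemma poly_mapping_sum_singles:
  "(\<Sum>x\<in>Poly_Mapping.keys f. Poly_Mapping.single x (Poly_Mapping.lookup f x)) = f"
proof (rule poly_mapping_eqI)
  fix k
  show "Poly_Mapping.lookup (\<Sum>x\<in>Poly_Mapping.keys f. Poly_Mapping.single x (Poly_Mapping.lookup f x)) k
    = Poly_Mapping.lookup f k"
    by (cases "k \<in> Poly_Mapping.keys f")
      (auto simp: lookup_sum lookup_single when_def sum.delta' in_keys_iff)
qed

lemma push_id: "(\<And>x. x \<in> Poly_Mapping.keys f \<Longrightarrow> h x = x) \<Longrightarrow> push h f = f"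
  by (simp add: push_def poly_mapping_sum_singles)

lemma keys_push: "Poly_Mapping.keys (push h f) \<subseteq> h ` Poly_Mapping.keys f"
proof -
  have "Poly_Mapping.keys (push h f)
    \<subseteq> (\<Union>x\<in>Poly_Mapping.keys f. Poly_Mapping.keys (Poly_Mapping.single (h x) (Poly_Mapping.lookup f x)))"
    unfolding push_def by (rule Poly_Mapping.keys_sum)
  also have "\<dots> \<subseteq> h ` Poly_Mapping.keys f" by (auto split: if_splits)
  finally show ?thesis .
qed

lemma lookup_map_mult: "Poly_Mapping.lookup (Poly_Mapping.map ((*) a) f) x = a * Poly_Mapping.lookup f x"
  for a :: "'k::field"
  by (simp add: Poly_Mapping.map.rep_eq when_def)

lemma map_mult_single:
  "Poly_Mapping.map ((*) a) (Poly_Mapping.single x c) = Poly_Mapping.single x (a * c)" for a :: "'k::field"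
  by (rule poly_mapping_eqI) (simp add: lookup_map_mult lookup_single when_def)

lemma keys_map_mult: "Poly_Mapping.keys (Poly_Mapping.map ((*) a) f) \<subseteq> Poly_Mapping.keys f"
  for a :: "'k::field"
  by (auto simp: in_keys_iff lookup_map_mult)

lemma push_map_mult: "push h (Poly_Mapping.map ((*) a) f) = Poly_Mapping.map ((*) a) (push h f)"
  for a :: "'k::field"
proof -
  have map_zero: "Poly_Mapping.map ((*) a) 0 = (0 :: 'x \<Rightarrow>\<^sub>0 'k)" for a
    by (rule poly_mapping_eqI) (simp add: lookup_map_mult)
  have map_add: "Poly_Mapping.map ((*) a) (p + q)
      = Poly_Mapping.map ((*) a) p + Poly_Mapping.map ((*) a) q" for p q :: "'x \<Rightarrow>\<^sub>0 'k"
    by (rule poly_mapping_eqI) (simp add: lookup_map_mult lookup_add algebra_simps)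
  have map_sum: "Poly_Mapping.map ((*) a) (\<Sum>i\<in>I. p i) = (\<Sum>i\<in>I. Poly_Mapping.map ((*) a) (p i))"
    for p :: "'i \<Rightarrow> 'x \<Rightarrow>\<^sub>0 'k" and I
    by (induction I rule: infinite_finite_induct) (auto simp: map_add map_zero)
  show ?thesis
    by (subst push_sum[OF _ keys_map_mult])
      (auto simp: push_def map_sum map_mult_single lookup_map_mult)
qed

lemma free_rep_simps [simp]:
  "carrier (free_rep S h) = {f. Poly_Mapping.keys f \<subseteq> S}"
  "\<zero>\<^bsub>free_rep S h\<^esub> = 0"
  "f \<oplus>\<^bsub>free_rep S h\<^esub> g = f + g"
  "a \<odot>\<^bsub>free_rep S h\<^esub> f = Poly_Mapping.map ((*) a) f"
  "act (free_rep S h) \<gamma> = push (h \<gamma>)"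
  by (simp_all add: free_rep_def)

lemma free_kspace: "kspace (free_rep S h :: ('k::field, 'x \<Rightarrow>\<^sub>0 'k, 'g) rep)"
proof (rule kspaceI; simp?)
  fix f g :: "'x \<Rightarrow>\<^sub>0 'k" and a b :: 'k
  show "Poly_Mapping.keys f \<subseteq> S \<Longrightarrow> Poly_Mapping.keys g \<subseteq> S \<Longrightarrow> Poly_Mapping.keys (f + g) \<subseteq> S"
    using Poly_Mapping.keys_add[of f g] by blast
  show "Poly_Mapping.keys f \<subseteq> S \<Longrightarrow> Poly_Mapping.keys (Poly_Mapping.map ((*) a) f) \<subseteq> S"
    using keys_map_mult[of a f] by blast
qed (auto intro!: poly_mapping_eqI simp: lookup_map_mult lookup_add algebra_simps)

lemma push_hom:
  fixes h :: "'g \<Rightarrow> 'x \<Rightarrow> 'x"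
  assumes "\<And>x. x \<in> S \<Longrightarrow> p x \<in> S"
  shows "push p \<in> LinearCombinations.module_hom class_ring
    (free_rep S h :: ('k::field, _, _) rep) (free_rep S h)"
proof (rule hom_kI)
  fix f :: "'x \<Rightarrow>\<^sub>0 'k" assume "f \<in> carrier (free_rep S h)"
  then show "push p f \<in> carrier (free_rep S h)"
    using keys_push[of p f] assms by auto
qed (simp_all add: push_add push_map_mult)

lemma free_representation:
  assumes G: "group G"
    and closed: "\<And>g x. g \<in> carrier G \<Longrightarrow> x \<in> S \<Longrightarrow> h g x \<in> S"
    and one: "\<And>x. x \<in> S \<Longrightarrow> h \<one>\<^bsub>G\<^esub> x = x"
    and mult: "\<And>g g' x. g \<in> carrier G \<Longrightarrow> g' \<in> carrier G \<Longrightarrow> x \<in> S \<Longrightarrow>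
      h (g \<otimes>\<^bsub>G\<^esub> g') x = h g (h g' x)"
  shows "representation G (free_rep S h)"
proof (rule representation.intro)
  show "vectorspace class_ring (free_rep S h)" using free_kspace by (simp add: kspace_def)
  show "act (free_rep S h) g \<in> LinearCombinations.module_hom class_ring (free_rep S h) (free_rep S h)"
    if "g \<in> carrier G" for g
    unfolding free_rep_simps by (rule push_hom) (rule closed[OF that])
  show "act (free_rep S h) \<one>\<^bsub>G\<^esub> x = x" if "x \<in> carrier (free_rep S h)" for x
    using that one by (auto intro!: push_id)
  show "act (free_rep S h) (g \<otimes>\<^bsub>G\<^esub> g') x = act (free_rep S h) g (act (free_rep S h) g' x)"
    if "g \<in> carrier G" "g' \<in> carrier G" "x \<in> carrier (free_rep S h)" for g g' x
    using that by (auto simp: push_push mult intro!: push_cong)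
qed (rule G)

lemma free_span:
  "vs_span (free_rep S h) ((\<lambda>x. Poly_Mapping.single x 1) ` S) = carrier (free_rep S h)"
proof -
  interpret F: kspace "free_rep S h :: ('b::field, 'a \<Rightarrow>\<^sub>0 'b, 'c) rep" by (rule free_kspace)
  let ?E = "(\<lambda>x. Poly_Mapping.single x 1) ` S :: ('a \<Rightarrow>\<^sub>0 'b) set"
  have E: "?E \<subseteq> carrier (free_rep S h)" by (auto simp del: single_one)
  have single: "Poly_Mapping.single x c \<in> vs_span (free_rep S h) ?E" if "x \<in> S" for x c
    using F.span_smult[OF E F.span_base[OF E], of "Poly_Mapping.single x 1" c] that
    by (auto simp: map_mult_single)
  have sums: "(\<Sum>x\<in>A. Poly_Mapping.single x (c x)) \<in> vs_span (free_rep S h) ?E" if "A \<subseteq> S" for A c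
    using that
  proof (induction A rule: infinite_finite_induct)
    case (insert x A)
    then show ?case using F.span_add[OF E single[of x "c x"]] by auto
  qed (use F.span_zero[OF E] in auto)
  have "f \<in> vs_span (free_rep S h) ?E" if "f \<in> carrier (free_rep S h)" for f
    using sums[of "Poly_Mapping.keys f" "Poly_Mapping.lookup f"] that
    by (simp add: poly_mapping_sum_singles)
  then show ?thesis using F.span_closed[OF E] by blast
qed

context kspace begin

lemma hom_eq_on_span:
  assumes W: "kspace W" and f: "f \<in> LinearCombinations.module_hom class_ring V W"
    and g: "g \<in> LinearCombinations.module_hom class_ring V W"
    and S: "S \<subseteq> carrier V" and x: "x \<in> vs_span V S"
    and eq: "\<And>x. x \<in> S \<Longrightarrow> f x = g x"
  shows "f x = g x"
  using x S by (induction rule: span_gen_induct)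
    (auto simp: eq hom_zero[OF W f] hom_zero[OF W g] hom_k_add[OF f] hom_k_add[OF g]
      hom_k_smult[OF f] hom_k_smult[OF g])

lemma hom_minus:
  assumes W: "kspace W" and f: "f \<in> LinearCombinations.module_hom class_ring V W"
    and "x \<in> carrier V" "y \<in> carrier V"
  shows "f (x \<ominus> y) = f x \<ominus>\<^bsub>W\<^esub> f y"
proof -
  interpret W: kspace W by (rule W)
  show ?thesis using assms
    by (simp add: minus_eq minus_eq_smult W.minus_eq W.minus_eq_smult hom_k_add[OF f]
        hom_k_smult[OF f] hom_k_closed[OF f])
qed

end

lemma free_minus:
  fixes f g :: "'x \<Rightarrow>\<^sub>0 'k::field"
  assumes "f \<in> carrier (free_rep S h)" "g \<in> carrier (free_rep S h)"
  shows "f \<ominus>\<^bsub>free_rep S h\<^esub> g = f - g"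
proof -
  interpret F: kspace "free_rep S h" by (rule free_kspace)
  have "Poly_Mapping.map ((*) (- 1)) g = - g" for g :: "'x \<Rightarrow>\<^sub>0 'k"
    by (rule poly_mapping_eqI) (simp add: lookup_map_mult)
  then show ?thesis using assms F.minus_eq_smult[of g] by (simp add: F.minus_eq)
qed


subsection \<open>Functionals with values in an extension field\<close>

text \<open>A functional that vanishes on the subspace is constant on each coset, so any
  representative computes the induced functional on the quotient.\<close>

definition coset_val :: "('v \<Rightarrow> 'l) \<Rightarrow> 'v set \<Rightarrow> 'l" where
  "coset_val \<phi> X = \<phi> (SOME x. x \<in> X)"

text \<open>An embedding of fields. It is used twice: with the identity, for ordinary linear forms,
  and with the constants inside the generic field, for evaluations.\<close>

locale scalar_extension =
  fixes \<kappa> :: "'k::field \<Rightarrow> 'l::field"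
  assumes \<kappa>_add [simp]: "\<kappa> (a + b) = \<kappa> a + \<kappa> b"
    and \<kappa>_mult [simp]: "\<kappa> (a * b) = \<kappa> a * \<kappa> b"
    and \<kappa>_one [simp]: "\<kappa> 1 = 1"
begin

lemma \<kappa>_zero [simp]: "\<kappa> 0 = 0"
proof -
  have "\<kappa> 0 + \<kappa> 0 = \<kappa> 0 + 0" using \<kappa>_add[of 0 0] by (simp only: add_0_left add_0_right)
  then show ?thesis by (rule add_left_imp_eq)
qed

lemma \<kappa>_minus [simp]: "\<kappa> (- a) = - \<kappa> a"
  using \<kappa>_add[of a "- a"] by (simp add: eq_neg_iff_add_eq_0 add.commute)

lemma \<kappa>_diff [simp]: "\<kappa> (a - b) = \<kappa> a - \<kappa> b"
  using \<kappa>_add[of a "- b"] by simp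

lemma \<kappa>_sign: "\<kappa> (of_int (sign p)) = of_int (sign p)"
  by (simp add: sign_def)

text \<open>These are the linear forms on the space after extension of scalars along
  \<open>\<kappa>\<close>, expressed on the original space so that the extended space never has to
  be formed.\<close>

definition functional :: "('k, 'v, 'm) module_scheme \<Rightarrow> ('v \<Rightarrow> 'l) \<Rightarrow> bool" where
  "functional V \<phi> \<longleftrightarrow> (\<forall>x\<in>carrier V. \<forall>y\<in>carrier V. \<phi> (x \<oplus>\<^bsub>V\<^esub> y) = \<phi> x + \<phi> y) \<and>
    (\<forall>a. \<forall>x\<in>carrier V. \<phi> (a \<odot>\<^bsub>V\<^esub> x) = \<kappa> a * \<phi> x)"

lemma
  assumes "functional V \<phi>"
  shows functional_add: "x \<in> carrier V \<Longrightarrow> y \<in> carrier V \<Longrightarrow> \<phi> (x \<oplus>\<^bsub>V\<^esub> y) = \<phi> x + \<phi> y"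
    and functional_smult: "x \<in> carrier V \<Longrightarrow> \<phi> (a \<odot>\<^bsub>V\<^esub> x) = \<kappa> a * \<phi> x"
  using assms by (auto simp: functional_def)

lemma functional_zero:
  assumes "kspace V" "functional V \<phi>"
  shows "\<phi> \<zero>\<^bsub>V\<^esub> = 0"
proof -
  interpret kspace V by (rule assms)
  show ?thesis using functional_smult[OF assms(2), of "\<zero>\<^bsub>V\<^esub>" 0] by simp
qed

lemma functional_minus:
  assumes "kspace V" "functional V \<phi>" "x \<in> carrier V" "y \<in> carrier V"
  shows "\<phi> (x \<ominus>\<^bsub>V\<^esub> y) = \<phi> x - \<phi> y"
proof -
  interpret kspace V by (rule assms)
  show ?thesis using assms(3,4)
    by (simp add: minus_eq minus_eq_smult functional_add[OF assms(2)] functional_smult[OF assms(2)])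
qed

lemma functional_finsum:
  assumes "kspace V" "functional V \<phi>" "\<And>i. i \<in> A \<Longrightarrow> g i \<in> carrier V"
  shows "\<phi> (finsum V g A) = (\<Sum>i\<in>A. \<phi> (g i))"
proof -
  interpret kspace V by (rule assms)
  show ?thesis
    using assms(3)
  proof (induction A rule: infinite_finite_induct)
    case (insert i A)
    then have "finsum V g (insert i A) = g i \<oplus>\<^bsub>V\<^esub> finsum V g A" "finsum V g A \<in> carrier V"
      by (auto simp: Pi_def)
    then show ?case using insert by (simp add: functional_add[OF assms(2)])
  qed (auto simp: functional_zero[OF assms(1,2)])
qed

lemma functional_eq_on_span:
  assumes V: "kspace V" and f: "functional V \<phi>" and g: "functional V \<psi>"
    and S: "S \<subseteq> carrier V" and x: "x \<in> vs_span V S"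
    and eq: "\<And>x. x \<in> S \<Longrightarrow> \<phi> x = \<psi> x"
  shows "\<phi> x = \<psi> x"
proof -
  interpret kspace V by (rule V)
  show ?thesis
    using x S by (induction rule: span_gen_induct)
      (auto simp: eq functional_zero[OF V f] functional_zero[OF V g] functional_add[OF f]
        functional_add[OF g] functional_smult[OF f] functional_smult[OF g])
qed

lemma functional_0: "functional V (\<lambda>x. 0)"
  by (simp add: functional_def)

lemma functional_hom:
  assumes "f \<in> LinearCombinations.module_hom class_ring V W" "functional W \<phi>"
  shows "functional V (\<lambda>x. \<phi> (f x))"
  using assms by (auto simp: functional_def hom_k_add hom_k_smult hom_k_closed)

lemma
  assumes V: "kspace V" and U: "submodule class_ring U V" and \<phi>: "functional V \<phi>"
    and zero: "\<And>u. u \<in> U \<Longrightarrow> \<phi> u = 0"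
  shows coset_val: "x \<in> carrier V \<Longrightarrow> coset_val \<phi> (U +>\<^bsub>V\<^esub> x) = \<phi> x"
    and coset_val_functional: "functional (quot_rep V U) (coset_val \<phi>)"
proof -
  interpret kspace_sub V U using V U by (simp add: kspace_sub_def kspace_sub_axioms_def)
  show val: "coset_val \<phi> (U +>\<^bsub>V\<^esub> x) = \<phi> x" if x: "x \<in> carrier V" for x
  proof -
    let ?y = "SOME y. y \<in> U +>\<^bsub>V\<^esub> x"
    have "?y \<in> U +>\<^bsub>V\<^esub> x" by (rule someI[of _ x]) (rule coset_self[OF x])
    then have "?y \<in> carrier V" "\<phi> (?y \<ominus>\<^bsub>V\<^esub> x) = 0" using x zero by (auto simp: mem_coset_iff)
    then show ?thesis using x by (simp add: coset_val_def functional_minus[OF V \<phi>])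
  qed
  show "functional (quot_rep V U) (coset_val \<phi>)"
    unfolding functional_def carrier_quot
    by (auto simp: val quot_add quot_smult functional_add[OF \<phi>] functional_smult[OF \<phi>])
qed

definition free_val :: "('x \<Rightarrow> 'l) \<Rightarrow> ('x \<Rightarrow>\<^sub>0 'k) \<Rightarrow> 'l" where
  "free_val F f = (\<Sum>x\<in>Poly_Mapping.keys f. \<kappa> (Poly_Mapping.lookup f x) * F x)"

lemma free_val_sum:
  assumes "finite A" "Poly_Mapping.keys f \<subseteq> A"
  shows "free_val F f = (\<Sum>x\<in>A. \<kappa> (Poly_Mapping.lookup f x) * F x)"
  unfolding free_val_def
  by (rule sum.mono_neutral_left) (use assms in \<open>auto simp: in_keys_iff\<close>)

lemma free_val_add: "free_val F (f + g) = free_val F f + free_val F g"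
proof -
  let ?A = "Poly_Mapping.keys f \<union> Poly_Mapping.keys g"
  have "finite ?A" "Poly_Mapping.keys (f + g) \<subseteq> ?A" using Poly_Mapping.keys_add[of f g] by auto
  then show ?thesis
    by (simp add: free_val_sum[of ?A] lookup_add sum.distrib algebra_simps)
qed

lemma free_val_diff: "free_val F (f - g) = free_val F f - free_val F g"
  using free_val_add[of F "f - g" g] by simp

lemma free_val_single [simp]: "free_val F (Poly_Mapping.single x c) = \<kappa> c * F x"
  by (cases "c = 0") (auto simp: free_val_def)

lemma free_val_functional: "functional (free_rep S h) (free_val F)"
proof -
  have "free_val F (Poly_Mapping.map ((*) a) f) = \<kappa> a * free_val F f" for a f
    by (subst free_val_sum[OF _ keys_map_mult])
      (auto simp: free_val_def lookup_map_mult sum_distrib_left mult.assoc)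
  then show ?thesis by (simp add: functional_def free_val_add)
qed

end


subsection \<open>Tensor products of lists of spaces\<close>

lemma mem_listset_iff:
  "xs \<in> listset As \<longleftrightarrow> length xs = length As \<and> (\<forall>i<length As. xs ! i \<in> As ! i)"
proof (induction As arbitrary: xs)
  case (Cons A As)
  then show ?case
    by (cases xs) (auto simp: set_Cons_def nth_Cons' all_conj_distrib split: if_splits
        dest: spec[of _ 0] spec[of _ "Suc _"])
qed auto

text \<open>The generators occurring in \<open>multilinear_rels\<close>, named so that induction
  over the span can be applied to them. \<open>bilinear_gens\<close>, \<open>sym_gens\<close> and
  \<open>alt_gens\<close> have the same purpose.\<close>

definition multilinear_gens :: "('k::field, 'v, 'g) rep list \<Rightarrow> ('v list \<Rightarrow>\<^sub>0 'k) set" where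
  "multilinear_gens Vs =
    {Poly_Mapping.single (xs[i := a \<odot>\<^bsub>Vs ! i\<^esub> x \<oplus>\<^bsub>Vs ! i\<^esub> b \<odot>\<^bsub>Vs ! i\<^esub> y]) 1
       - Poly_Mapping.single (xs[i := x]) a - Poly_Mapping.single (xs[i := y]) b
     | xs i a b x y. xs \<in> listset (map carrier Vs) \<and> i < length Vs \<and>
         x \<in> carrier (Vs ! i) \<and> y \<in> carrier (Vs ! i)}"

lemma multilinear_rels_span: "multilinear_rels Vs = vs_span (free_tuples Vs) (multilinear_gens Vs)"
  unfolding multilinear_rels_def multilinear_gens_def ..

definition (in scalar_extension) multilinear ::
  "('k, 'v, 'g) rep list \<Rightarrow> ('v list \<Rightarrow> 'l) \<Rightarrow> bool" where
  "multilinear Vs F \<longleftrightarrow> (\<forall>xs\<in>listset (map carrier Vs). \<forall>i<length Vs. \<forall>a b.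
     \<forall>x\<in>carrier (Vs ! i). \<forall>y\<in>carrier (Vs ! i).
       F (xs[i := a \<odot>\<^bsub>Vs ! i\<^esub> x \<oplus>\<^bsub>Vs ! i\<^esub> b \<odot>\<^bsub>Vs ! i\<^esub> y])
         = \<kappa> a * F (xs[i := x]) + \<kappa> b * F (xs[i := y]))"

definition (in scalar_extension) tensor_val ::
  "('v list \<Rightarrow> 'l) \<Rightarrow> ('v list \<Rightarrow>\<^sub>0 'k) set \<Rightarrow> 'l" where
  "tensor_val F = coset_val (free_val F)"

locale kspaces =
  fixes Vs :: "('k::field, 'v, 'g) rep list"
  assumes kspaces: "V \<in> set Vs \<Longrightarrow> kspace V"
begin

lemma kspace_nth: "i < length Vs \<Longrightarrow> kspace (Vs ! i)"
  by (rule kspaces) (rule nth_mem)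

lemma tuple_iff: "xs \<in> listset (map carrier Vs) \<longleftrightarrow>
    length xs = length Vs \<and> (\<forall>i<length Vs. xs ! i \<in> carrier (Vs ! i))"
  by (auto simp: mem_listset_iff)

lemma tuple_update:
  "xs \<in> listset (map carrier Vs) \<Longrightarrow> i < length Vs \<Longrightarrow> x \<in> carrier (Vs ! i) \<Longrightarrow>
    xs[i := x] \<in> listset (map carrier Vs)"
  by (auto simp: tuple_iff nth_list_update)

lemma single_closed:
  "xs \<in> listset (map carrier Vs) \<Longrightarrow> Poly_Mapping.single xs c \<in> carrier (free_tuples Vs)"
  by (simp add: free_tuples_def)

lemma diff_closed:
  assumes "f \<in> carrier (free_tuples Vs)" "g \<in> carrier (free_tuples Vs)"
  shows "f - g \<in> carrier (free_tuples Vs)"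
  using assms Poly_Mapping.keys_diff[of f g] by (auto simp: free_tuples_def)

lemma lincomb_closed:
  assumes "i < length Vs" "x \<in> carrier (Vs ! i)" "y \<in> carrier (Vs ! i)"
  shows "a \<odot>\<^bsub>Vs ! i\<^esub> x \<oplus>\<^bsub>Vs ! i\<^esub> b \<odot>\<^bsub>Vs ! i\<^esub> y \<in> carrier (Vs ! i)"
proof -
  interpret kspace "Vs ! i" by (rule kspace_nth) (rule assms)
  show ?thesis using assms by simp
qed

lemma gens_closed: "multilinear_gens Vs \<subseteq> carrier (free_tuples Vs)"
proof
  fix f assume "f \<in> multilinear_gens Vs"
  then obtain xs i a b x y where *: "xs \<in> listset (map carrier Vs)" "i < length Vs"
    "x \<in> carrier (Vs ! i)" "y \<in> carrier (Vs ! i)"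
    and f: "f = Poly_Mapping.single (xs[i := a \<odot>\<^bsub>Vs ! i\<^esub> x \<oplus>\<^bsub>Vs ! i\<^esub> b \<odot>\<^bsub>Vs ! i\<^esub> y]) 1
     - Poly_Mapping.single (xs[i := x]) a - Poly_Mapping.single (xs[i := y]) b"
    unfolding multilinear_gens_def by blast
  show "f \<in> carrier (free_tuples Vs)"
    unfolding f by (intro diff_closed single_closed tuple_update lincomb_closed *)
qed

sublocale free: kspace "free_tuples Vs"
  unfolding free_tuples_def by (rule free_kspace)

sublocale free: kspace_sub "free_tuples Vs" "multilinear_rels Vs"
  unfolding multilinear_rels_span
  by (intro kspace_sub.intro kspace_sub_axioms.intro free.span_submodule gens_closed
      free.kspace_axioms)

lemma tensor_kspace: "kspace (tensor_list Vs)"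
  unfolding tensor_list_def by (rule free.quot_kspace)

lemma pure_tensor_closed:
  "xs \<in> listset (map carrier Vs) \<Longrightarrow> pure_tensor Vs xs \<in> carrier (tensor_list Vs)"
  unfolding tensor_list_def pure_tensor_def by (intro free.quot_closed single_closed)

lemma pure_tensor_linear:
  assumes xs: "xs \<in> listset (map carrier Vs)" and i: "i < length Vs"
    and x: "x \<in> carrier (Vs ! i)" and y: "y \<in> carrier (Vs ! i)"
  shows "pure_tensor Vs (xs[i := a \<odot>\<^bsub>Vs ! i\<^esub> x \<oplus>\<^bsub>Vs ! i\<^esub> b \<odot>\<^bsub>Vs ! i\<^esub> y]) =
    a \<odot>\<^bsub>tensor_list Vs\<^esub> pure_tensor Vs (xs[i := x]) \<oplus>\<^bsub>tensor_list Vs\<^esub>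
    b \<odot>\<^bsub>tensor_list Vs\<^esub> pure_tensor Vs (xs[i := y])"
proof -
  let ?s = "\<lambda>z c. Poly_Mapping.single (xs[i := z]) c"
  let ?z = "a \<odot>\<^bsub>Vs ! i\<^esub> x \<oplus>\<^bsub>Vs ! i\<^esub> b \<odot>\<^bsub>Vs ! i\<^esub> y"
  have cl: "?s z c \<in> carrier (free_tuples Vs)" if "z \<in> carrier (Vs ! i)" for z c
    by (intro single_closed tuple_update xs i that)
  have sm: "c \<odot>\<^bsub>free_tuples Vs\<^esub> ?s z 1 = ?s z c" for c z
    by (simp add: free_tuples_def map_mult_single)
  have ad: "f \<oplus>\<^bsub>free_tuples Vs\<^esub> g = f + g" for f g
    by (simp add: free_tuples_def)
  have minus: "f \<ominus>\<^bsub>free_tuples Vs\<^esub> g = f - g"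
    if "f \<in> carrier (free_tuples Vs)" "g \<in> carrier (free_tuples Vs)" for f g
    using that unfolding free_tuples_def by (rule free_minus)
  have "?s ?z 1 - ?s x a - ?s y b \<in> multilinear_gens Vs"
    using xs i x y unfolding multilinear_gens_def by blast
  then have "?s ?z 1 - (?s x a + ?s y b) \<in> multilinear_rels Vs"
    using free.span_base[OF gens_closed] by (simp add: multilinear_rels_span diff_diff_eq)
  moreover have z: "?z \<in> carrier (Vs ! i)" by (intro lincomb_closed i x y)
  moreover have "?s x a + ?s y b \<in> carrier (free_tuples Vs)"
    using free.a_closed[OF cl[OF x, of a] cl[OF y, of b]] by (simp add: ad)
  ultimately have "multilinear_rels Vs +>\<^bsub>free_tuples Vs\<^esub> ?s ?z 1
      = multilinear_rels Vs +>\<^bsub>free_tuples Vs\<^esub> (?s x a + ?s y b)"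
    unfolding free.coset_eq_iff[OF cl[OF z] \<open>?s x a + ?s y b \<in> carrier (free_tuples Vs)\<close>]
    by (simp only: minus[OF cl[OF z]])
  also have "\<dots> = (multilinear_rels Vs +>\<^bsub>free_tuples Vs\<^esub> ?s x a) \<oplus>\<^bsub>tensor_list Vs\<^esub>
      (multilinear_rels Vs +>\<^bsub>free_tuples Vs\<^esub> ?s y b)"
    unfolding tensor_list_def free.quot_add[OF cl[OF x] cl[OF y]] ad ..
  also have "multilinear_rels Vs +>\<^bsub>free_tuples Vs\<^esub> ?s x a =
      a \<odot>\<^bsub>tensor_list Vs\<^esub> (multilinear_rels Vs +>\<^bsub>free_tuples Vs\<^esub> ?s x 1)"
    unfolding tensor_list_def free.quot_smult[OF cl[OF x]] sm ..
  also have "multilinear_rels Vs +>\<^bsub>free_tuples Vs\<^esub> ?s y b =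
      b \<odot>\<^bsub>tensor_list Vs\<^esub> (multilinear_rels Vs +>\<^bsub>free_tuples Vs\<^esub> ?s y 1)"
    unfolding tensor_list_def free.quot_smult[OF cl[OF y]] sm ..
  finally show ?thesis unfolding pure_tensor_def .
qed

lemma tensor_span_pure:
  "vs_span (tensor_list Vs) (pure_tensor Vs ` listset (map carrier Vs)) = carrier (tensor_list Vs)"
proof -
  have "vs_span (free_tuples Vs) ((\<lambda>xs. Poly_Mapping.single xs 1) ` listset (map carrier Vs))
      = carrier (free_tuples Vs)"
    unfolding free_tuples_def by (rule free_span)
  moreover have "(\<lambda>xs. Poly_Mapping.single xs 1) ` listset (map carrier Vs) \<subseteq> carrier (free_tuples Vs)"
    by (auto simp: single_closed simp del: single_one)
  ultimately have "vs_span (quot_rep (free_tuples Vs) (multilinear_rels Vs))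
      ((\<lambda>x. multilinear_rels Vs +>\<^bsub>free_tuples Vs\<^esub> x) `
        (\<lambda>xs. Poly_Mapping.single xs 1) ` listset (map carrier Vs))
    = carrier (quot_rep (free_tuples Vs) (multilinear_rels Vs))"
    by (intro free.quot_span)
  then show ?thesis
    unfolding image_image pure_tensor_def tensor_list_def .
qed

lemma tensor_span:
  assumes S: "length Ss = length Vs"
    "\<And>i. i < length Vs \<Longrightarrow> Ss ! i \<subseteq> carrier (Vs ! i)"
    "\<And>i. i < length Vs \<Longrightarrow> vs_span (Vs ! i) (Ss ! i) = carrier (Vs ! i)"
  shows "vs_span (tensor_list Vs) (pure_tensor Vs ` listset Ss) = carrier (tensor_list Vs)"
proof -
  interpret T: kspace "tensor_list Vs" by (rule tensor_kspace)
  let ?W = "vs_span (tensor_list Vs) (pure_tensor Vs ` listset Ss)"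
  have sub: "pure_tensor Vs ` listset Ss \<subseteq> carrier (tensor_list Vs)"
    using S(1,2) by (intro image_subsetI pure_tensor_closed) (fastforce simp: tuple_iff mem_listset_iff)
  \<comment> \<open>The slots are treated one at a time: those from \<open>k\<close> on already hold
    members of the spanning sets, those before \<open>k\<close> are arbitrary.\<close>
  have "pure_tensor Vs xs \<in> ?W"
    if "k \<le> length Vs" "xs \<in> listset (map carrier Vs)" "\<And>i. k \<le> i \<Longrightarrow> i < length Vs \<Longrightarrow> xs ! i \<in> Ss ! i"
    for k xs
    using that
  proof (induction k arbitrary: xs)
    case 0
    then show ?case using T.span_base[OF sub] S(1) by (auto simp: mem_listset_iff)
  next
    case (Suc k)
    then have k: "k < length Vs" by simp
    interpret K: kspace "Vs ! k" by (rule kspace_nth[OF k])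
    have lin: "pure_tensor Vs (xs[k := a \<odot>\<^bsub>Vs ! k\<^esub> x \<oplus>\<^bsub>Vs ! k\<^esub> b \<odot>\<^bsub>Vs ! k\<^esub> y]) \<in> ?W"
      if "x \<in> carrier (Vs ! k)" "y \<in> carrier (Vs ! k)"
        "pure_tensor Vs (xs[k := x]) \<in> ?W" "pure_tensor Vs (xs[k := y]) \<in> ?W" for a b x y
      unfolding pure_tensor_linear[OF Suc.prems(2) k that(1,2)]
      by (intro T.span_add T.span_smult sub that)
    have "pure_tensor Vs (xs[k := x]) \<in> ?W" if "x \<in> vs_span (Vs ! k) (Ss ! k)" for x
      using that S(2)[OF k]
    proof (induction rule: K.span_gen_induct)
      case zero
      \<comment> \<open>Linearity is available for combinations of two terms, so the zero vector is
        written as one.\<close>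
      have "pure_tensor Vs (xs[k := \<zero>\<^bsub>Vs ! k\<^esub>]) =
        pure_tensor Vs (xs[k := 0 \<odot>\<^bsub>Vs ! k\<^esub> \<zero>\<^bsub>Vs ! k\<^esub> \<oplus>\<^bsub>Vs ! k\<^esub> 0 \<odot>\<^bsub>Vs ! k\<^esub> \<zero>\<^bsub>Vs ! k\<^esub>])"
        by simp
      also have "\<dots> = \<zero>\<^bsub>tensor_list Vs\<^esub>"
        by (subst pure_tensor_linear[OF Suc.prems(2) k])
          (simp_all add: pure_tensor_closed tuple_update[OF Suc.prems(2) k])
      finally show ?case using T.span_zero[OF sub] by simp
    next
      case (gen x)
      then have "x \<in> carrier (Vs ! k)" using S(2)[OF k] by blast
      then show ?case
        using Suc.prems gen k
        by (intro Suc.IH tuple_update) (auto simp: nth_list_update tuple_iff)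
    next
      case (add x y)
      then show ?case using lin[of x y 1 1] by simp
    next
      case (smult a x)
      then show ?case using lin[of x x a 0] by simp
    qed
    from this[of "xs ! k"] show ?case using Suc.prems S(3)[OF k] k by (simp add: tuple_iff)
  qed
  from this[of "length Vs"] have "pure_tensor Vs ` listset (map carrier Vs) \<subseteq> ?W" by auto
  then have "carrier (tensor_list Vs) \<subseteq> ?W"
    using T.span_minimal[OF T.span_submodule[OF sub]] tensor_span_pure by blast
  then show ?thesis using T.span_closed[OF sub] by blast
qed

end

context scalar_extension begin

text \<open>The universal property of the tensor product, for maps into the extension field:
  multilinearity says exactly that the linear extension of \<open>F\<close> kills the generators of
  the relations.\<close>

lemma
  assumes Vs: "kspaces Vs" and F: "multilinear Vs F"
  shows tensor_val_functional: "functional (tensor_list Vs) (tensor_val F)"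
    and tensor_val_pure: "xs \<in> listset (map carrier Vs) \<Longrightarrow> tensor_val F (pure_tensor Vs xs) = F xs"
proof -
  interpret kspaces Vs by (rule Vs)
  have fnl: "functional (free_tuples Vs) (free_val F)"
    unfolding free_tuples_def by (rule free_val_functional)
  have gen: "free_val F u = 0" if "u \<in> multilinear_gens Vs" for u
    using that F by (auto simp: multilinear_gens_def multilinear_def free_val_diff)
  have zero: "free_val F u = 0" if "u \<in> multilinear_rels Vs" for u
    using functional_eq_on_span[OF _ fnl functional_0 gens_closed] that gen free.kspace_axioms
    by (auto simp: multilinear_rels_span)
  show "functional (tensor_list Vs) (tensor_val F)"
    unfolding tensor_list_def tensor_val_def
    by (rule coset_val_functional[OF free.kspace_axioms free.U fnl zero])
  show "tensor_val F (pure_tensor Vs xs) = F xs" if "xs \<in> listset (map carrier Vs)"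
    unfolding tensor_val_def pure_tensor_def
    by (subst coset_val[OF free.kspace_axioms free.U fnl zero]) (simp_all add: single_closed that)
qed

end

section \<open>Group actions on tensor products of lists\<close>

lemma kspaces_representation: "(\<And>V. V \<in> set Vs \<Longrightarrow> representation G V) \<Longrightarrow> kspaces Vs"
  by (rule kspaces.intro) (rule representation_kspace)

lemma
  assumes G: "group G" and Vs: "\<And>V. V \<in> set Vs \<Longrightarrow> representation G V"
  shows tensor_representation: "representation G (tensor_list Vs)"
    and act_pure_tensor: "\<And>g xs. g \<in> carrier G \<Longrightarrow> xs \<in> listset (map carrier Vs) \<Longrightarrow>
      act (tensor_list Vs) g (pure_tensor Vs xs) = pure_tensor Vs (map2 (\<lambda>V x. act V g x) Vs xs)"
proof -
  interpret kspaces Vs by (rule kspaces_representation[OF Vs])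
  have rep: "representation G (Vs ! i)" if "i < length Vs" for i using Vs that by simp
  have hom: "act (Vs ! i) g \<in> LinearCombinations.module_hom class_ring (Vs ! i) (Vs ! i)"
    if "i < length Vs" "g \<in> carrier G" for i g
    using representation.act_linear[OF rep] that by blast
  let ?h = "\<lambda>g xs. map2 (\<lambda>V x. act V g x) Vs xs"
  have cl: "?h g xs \<in> listset (map carrier Vs)"
    if "g \<in> carrier G" "xs \<in> listset (map carrier Vs)" for g xs
    using that hom_k_closed[OF hom] by (auto simp: tuple_iff)
  have free: "representation G (free_tuples Vs)"
    unfolding free_tuples_def
  proof (rule free_representation[OF G])
    fix g assume "g \<in> carrier G"
    then show "?h g xs \<in> listset (map carrier Vs)" if "xs \<in> listset (map carrier Vs)" for xs
      using cl that by blast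
  next
    show "?h \<one>\<^bsub>G\<^esub> xs = xs" if "xs \<in> listset (map carrier Vs)" for xs
      using that representation.act_one[OF rep] by (auto simp: tuple_iff intro: nth_equalityI)
    show "?h (g \<otimes>\<^bsub>G\<^esub> g') xs = ?h g (?h g' xs)"
      if "g \<in> carrier G" "g' \<in> carrier G" "xs \<in> listset (map carrier Vs)" for g g' xs
      using that representation.act_mult[OF rep] by (auto simp: tuple_iff intro: nth_equalityI)
  qed
  have act: "act (free_tuples Vs) g = push (?h g)" for g by (simp add: free_tuples_def)
  \<comment> \<open>A group element maps each generator of the relations to a generator, with the
    same scalars; hence the span of the generators is invariant.\<close>
  have gens: "act (free_tuples Vs) g u \<in> multilinear_gens Vs"
    if g: "g \<in> carrier G" and u: "u \<in> multilinear_gens Vs" for g u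
  proof -
    obtain xs i a b x y where xs: "xs \<in> listset (map carrier Vs)" "i < length Vs"
      "x \<in> carrier (Vs ! i)" "y \<in> carrier (Vs ! i)"
      and u: "u = Poly_Mapping.single (xs[i := a \<odot>\<^bsub>Vs ! i\<^esub> x \<oplus>\<^bsub>Vs ! i\<^esub> b \<odot>\<^bsub>Vs ! i\<^esub> y]) 1
       - Poly_Mapping.single (xs[i := x]) a - Poly_Mapping.single (xs[i := y]) b"
      using u unfolding multilinear_gens_def by blast
    have upd: "?h g (xs[i := z]) = (?h g xs)[i := act (Vs ! i) g z]" for z
      using xs by (auto simp: tuple_iff nth_list_update intro!: nth_equalityI)
    interpret K: kspace "Vs ! i" by (rule kspace_nth) (rule xs)
    have "act (Vs ! i) g (a \<odot>\<^bsub>Vs ! i\<^esub> x \<oplus>\<^bsub>Vs ! i\<^esub> b \<odot>\<^bsub>Vs ! i\<^esub> y) =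
      a \<odot>\<^bsub>Vs ! i\<^esub> act (Vs ! i) g x \<oplus>\<^bsub>Vs ! i\<^esub> b \<odot>\<^bsub>Vs ! i\<^esub> act (Vs ! i) g y"
      using xs hom[OF xs(2) g] by (simp add: hom_k_add hom_k_smult)
    then have "act (free_tuples Vs) g u =
      Poly_Mapping.single ((?h g xs)[i := a \<odot>\<^bsub>Vs ! i\<^esub> act (Vs ! i) g x \<oplus>\<^bsub>Vs ! i\<^esub>
          b \<odot>\<^bsub>Vs ! i\<^esub> act (Vs ! i) g y]) 1
       - Poly_Mapping.single ((?h g xs)[i := act (Vs ! i) g x]) a
       - Poly_Mapping.single ((?h g xs)[i := act (Vs ! i) g y]) b"
      by (simp add: u act push_minus upd)
    moreover have "?h g xs \<in> listset (map carrier Vs)" by (rule cl[OF g xs(1)])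
    moreover have "act (Vs ! i) g x \<in> carrier (Vs ! i)" "act (Vs ! i) g y \<in> carrier (Vs ! i)"
      using hom_k_closed[OF hom[OF xs(2) g]] xs by auto
    ultimately show ?thesis using xs(2) unfolding multilinear_gens_def by blast
  qed
  have inv: "act (free_tuples Vs) g u \<in> multilinear_rels Vs"
    if "g \<in> carrier G" "u \<in> multilinear_rels Vs" for g u
    by (rule free.hom_image_span[OF free.kspace_axioms representation.act_linear[OF free that(1)]
          gens_closed free.U])
      (use that gens free.span_base[OF gens_closed] in \<open>auto simp: multilinear_rels_span\<close>)
  show "representation G (tensor_list Vs)"
    unfolding tensor_list_def by (rule quot_representation[OF free free.U inv])
  show "act (tensor_list Vs) g (pure_tensor Vs xs) = pure_tensor Vs (?h g xs)"
    if "g \<in> carrier G" "xs \<in> listset (map carrier Vs)" for g xs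
    unfolding tensor_list_def pure_tensor_def
    by (subst quot_representation(2)[OF free free.U inv]) (auto simp: that single_closed act simp del: single_one)
qed

subsection \<open>Tensor products of two spaces\<close>

definition bilinear_gens ::
  "('k::field, 'v, 'g) rep \<Rightarrow> ('k, 'w, 'g) rep \<Rightarrow> ('v \<times> 'w \<Rightarrow>\<^sub>0 'k) set" where
  "bilinear_gens V W =
    {Poly_Mapping.single (a \<odot>\<^bsub>V\<^esub> x \<oplus>\<^bsub>V\<^esub> b \<odot>\<^bsub>V\<^esub> x', y) 1
        - Poly_Mapping.single (x, y) a - Poly_Mapping.single (x', y) b
      | a b x x' y. x \<in> carrier V \<and> x' \<in> carrier V \<and> y \<in> carrier W} \<union>
     {Poly_Mapping.single (x, a \<odot>\<^bsub>W\<^esub> y \<oplus>\<^bsub>W\<^esub> b \<odot>\<^bsub>W\<^esub> y') 1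
        - Poly_Mapping.single (x, y) a - Poly_Mapping.single (x, y') b
      | a b x y y'. x \<in> carrier V \<and> y \<in> carrier W \<and> y' \<in> carrier W}"

lemma bilinear_rels_span: "bilinear_rels V W = vs_span (free_pairs V W) (bilinear_gens V W)"
  unfolding bilinear_rels_def bilinear_gens_def ..

definition pure_pair ::
  "('k::field, 'v, 'g) rep \<Rightarrow> ('k, 'w, 'g) rep \<Rightarrow> 'v \<Rightarrow> 'w \<Rightarrow> ('v \<times> 'w \<Rightarrow>\<^sub>0 'k) set" where
  "pure_pair V W x y = bilinear_rels V W +>\<^bsub>free_pairs V W\<^esub> Poly_Mapping.single (x, y) 1"

definition (in scalar_extension) bilinear ::
  "('k, 'v, 'g) rep \<Rightarrow> ('k, 'w, 'g) rep \<Rightarrow> ('v \<times> 'w \<Rightarrow> 'l) \<Rightarrow> bool" where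
  "bilinear V W F \<longleftrightarrow>
    (\<forall>y\<in>carrier W. functional V (\<lambda>x. F (x, y))) \<and> (\<forall>x\<in>carrier V. functional W (\<lambda>y. F (x, y)))"

lemma carrier_free_pairs:
  "carrier (free_pairs V W) = {f. Poly_Mapping.keys f \<subseteq> carrier V \<times> carrier W}"
  by (simp add: free_pairs_def)

lemma free_pairs_single_closed:
  "x \<in> carrier V \<Longrightarrow> y \<in> carrier W \<Longrightarrow> Poly_Mapping.single (x, y) c \<in> carrier (free_pairs V W)"
  by (simp add: carrier_free_pairs)

lemma free_pairs_diff_closed:
  assumes "f \<in> carrier (free_pairs V W)" "g \<in> carrier (free_pairs V W)"
  shows "f - g \<in> carrier (free_pairs V W)"
  using assms Poly_Mapping.keys_diff[of f g] by (auto simp: carrier_free_pairs)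

locale kspace_pair = V: kspace V + W: kspace W
  for V :: "('k::field, 'v, 'g) rep" and W :: "('k, 'w, 'g) rep"
begin

lemmas single_closed = free_pairs_single_closed
lemmas diff_closed = free_pairs_diff_closed

lemma gens_closed: "bilinear_gens V W \<subseteq> carrier (free_pairs V W)"
proof
  fix f assume "f \<in> bilinear_gens V W"
  then consider a b x x' y where "x \<in> carrier V" "x' \<in> carrier V" "y \<in> carrier W"
      "f = Poly_Mapping.single (a \<odot>\<^bsub>V\<^esub> x \<oplus>\<^bsub>V\<^esub> b \<odot>\<^bsub>V\<^esub> x', y) 1
        - Poly_Mapping.single (x, y) a - Poly_Mapping.single (x', y) b"
    | a b x y y' where "x \<in> carrier V" "y \<in> carrier W" "y' \<in> carrier W"
      "f = Poly_Mapping.single (x, a \<odot>\<^bsub>W\<^esub> y \<oplus>\<^bsub>W\<^esub> b \<odot>\<^bsub>W\<^esub> y') 1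
        - Poly_Mapping.single (x, y) a - Poly_Mapping.single (x, y') b"
    unfolding bilinear_gens_def by blast
  then show "f \<in> carrier (free_pairs V W)"
  proof cases
    case 1
    show ?thesis unfolding 1(4)
      by (intro diff_closed single_closed V.a_closed V.smult_closed' 1(1-3))
  next
    case 2
    show ?thesis unfolding 2(4)
      by (intro diff_closed single_closed W.a_closed W.smult_closed' 2(1-3))
  qed
qed

sublocale free: kspace "free_pairs V W"
  unfolding free_pairs_def by (rule free_kspace)

sublocale free: kspace_sub "free_pairs V W" "bilinear_rels V W"
  unfolding bilinear_rels_span
  by (intro kspace_sub.intro kspace_sub_axioms.intro free.span_submodule gens_closed
      free.kspace_axioms)

lemma tensor_kspace: "kspace (tensor_prod V W)"
  unfolding tensor_prod_def by (rule free.quot_kspace)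

lemma pure_pair_closed:
  "x \<in> carrier V \<Longrightarrow> y \<in> carrier W \<Longrightarrow> pure_pair V W x y \<in> carrier (tensor_prod V W)"
  unfolding tensor_prod_def pure_pair_def by (intro free.quot_closed single_closed)

text \<open>Formulated with pairs instead of components, so that one computation yields linearity in
  both factors.\<close>

lemma pair_relation:
  assumes gen: "Poly_Mapping.single p 1 - Poly_Mapping.single q a - Poly_Mapping.single q' b
      \<in> bilinear_gens V W"
    and cl: "p \<in> carrier V \<times> carrier W" "q \<in> carrier V \<times> carrier W" "q' \<in> carrier V \<times> carrier W"
  shows "pure_pair V W (fst p) (snd p) =
    a \<odot>\<^bsub>tensor_prod V W\<^esub> pure_pair V W (fst q) (snd q) \<oplus>\<^bsub>tensor_prod V W\<^esub>
    b \<odot>\<^bsub>tensor_prod V W\<^esub> pure_pair V W (fst q') (snd q')"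
proof -
  have scl: "Poly_Mapping.single z c \<in> carrier (free_pairs V W)"
    if "z \<in> carrier V \<times> carrier W" for z and c :: 'k
    using that single_closed by auto
  have sm: "c \<odot>\<^bsub>free_pairs V W\<^esub> Poly_Mapping.single z 1 = Poly_Mapping.single z c" for c z
    by (simp add: free_pairs_def map_mult_single)
  have ad: "f \<oplus>\<^bsub>free_pairs V W\<^esub> g = f + g" for f g
    by (simp add: free_pairs_def)
  have minus: "f \<ominus>\<^bsub>free_pairs V W\<^esub> g = f - g"
    if "f \<in> carrier (free_pairs V W)" "g \<in> carrier (free_pairs V W)" for f g
    using that unfolding free_pairs_def by (rule free_minus)
  have sum: "Poly_Mapping.single q a + Poly_Mapping.single q' b \<in> carrier (free_pairs V W)"
    using free.a_closed[OF scl[OF cl(2), of a] scl[OF cl(3), of b]] by (simp only: ad)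
  have "Poly_Mapping.single p 1 - (Poly_Mapping.single q a + Poly_Mapping.single q' b)
      \<in> bilinear_rels V W"
    using free.span_base[OF gens_closed gen] unfolding bilinear_rels_span by (simp only: diff_diff_eq)
  then have "bilinear_rels V W +>\<^bsub>free_pairs V W\<^esub> Poly_Mapping.single p 1 =
      bilinear_rels V W +>\<^bsub>free_pairs V W\<^esub> (Poly_Mapping.single q a + Poly_Mapping.single q' b)"
    unfolding free.coset_eq_iff[OF scl[OF cl(1)] sum] minus[OF scl[OF cl(1)] sum] .
  also have "\<dots> = (bilinear_rels V W +>\<^bsub>free_pairs V W\<^esub> Poly_Mapping.single q a) \<oplus>\<^bsub>tensor_prod V W\<^esub>
      (bilinear_rels V W +>\<^bsub>free_pairs V W\<^esub> Poly_Mapping.single q' b)"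
    unfolding tensor_prod_def free.quot_add[OF scl[OF cl(2)] scl[OF cl(3)]] ad ..
  also have "bilinear_rels V W +>\<^bsub>free_pairs V W\<^esub> Poly_Mapping.single q a =
      a \<odot>\<^bsub>tensor_prod V W\<^esub> (bilinear_rels V W +>\<^bsub>free_pairs V W\<^esub> Poly_Mapping.single q 1)"
    unfolding tensor_prod_def free.quot_smult[OF scl[OF cl(2)]] sm ..
  also have "bilinear_rels V W +>\<^bsub>free_pairs V W\<^esub> Poly_Mapping.single q' b =
      b \<odot>\<^bsub>tensor_prod V W\<^esub> (bilinear_rels V W +>\<^bsub>free_pairs V W\<^esub> Poly_Mapping.single q' 1)"
    unfolding tensor_prod_def free.quot_smult[OF scl[OF cl(3)]] sm ..
  finally show ?thesis unfolding pure_pair_def prod.collapse .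
qed

lemma pure_pair_linear_left:
  assumes "x \<in> carrier V" "x' \<in> carrier V" "y \<in> carrier W"
  shows "pure_pair V W (a \<odot>\<^bsub>V\<^esub> x \<oplus>\<^bsub>V\<^esub> b \<odot>\<^bsub>V\<^esub> x') y =
    a \<odot>\<^bsub>tensor_prod V W\<^esub> pure_pair V W x y \<oplus>\<^bsub>tensor_prod V W\<^esub>
    b \<odot>\<^bsub>tensor_prod V W\<^esub> pure_pair V W x' y"
proof -
  have "Poly_Mapping.single (a \<odot>\<^bsub>V\<^esub> x \<oplus>\<^bsub>V\<^esub> b \<odot>\<^bsub>V\<^esub> x', y) 1
        - Poly_Mapping.single (x, y) a - Poly_Mapping.single (x', y) b \<in> bilinear_gens V W"
    unfolding bilinear_gens_def using assms by blast
  from pair_relation[OF this] show ?thesis using assms by simp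
qed

lemma pure_pair_linear_right:
  assumes "x \<in> carrier V" "y \<in> carrier W" "y' \<in> carrier W"
  shows "pure_pair V W x (a \<odot>\<^bsub>W\<^esub> y \<oplus>\<^bsub>W\<^esub> b \<odot>\<^bsub>W\<^esub> y') =
    a \<odot>\<^bsub>tensor_prod V W\<^esub> pure_pair V W x y \<oplus>\<^bsub>tensor_prod V W\<^esub>
    b \<odot>\<^bsub>tensor_prod V W\<^esub> pure_pair V W x y'"
proof -
  have "Poly_Mapping.single (x, a \<odot>\<^bsub>W\<^esub> y \<oplus>\<^bsub>W\<^esub> b \<odot>\<^bsub>W\<^esub> y') 1
        - Poly_Mapping.single (x, y) a - Poly_Mapping.single (x, y') b \<in> bilinear_gens V W"
    unfolding bilinear_gens_def using assms by blast
  from pair_relation[OF this] show ?thesis using assms by simp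
qed

lemma pure_pair_hom_left:
  assumes "y \<in> carrier W"
  shows "(\<lambda>x. pure_pair V W x y) \<in> LinearCombinations.module_hom class_ring V (tensor_prod V W)"
proof -
  interpret T: kspace "tensor_prod V W" by (rule tensor_kspace)
  show ?thesis
  proof (rule hom_kI)
    show "pure_pair V W (x \<oplus>\<^bsub>V\<^esub> y') y = pure_pair V W x y \<oplus>\<^bsub>tensor_prod V W\<^esub> pure_pair V W y' y"
      if "x \<in> carrier V" "y' \<in> carrier V" for x y'
      using pure_pair_linear_left[OF that assms, of 1 1] that by (simp add: pure_pair_closed assms)
    show "pure_pair V W (a \<odot>\<^bsub>V\<^esub> x) y = a \<odot>\<^bsub>tensor_prod V W\<^esub> pure_pair V W x y"
      if "x \<in> carrier V" for a x
      using pure_pair_linear_left[OF that that assms, of a 0] that by (simp add: pure_pair_closed assms)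
  qed (intro pure_pair_closed assms)
qed

lemma pure_pair_hom_right:
  assumes "x \<in> carrier V"
  shows "(\<lambda>y. pure_pair V W x y) \<in> LinearCombinations.module_hom class_ring W (tensor_prod V W)"
proof -
  interpret T: kspace "tensor_prod V W" by (rule tensor_kspace)
  show ?thesis
  proof (rule hom_kI)
    show "pure_pair V W x (y \<oplus>\<^bsub>W\<^esub> y') = pure_pair V W x y \<oplus>\<^bsub>tensor_prod V W\<^esub> pure_pair V W x y'"
      if "y \<in> carrier W" "y' \<in> carrier W" for y y'
      using pure_pair_linear_right[OF assms that, of 1 1] that by (simp add: pure_pair_closed assms)
    show "pure_pair V W x (a \<odot>\<^bsub>W\<^esub> y) = a \<odot>\<^bsub>tensor_prod V W\<^esub> pure_pair V W x y"
      if "y \<in> carrier W" for a y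
      using pure_pair_linear_right[OF assms that that, of a 0] that by (simp add: pure_pair_closed assms)
  qed (intro pure_pair_closed assms)
qed

lemma pair_span:
  assumes S: "S \<subseteq> carrier V" "vs_span V S = carrier V"
    and T: "T \<subseteq> carrier W" "vs_span W T = carrier W"
  shows "vs_span (tensor_prod V W) {pure_pair V W x y | x y. x \<in> S \<and> y \<in> T}
    = carrier (tensor_prod V W)"
proof -
  interpret P: kspace "tensor_prod V W" by (rule tensor_kspace)
  let ?E = "{pure_pair V W x y | x y. x \<in> S \<and> y \<in> T}"
  let ?A = "(\<lambda>p. Poly_Mapping.single p (1::'k)) ` (carrier V \<times> carrier W)"
  have E: "?E \<subseteq> carrier (tensor_prod V W)"
    using S(1) T(1) by (auto intro!: pure_pair_closed)
  \<comment> \<open>The right factor is freed first, with the left one still in \<open>S\<close>;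
    the left factor follows in the next step.\<close>
  have 1: "pure_pair V W x y \<in> vs_span (tensor_prod V W) ?E" if "x \<in> S" "y \<in> carrier W" for x y
  proof (rule W.hom_image_span[OF tensor_kspace pure_pair_hom_right T(1) P.span_submodule[OF E]])
    show "x \<in> carrier V" using that S by blast
    show "(\<lambda>y. pure_pair V W x y) ` T \<subseteq> vs_span (tensor_prod V W) ?E"
      using P.span_base[OF E] that by blast
  qed (use that T in blast)
  have 2: "pure_pair V W x y \<in> vs_span (tensor_prod V W) ?E" if "x \<in> carrier V" "y \<in> carrier W" for x y
  proof (rule V.hom_image_span[OF tensor_kspace pure_pair_hom_left S(1) P.span_submodule[OF E]])
    show "(\<lambda>x. pure_pair V W x y) ` S \<subseteq> vs_span (tensor_prod V W) ?E"
      using 1 that by blast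
  qed (use that S in blast)+
  have "vs_span (free_pairs V W) ?A = carrier (free_pairs V W)"
    unfolding free_pairs_def by (rule free_span)
  moreover have "?A \<subseteq> carrier (free_pairs V W)"
    unfolding carrier_free_pairs by auto
  ultimately have "vs_span (tensor_prod V W) ((\<lambda>x. bilinear_rels V W +>\<^bsub>free_pairs V W\<^esub> x) ` ?A)
    = carrier (tensor_prod V W)"
    unfolding tensor_prod_def by (intro free.quot_span)
  moreover have "bilinear_rels V W +>\<^bsub>free_pairs V W\<^esub> Poly_Mapping.single p 1
      \<in> vs_span (tensor_prod V W) ?E" if "p \<in> carrier V \<times> carrier W" for p
    using 2[of "fst p" "snd p"] that by (simp only: pure_pair_def mem_Times_iff prod.collapse)
  then have "(\<lambda>x. bilinear_rels V W +>\<^bsub>free_pairs V W\<^esub> x) ` ?A \<subseteq> vs_span (tensor_prod V W) ?E"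
    unfolding image_image by (rule image_subsetI)
  note P.span_minimal[OF P.span_submodule[OF E] this]
  ultimately have "carrier (tensor_prod V W) \<subseteq> vs_span (tensor_prod V W) ?E"
    by (simp only:)
  then show ?thesis by (intro subset_antisym P.span_is_subset2 E)
qed

end

context scalar_extension begin

lemma
  assumes VW: "kspace_pair V W" and F: "bilinear V W F"
  shows pair_val_functional: "functional (tensor_prod V W) (coset_val (free_val F))"
    and pair_val_pure: "x \<in> carrier V \<Longrightarrow> y \<in> carrier W \<Longrightarrow>
      coset_val (free_val F) (pure_pair V W x y) = F (x, y)"
proof -
  interpret kspace_pair V W by (rule VW)
  have fnl: "functional (free_pairs V W) (free_val F)"
    unfolding free_pairs_def by (rule free_val_functional)
  have left: "F (a \<odot>\<^bsub>V\<^esub> x \<oplus>\<^bsub>V\<^esub> b \<odot>\<^bsub>V\<^esub> x', y) = \<kappa> a * F (x, y) + \<kappa> b * F (x', y)"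
    if "x \<in> carrier V" "x' \<in> carrier V" "y \<in> carrier W" for a b x x' y
    using F that by (auto simp: bilinear_def functional_def)
  have right: "F (x, a \<odot>\<^bsub>W\<^esub> y \<oplus>\<^bsub>W\<^esub> b \<odot>\<^bsub>W\<^esub> y') = \<kappa> a * F (x, y) + \<kappa> b * F (x, y')"
    if "x \<in> carrier V" "y \<in> carrier W" "y' \<in> carrier W" for a b x y y'
    using F that by (auto simp: bilinear_def functional_def)
  have gen: "free_val F u = 0" if "u \<in> bilinear_gens V W" for u
    using that by (auto simp: bilinear_gens_def free_val_diff left right)
  have zero: "free_val F u = 0" if "u \<in> bilinear_rels V W" for u
    by (rule functional_eq_on_span[OF free.kspace_axioms fnl functional_0 gens_closed])
      (use that gen in \<open>auto simp: bilinear_rels_span\<close>)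
  show "functional (tensor_prod V W) (coset_val (free_val F))"
    unfolding tensor_prod_def
    by (rule coset_val_functional[OF free.kspace_axioms free.U fnl zero])
  show "coset_val (free_val F) (pure_pair V W x y) = F (x, y)"
    if "x \<in> carrier V" "y \<in> carrier W"
    unfolding pure_pair_def
    by (subst coset_val[OF free.kspace_axioms free.U fnl zero]) (simp_all add: single_closed that)
qed

end

lemma
  assumes V: "representation G V" and W: "representation G W"
  shows tensor_prod_representation: "representation G (tensor_prod V W)"
    and act_pure_pair: "\<And>g x y. g \<in> carrier G \<Longrightarrow> x \<in> carrier V \<Longrightarrow> y \<in> carrier W \<Longrightarrow>
      act (tensor_prod V W) g (pure_pair V W x y) = pure_pair V W (act V g x) (act W g y)"
proof -
  interpret kspace_pair V W
    by (intro kspace_pair.intro representation_kspace[OF V] representation_kspace[OF W])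
  interpret RV: representation G V by (rule V)
  interpret RW: representation G W by (rule W)
  note homV = RV.act_linear and homW = RW.act_linear
  have free: "representation G (free_pairs V W)"
    unfolding free_pairs_def
    by (rule free_representation)
      (auto simp: RV.group RV.act_one RW.act_one RV.act_mult RW.act_mult hom_k_closed[OF homV]
        hom_k_closed[OF homW])
  have act: "act (free_pairs V W) g = push (\<lambda>(x, y). (act V g x, act W g y))" for g
    by (simp add: free_pairs_def)
  have gens: "act (free_pairs V W) g u \<in> bilinear_gens V W"
    if g: "g \<in> carrier G" and u: "u \<in> bilinear_gens V W" for g u
    using u unfolding bilinear_gens_def
  proof (elim UnE, goal_cases)
    case 1
    then obtain a b x x' y where *: "x \<in> carrier V" "x' \<in> carrier V" "y \<in> carrier W"
      and u: "u = Poly_Mapping.single (a \<odot>\<^bsub>V\<^esub> x \<oplus>\<^bsub>V\<^esub> b \<odot>\<^bsub>V\<^esub> x', y) 1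
        - Poly_Mapping.single (x, y) a - Poly_Mapping.single (x', y) b" by blast
    have "act (free_pairs V W) g u =
      Poly_Mapping.single (a \<odot>\<^bsub>V\<^esub> act V g x \<oplus>\<^bsub>V\<^esub> b \<odot>\<^bsub>V\<^esub> act V g x', act W g y) 1
        - Poly_Mapping.single (act V g x, act W g y) a - Poly_Mapping.single (act V g x', act W g y) b"
      using * by (simp add: u act push_minus hom_k_add[OF homV[OF g]] hom_k_smult[OF homV[OF g]])
    moreover have "act V g x \<in> carrier V" "act V g x' \<in> carrier V" "act W g y \<in> carrier W"
      using * hom_k_closed[OF homV[OF g]] hom_k_closed[OF homW[OF g]] by auto
    ultimately show ?case by blast
  next
    case 2
    then obtain a b x y y' where *: "x \<in> carrier V" "y \<in> carrier W" "y' \<in> carrier W"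
      and u: "u = Poly_Mapping.single (x, a \<odot>\<^bsub>W\<^esub> y \<oplus>\<^bsub>W\<^esub> b \<odot>\<^bsub>W\<^esub> y') 1
        - Poly_Mapping.single (x, y) a - Poly_Mapping.single (x, y') b" by blast
    have "act (free_pairs V W) g u =
      Poly_Mapping.single (act V g x, a \<odot>\<^bsub>W\<^esub> act W g y \<oplus>\<^bsub>W\<^esub> b \<odot>\<^bsub>W\<^esub> act W g y') 1
        - Poly_Mapping.single (act V g x, act W g y) a - Poly_Mapping.single (act V g x, act W g y') b"
      using * by (simp add: u act push_minus hom_k_add[OF homW[OF g]] hom_k_smult[OF homW[OF g]])
    moreover have "act V g x \<in> carrier V" "act W g y \<in> carrier W" "act W g y' \<in> carrier W"
      using * hom_k_closed[OF homV[OF g]] hom_k_closed[OF homW[OF g]] by auto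
    ultimately show ?case by blast
  qed
  have inv: "act (free_pairs V W) g u \<in> bilinear_rels V W"
    if "g \<in> carrier G" "u \<in> bilinear_rels V W" for g u
    by (rule free.hom_image_span[OF free.kspace_axioms representation.act_linear[OF free that(1)]
          gens_closed free.U])
      (use that gens free.span_base[OF gens_closed] in \<open>auto simp: bilinear_rels_span\<close>)
  show "representation G (tensor_prod V W)"
    unfolding tensor_prod_def by (rule quot_representation[OF free free.U inv])
  show "act (tensor_prod V W) g (pure_pair V W x y) = pure_pair V W (act V g x) (act W g y)"
    if "g \<in> carrier G" "x \<in> carrier V" "y \<in> carrier W" for g x y
    unfolding tensor_prod_def pure_pair_def
    by (subst quot_representation(2)[OF free free.U inv])
      (auto simp: that single_closed act simp del: single_one)
qed


subsection \<open>Tensor powers, symmetric and exterior powers\<close>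

text \<open>Entry j of \<open>permute_list \<sigma> xs\<close> is entry \<open>\<sigma> j\<close> of
  \<open>xs\<close>, so what stood at place i moves to the preimage of i.\<close>

lemma permute_list_update:
  assumes "\<sigma> permutes {..<length xs}" "i < length xs"
  shows "permute_list \<sigma> (xs[i := x]) = (permute_list \<sigma> xs)[inv_into UNIV \<sigma> i := x]"
proof (rule nth_equalityI)
  fix j assume "j < length (permute_list \<sigma> (xs[i := x]))"
  then have j: "j < length xs" by simp
  have "\<sigma> j = i \<longleftrightarrow> inv_into UNIV \<sigma> i = j" using permutes_inv_eq[OF assms(1)] by metis
  then show "permute_list \<sigma> (xs[i := x]) ! j = (permute_list \<sigma> xs)[inv_into UNIV \<sigma> i := x] ! j"
    using j assms permutes_in_image[OF assms(1), of j]
    by (auto simp: permute_list_nth nth_list_update)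
qed simp

lemma multilinear_gensI:
  assumes "xs \<in> listset (map carrier Vs)" "i < length Vs"
    "x \<in> carrier (Vs ! i)" "y \<in> carrier (Vs ! i)"
  shows "Poly_Mapping.single (xs[i := a \<odot>\<^bsub>Vs ! i\<^esub> x \<oplus>\<^bsub>Vs ! i\<^esub> b \<odot>\<^bsub>Vs ! i\<^esub> y]) 1
     - Poly_Mapping.single (xs[i := x]) a - Poly_Mapping.single (xs[i := y]) b \<in> multilinear_gens Vs"
  unfolding multilinear_gens_def using assms by blast

locale kspace_rep = kspace V for V :: "('k::field, 'v, 'g) rep"
begin

lemma kspaces_replicate: "kspaces (replicate r V)"
  by (rule kspaces.intro) (auto intro: kspace_axioms)

lemma power_kspace: "kspace (tensor_power r V)"
  by (rule kspaces.tensor_kspace) (rule kspaces_replicate)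

lemma power_tuple_iff:
  "xs \<in> listset (map carrier (replicate r V)) \<longleftrightarrow> length xs = r \<and> set xs \<subseteq> carrier V"
  by (auto simp: mem_listset_iff subset_eq all_set_conv_all_nth)

lemma power_pure_closed:
  "length xs = r \<Longrightarrow> set xs \<subseteq> carrier V \<Longrightarrow>
    pure_tensor (replicate r V) xs \<in> carrier (tensor_power r V)"
  using kspaces.pure_tensor_closed[OF kspaces_replicate] by (simp only: power_tuple_iff)

lemma power_pure_linear:
  assumes "length xs = r" "set xs \<subseteq> carrier V" "i < r" "x \<in> carrier V" "y \<in> carrier V"
  shows "pure_tensor (replicate r V) (xs[i := a \<odot>\<^bsub>V\<^esub> x \<oplus>\<^bsub>V\<^esub> b \<odot>\<^bsub>V\<^esub> y]) =
    a \<odot>\<^bsub>tensor_power r V\<^esub> pure_tensor (replicate r V) (xs[i := x]) \<oplus>\<^bsub>tensor_power r V\<^esub>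
    b \<odot>\<^bsub>tensor_power r V\<^esub> pure_tensor (replicate r V) (xs[i := y])"
  using kspaces.pure_tensor_linear[OF kspaces_replicate, of xs r i x y a b]
  unfolding power_tuple_iff length_replicate List.nth_replicate[OF assms(3)] using assms by blast

lemma power_span:
  assumes "S \<subseteq> carrier V" "vs_span V S = carrier V"
  shows "vs_span (tensor_power r V) (pure_tensor (replicate r V) ` {xs. length xs = r \<and> set xs \<subseteq> S})
    = carrier (tensor_power r V)"
proof -
  have "listset (replicate r S) = {xs. length xs = r \<and> set xs \<subseteq> S}"
    by (auto simp: mem_listset_iff subset_eq all_set_conv_all_nth)
  then show ?thesis
    using kspaces.tensor_span[OF kspaces_replicate, of "replicate r S" r] assms by simp
qed

lemma
  assumes \<sigma>: "\<sigma> permutes {..<r}"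
  shows place_perm_hom:
      "place_perm \<sigma> \<in> LinearCombinations.module_hom class_ring (tensor_power r V) (tensor_power r V)"
    and place_perm_pure: "\<And>xs. length xs = r \<Longrightarrow> set xs \<subseteq> carrier V \<Longrightarrow>
      place_perm \<sigma> (pure_tensor (replicate r V) xs) = pure_tensor (replicate r V) (permute_list \<sigma> xs)"
proof -
  interpret T: kspaces "replicate r V" by (rule kspaces_replicate)
  let ?F = "free_tuples (replicate r V)"
  have mem: "permute_list \<sigma> xs \<in> listset (map carrier (replicate r V))"
    if "xs \<in> listset (map carrier (replicate r V))" "\<sigma> permutes {..<r}" for xs \<sigma>
    using that unfolding power_tuple_iff by auto
  have hom: "push (permute_list \<sigma>) \<in> LinearCombinations.module_hom class_ring ?F ?F"
    if "\<sigma> permutes {..<r}" for \<sigma>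
    unfolding free_tuples_def by (rule push_hom) (rule mem[OF _ that])
  have gens: "push (permute_list \<sigma>) u \<in> multilinear_gens (replicate r V)"
    if \<sigma>: "\<sigma> permutes {..<r}" and u: "u \<in> multilinear_gens (replicate r V)" for \<sigma> u
  proof -
    obtain xs i a b x y where xs: "xs \<in> listset (map carrier (replicate r V))" "i < r"
      "x \<in> carrier V" "y \<in> carrier V"
      and u: "u = Poly_Mapping.single (xs[i := a \<odot>\<^bsub>V\<^esub> x \<oplus>\<^bsub>V\<^esub> b \<odot>\<^bsub>V\<^esub> y]) 1
       - Poly_Mapping.single (xs[i := x]) a - Poly_Mapping.single (xs[i := y]) b"
      using u unfolding multilinear_gens_def by auto
    have i': "inv_into UNIV \<sigma> i < r" using permutes_in_image[OF permutes_inv[OF \<sigma>], of i] xs(2) by simp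
    have len: "length xs = r" using xs(1) by (simp only: power_tuple_iff)
    have "push (permute_list \<sigma>) u =
      Poly_Mapping.single ((permute_list \<sigma> xs)[inv_into UNIV \<sigma> i := a \<odot>\<^bsub>V\<^esub> x \<oplus>\<^bsub>V\<^esub> b \<odot>\<^bsub>V\<^esub> y]) 1
       - Poly_Mapping.single ((permute_list \<sigma> xs)[inv_into UNIV \<sigma> i := x]) a
       - Poly_Mapping.single ((permute_list \<sigma> xs)[inv_into UNIV \<sigma> i := y]) b"
      using \<sigma> xs(2) len by (simp add: u push_minus permute_list_update)
    then show ?thesis
      using multilinear_gensI[OF mem[OF xs(1) \<sigma>], of "inv_into UNIV \<sigma> i" x y a b] i' xs(3,4)
      by simp
  qed
  have rels: "push (permute_list \<sigma>) u \<in> multilinear_rels (replicate r V)"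
    if "\<sigma> permutes {..<r}" "u \<in> multilinear_rels (replicate r V)" for \<sigma> u
    by (rule T.free.hom_image_span[OF T.free.kspace_axioms hom[OF that(1)] T.gens_closed T.free.U])
      (use that gens T.free.span_base[OF T.gens_closed] in \<open>auto simp: multilinear_rels_span\<close>)
  have inverse: "push (permute_list \<sigma>) (push (permute_list (inv_into UNIV \<sigma>)) u) = u"
    if "u \<in> carrier ?F" for u
  proof -
    have "permute_list \<sigma> (permute_list (inv_into UNIV \<sigma>) xs) = xs"
      if "xs \<in> listset (map carrier (replicate r V))" for xs
    proof -
      have "length xs = r" using that by (simp only: power_tuple_iff)
      from permute_list_compose[OF \<sigma>[folded this], of "inv_into UNIV \<sigma>"] show ?thesis
        unfolding permutes_inv_o(2)[OF \<sigma>] permute_list_id by (rule sym)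
    qed
    moreover have "Poly_Mapping.keys u \<subseteq> listset (map carrier (replicate r V))"
      using that unfolding free_tuples_def free_rep_simps by blast
    ultimately show ?thesis
      unfolding push_push by (intro push_id) blast
  qed
  \<comment> \<open>Place permutations act on cosets by images, so the relations must be mapped onto
    themselves. The inverse permutation supplies the preimages.\<close>
  have img: "push (permute_list \<sigma>) ` multilinear_rels (replicate r V) = multilinear_rels (replicate r V)"
  proof
    show "multilinear_rels (replicate r V) \<subseteq> push (permute_list \<sigma>) ` multilinear_rels (replicate r V)"
    proof
      fix u assume u: "u \<in> multilinear_rels (replicate r V)"
      have "u = push (permute_list \<sigma>) (push (permute_list (inv_into UNIV \<sigma>)) u)"
        by (rule inverse[OF T.free.U_closed[OF u], symmetric])
      then show "u \<in> push (permute_list \<sigma>) ` multilinear_rels (replicate r V)"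
        using rels[OF permutes_inv[OF \<sigma>] u] by blast
    qed
  qed (use rels[OF \<sigma>] in blast)
  show "place_perm \<sigma> \<in> LinearCombinations.module_hom class_ring (tensor_power r V) (tensor_power r V)"
    using T.free.coset_image_hom[OF hom[OF \<sigma>] img]
    unfolding tensor_list_def place_perm_def[abs_def] .
  show "place_perm \<sigma> (pure_tensor (replicate r V) xs) = pure_tensor (replicate r V) (permute_list \<sigma> xs)"
    if "length xs = r" "set xs \<subseteq> carrier V" for xs
  proof -
    have "Poly_Mapping.single xs 1 \<in> carrier ?F"
      by (rule T.single_closed) (unfold power_tuple_iff, use that in blast)
    from T.free.hom_image_coset[OF hom[OF \<sigma>] img this] show ?thesis
      unfolding place_perm_def pure_tensor_def push_single .
  qed
qed

end

lemma
  assumes G: "group G" and V: "representation G V"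
  shows power_representation: "representation G (tensor_power r V)"
    and act_power_pure: "\<And>g xs. g \<in> carrier G \<Longrightarrow> length xs = r \<Longrightarrow> set xs \<subseteq> carrier V \<Longrightarrow>
      act (tensor_power r V) g (pure_tensor (replicate r V) xs)
        = pure_tensor (replicate r V) (map (act V g) xs)"
proof -
  have V': "representation G W" if "W \<in> set (replicate r V)" for W
    using that V by simp
  show "representation G (tensor_power r V)" by (rule tensor_representation[OF G V'])
  show "act (tensor_power r V) g (pure_tensor (replicate r V) xs)
        = pure_tensor (replicate r V) (map (act V g) xs)"
    if "g \<in> carrier G" "length xs = r" "set xs \<subseteq> carrier V" for g xs
  proof -
    have "map2 (\<lambda>V. act V g) (replicate r V) xs = map (act V g) xs"
      using that(2) by (intro nth_equalityI) auto
    moreover have "xs \<in> listset (map carrier (replicate r V))"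
      using kspace_rep.power_tuple_iff[of V xs r] representation_kspace[OF V] that
      by (simp add: kspace_rep_def)
    ultimately show ?thesis
      using act_pure_tensor[of G "replicate r V", OF G V' that(1)] by simp
  qed
qed

definition (in scalar_extension) symmetric_on :: "nat \<Rightarrow> 'v set \<Rightarrow> ('v list \<Rightarrow> 'l) \<Rightarrow> bool" where
  "symmetric_on r S F \<longleftrightarrow> (\<forall>xs \<sigma>. length xs = r \<longrightarrow> set xs \<subseteq> S \<longrightarrow> \<sigma> permutes {..<r} \<longrightarrow>
     F (permute_list \<sigma> xs) = F xs)"

text \<open>Alternation is expressed by vanishing on repeated entries, the form that is also correct
  in characteristic 2.\<close>

definition (in scalar_extension) alternating_on :: "nat \<Rightarrow> 'v set \<Rightarrow> ('v list \<Rightarrow> 'l) \<Rightarrow> bool" where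
  "alternating_on r S F \<longleftrightarrow>
     (\<forall>xs. length xs = r \<longrightarrow> set xs \<subseteq> S \<longrightarrow> \<not> distinct xs \<longrightarrow> F xs = 0)"

definition ext_product ::
  "('k::field, 'v, 'g) rep \<Rightarrow> 'v list \<Rightarrow> ('v list \<Rightarrow>\<^sub>0 'k) set set" where
  "ext_product V xs = alt_rels (length xs) V +>\<^bsub>tensor_power (length xs) V\<^esub>
    pure_tensor (replicate (length xs) V) xs"

definition sym_gens :: "nat \<Rightarrow> ('k::field, 'v, 'g) rep \<Rightarrow> ('v list \<Rightarrow>\<^sub>0 'k) set set" where
  "sym_gens r V = {place_perm \<sigma> w \<ominus>\<^bsub>tensor_power r V\<^esub> w
     | w \<sigma>. w \<in> carrier (tensor_power r V) \<and> \<sigma> permutes {..<r}}"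

lemma sym_rels_span: "sym_rels r V = vs_span (tensor_power r V) (sym_gens r V)"
  unfolding sym_rels_def sym_gens_def ..

definition alt_gens :: "nat \<Rightarrow> ('k::field, 'v, 'g) rep \<Rightarrow> ('v list \<Rightarrow>\<^sub>0 'k) set set" where
  "alt_gens r V = {pure_tensor (replicate r V) xs
     | xs. set xs \<subseteq> carrier V \<and> length xs = r \<and> \<not> distinct xs}"

lemma alt_rels_span: "alt_rels r V = vs_span (tensor_power r V) (alt_gens r V)"
  unfolding alt_rels_def alt_gens_def ..

locale power_space = kspace_rep V for V :: "('k::field, 'v, 'g) rep" +
  fixes r :: nat
begin

abbreviation "T \<equiv> tensor_power r V"
abbreviation "pt \<equiv> pure_tensor (replicate r V)"

sublocale T: kspace T by (rule power_kspace)

lemma sym_gens_closed: "sym_gens r V \<subseteq> carrier T"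
proof
  fix u assume "u \<in> sym_gens r V"
  then obtain w \<sigma> where "w \<in> carrier T" "\<sigma> permutes {..<r}" "u = place_perm \<sigma> w \<ominus>\<^bsub>T\<^esub> w"
    unfolding sym_gens_def by blast
  then show "u \<in> carrier T"
    using hom_k_closed[OF place_perm_hom] by (simp add: T.minus_closed)
qed

lemma alt_gens_closed: "alt_gens r V \<subseteq> carrier T"
  unfolding alt_gens_def using power_pure_closed by blast

sublocale sym: kspace_sub T "sym_rels r V"
  unfolding sym_rels_span
  by (intro kspace_sub.intro kspace_sub_axioms.intro T.span_submodule sym_gens_closed T.kspace_axioms)

sublocale alt: kspace_sub T "alt_rels r V"
  unfolding alt_rels_span
  by (intro kspace_sub.intro kspace_sub_axioms.intro T.span_submodule alt_gens_closed T.kspace_axioms)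

lemma sym_kspace: "kspace (sym_power r V)"
  unfolding sym_power_def by (rule sym.quot_kspace)

lemma ext_kspace: "kspace (ext_power r V)"
  unfolding ext_power_def by (rule alt.quot_kspace)

lemma sym_product_closed:
  "length xs = r \<Longrightarrow> set xs \<subseteq> carrier V \<Longrightarrow> sym_product V xs \<in> carrier (sym_power r V)"
  unfolding sym_power_def sym_product_def using sym.quot_closed[OF power_pure_closed] by blast

lemma ext_product_closed:
  "length xs = r \<Longrightarrow> set xs \<subseteq> carrier V \<Longrightarrow> ext_product V xs \<in> carrier (ext_power r V)"
  unfolding ext_power_def ext_product_def using alt.quot_closed[OF power_pure_closed] by blast

lemma sym_product_permute:
  assumes xs: "length xs = r" "set xs \<subseteq> carrier V" and \<sigma>: "\<sigma> permutes {..<r}"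
  shows "sym_product V (permute_list \<sigma> xs) = sym_product V xs"
proof -
  have "pt (permute_list \<sigma> xs) \<ominus>\<^bsub>T\<^esub> pt xs \<in> sym_gens r V"
    unfolding sym_gens_def place_perm_pure[OF \<sigma> xs, symmetric]
    using power_pure_closed[OF xs] \<sigma> by blast
  then have "pt (permute_list \<sigma> xs) \<ominus>\<^bsub>T\<^esub> pt xs \<in> sym_rels r V"
    unfolding sym_rels_span by (rule T.span_base[OF sym_gens_closed])
  moreover have "pt (permute_list \<sigma> xs) \<in> carrier T"
    by (rule power_pure_closed) (use xs \<sigma> in simp_all)
  ultimately have "sym_rels r V +>\<^bsub>T\<^esub> pt (permute_list \<sigma> xs) = sym_rels r V +>\<^bsub>T\<^esub> pt xs"
    using sym.coset_eq_iff[OF _ power_pure_closed[OF xs]] by blast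
  then show ?thesis unfolding sym_product_def length_permute_list xs(1) .
qed

lemma sym_product_mset_eq:
  assumes "length xs = r" "set xs \<subseteq> carrier V" "mset xs = mset ys"
  shows "sym_product V xs = sym_product V ys"
proof -
  obtain \<sigma> where \<sigma>: "\<sigma> permutes {..<length ys}" "permute_list \<sigma> ys = xs"
    using mset_eq_permutation[OF assms(3)] .
  have "length ys = r" "set ys \<subseteq> carrier V"
    using assms mset_eq_length[OF assms(3)] mset_eq_setD[OF assms(3)] by auto
  then show ?thesis using sym_product_permute[of ys \<sigma>] \<sigma> by simp
qed

lemma
  assumes "S \<subseteq> carrier V" "vs_span V S = carrier V"
  shows sym_span: "vs_span (sym_power r V) (sym_product V ` {xs. length xs = r \<and> set xs \<subseteq> S})
      = carrier (sym_power r V)"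
    and ext_span: "vs_span (ext_power r V) (ext_product V ` {xs. length xs = r \<and> set xs \<subseteq> S})
      = carrier (ext_power r V)"
proof -
  let ?L = "{xs. length xs = r \<and> set xs \<subseteq> S}"
  have cl: "pt ` ?L \<subseteq> carrier T" using power_pure_closed assms(1) by blast
  have "(\<lambda>x. sym_rels r V +>\<^bsub>T\<^esub> x) ` (pt ` ?L) = sym_product V ` ?L"
    unfolding image_image by (rule image_cong) (auto simp: sym_product_def)
  then show "vs_span (sym_power r V) (sym_product V ` ?L) = carrier (sym_power r V)"
    using sym.quot_span[OF cl power_span[OF assms]] unfolding sym_power_def by simp
  have "(\<lambda>x. alt_rels r V +>\<^bsub>T\<^esub> x) ` (pt ` ?L) = ext_product V ` ?L"
    unfolding image_image by (rule image_cong) (auto simp: ext_product_def)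
  then show "vs_span (ext_power r V) (ext_product V ` ?L) = carrier (ext_power r V)"
    using alt.quot_span[OF cl power_span[OF assms]] unfolding ext_power_def by simp
qed

lemma ext_product_linear:
  assumes "length xs = r" "set xs \<subseteq> carrier V" "i < r" "x \<in> carrier V" "y \<in> carrier V"
  shows "ext_product V (xs[i := x \<oplus>\<^bsub>V\<^esub> y]) =
    ext_product V (xs[i := x]) \<oplus>\<^bsub>ext_power r V\<^esub> ext_product V (xs[i := y])"
proof -
  have cl: "pt (xs[i := z]) \<in> carrier T" if "z \<in> carrier V" for z
    by (rule power_pure_closed) (use assms that set_update_subset_insert[of xs i z] in auto)
  have "pt (xs[i := x \<oplus>\<^bsub>V\<^esub> y]) = pt (xs[i := x]) \<oplus>\<^bsub>T\<^esub> pt (xs[i := y])"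
    using power_pure_linear[OF assms, of 1 1] assms(4,5) cl by simp
  then show ?thesis
    unfolding ext_product_def ext_power_def length_list_update assms(1)
    by (simp only: alt.quot_add cl assms(4,5))
qed

lemma ext_product_not_distinct:
  assumes "length xs = r" "set xs \<subseteq> carrier V" "\<not> distinct xs"
  shows "ext_product V xs = \<zero>\<^bsub>ext_power r V\<^esub>"
proof -
  have "pt xs \<in> alt_gens r V" unfolding alt_gens_def using assms by blast
  then have "pt xs \<in> alt_rels r V"
    unfolding alt_rels_span by (rule T.span_base[OF alt_gens_closed])
  from alt.quot_eq_zero[OF this] show ?thesis
    unfolding ext_product_def ext_power_def assms(1) .
qed

text \<open>Polarisation: the product with x + y in both places vanishes, and so do the two diagonal
  terms of its expansion. The mixed terms therefore cancel.\<close>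

lemma ext_product_swap:
  assumes xs: "length xs = r" "set xs \<subseteq> carrier V" and ij: "i < r" "j < r" "i \<noteq> j"
  shows "ext_product V (xs[i := xs ! j, j := xs ! i]) = (- 1) \<odot>\<^bsub>ext_power r V\<^esub> ext_product V xs"
proof -
  interpret E: kspace "ext_power r V" by (rule ext_kspace)
  let ?P = "\<lambda>x y. ext_product V (xs[i := x, j := y])"
  have set_upd: "set (ys[k := z]) \<subseteq> carrier V" if "set ys \<subseteq> carrier V" "z \<in> carrier V" for ys k z
    using that set_update_subset_insert[of ys k z] by blast
  have cl: "?P x y \<in> carrier (ext_power r V)" if "x \<in> carrier V" "y \<in> carrier V" for x y
    by (rule ext_product_closed) (simp_all add: xs set_upd that)
  have right: "?P x (y \<oplus>\<^bsub>V\<^esub> y') = ?P x y \<oplus>\<^bsub>ext_power r V\<^esub> ?P x y'"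
    if "x \<in> carrier V" "y \<in> carrier V" "y' \<in> carrier V" for x y y'
    by (rule ext_product_linear) (simp_all add: xs set_upd that ij)
  have left: "?P (x \<oplus>\<^bsub>V\<^esub> x') y = ?P x y \<oplus>\<^bsub>ext_power r V\<^esub> ?P x' y"
    if "x \<in> carrier V" "x' \<in> carrier V" "y \<in> carrier V" for x x' y
    unfolding list_update_swap[OF ij(3)]
    by (rule ext_product_linear) (simp_all add: xs set_upd that ij)
  have diag: "?P x x = \<zero>\<^bsub>ext_power r V\<^esub>" if "x \<in> carrier V" for x
  proof (rule ext_product_not_distinct)
    show "\<not> distinct (xs[i := x, j := x])"
      using nth_eq_iff_index_eq[of "xs[i := x, j := x]" i j] ij xs by auto
  qed (simp_all add: xs set_upd that)
  let ?x = "xs ! i" and ?y = "xs ! j"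
  have mem: "?x \<in> carrier V" "?y \<in> carrier V" using xs ij by auto
  have s: "?x \<oplus>\<^bsub>V\<^esub> ?y \<in> carrier V" by (rule a_closed[OF mem])
  have "\<zero>\<^bsub>ext_power r V\<^esub> = ?P (?x \<oplus>\<^bsub>V\<^esub> ?y) (?x \<oplus>\<^bsub>V\<^esub> ?y)"
    using diag[OF s] by simp
  also have "\<dots> = (?P ?x ?x \<oplus>\<^bsub>ext_power r V\<^esub> ?P ?x ?y) \<oplus>\<^bsub>ext_power r V\<^esub>
      (?P ?y ?x \<oplus>\<^bsub>ext_power r V\<^esub> ?P ?y ?y)"
    unfolding left[OF mem s] right[OF mem(1) mem] right[OF mem(2) mem] ..
  also have "\<dots> = ?P ?x ?y \<oplus>\<^bsub>ext_power r V\<^esub> ?P ?y ?x"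
    using cl[OF mem] cl[OF mem(2,1)] by (simp only: diag mem E.l_zero E.r_zero)
  finally have "\<ominus>\<^bsub>ext_power r V\<^esub> ?P ?x ?y = ?P ?y ?x"
    using E.minus_equality[of "?P ?y ?x" "?P ?x ?y"] cl[OF mem] cl[OF mem(2,1)]
    by (simp only: E.a_comm)
  then show ?thesis
    using E.minus_eq_smult[OF cl[OF mem]] by simp
qed

text \<open>Asserting only membership in the line spanned by the original product makes it
  unnecessary to track the sign.\<close>

lemma ext_product_permute:
  assumes "\<sigma> permutes {..<r}" "length xs = r" "set xs \<subseteq> carrier V"
  shows "ext_product V (permute_list \<sigma> xs) \<in> vs_span (ext_power r V) {ext_product V xs}"
proof -
  interpret E: kspace "ext_power r V" by (rule ext_kspace)
  show ?thesis
    using assms(1) finite_lessThan[of r] assms(2,3)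
  proof (induction arbitrary: xs rule: permutes_induct)
    case id
    then show ?case
      using ext_product_closed by (intro E.span_base) auto
  next
    case (swap a b p)
    let ?ys = "xs[a := xs ! b, b := xs ! a]"
    have ab: "a < r" "b < r" using swap by auto
    have ys: "permute_list (Transposition.transpose a b) xs = ?ys"
      using ab swap by (intro nth_equalityI)
        (auto simp: permute_list_nth nth_list_update Transposition.transpose_def permutes_swap_id)
    have len: "length ?ys = r" "set ?ys \<subseteq> carrier V"
      using swap ab by (auto simp: ys[symmetric] permutes_swap_id)
    \<comment> \<open>In a composite the left factor acts on the list first, so the induction
      hypothesis is applied to the swapped list.\<close>
    have "permute_list (Transposition.transpose a b \<circ> p) xs = permute_list p ?ys"
      using permute_list_compose[of p xs "Transposition.transpose a b"] swap unfolding ys by simp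
    then have "ext_product V (permute_list (Transposition.transpose a b \<circ> p) xs)
        \<in> vs_span (ext_power r V) {ext_product V ?ys}"
      using swap.IH[OF len] by simp
    moreover have "vs_span (ext_power r V) {ext_product V ?ys} \<subseteq> vs_span (ext_power r V) {ext_product V xs}"
    proof (rule E.span_minimal)
      have xs: "{ext_product V xs} \<subseteq> carrier (ext_power r V)"
        using ext_product_closed swap by simp
      show "submodule class_ring (vs_span (ext_power r V) {ext_product V xs}) (ext_power r V)"
        by (rule E.span_submodule[OF xs])
      show "{ext_product V ?ys} \<subseteq> vs_span (ext_power r V) {ext_product V xs}"
        using ext_product_swap[of xs a b] E.span_smult[OF xs E.span_base[OF xs]] swap ab by simp
    qed
    ultimately show ?case by blast
  qed
qed

text \<open>A word of length \<open>r\<close> in the \<open>r\<close> entries of the spanning list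
  either repeats a letter, and then its product vanishes, or is a rearrangement of the whole
  list.\<close>

lemma ext_power_line:
  assumes us: "length us = r" "set us \<subseteq> carrier V" "vs_span V (set us) = carrier V"
  shows "vs_span (ext_power r V) {ext_product V us} = carrier (ext_power r V)"
proof -
  interpret E: kspace "ext_power r V" by (rule ext_kspace)
  have cl: "{ext_product V us} \<subseteq> carrier (ext_power r V)"
    using ext_product_closed us by simp
  have "ext_product V xs \<in> vs_span (ext_power r V) {ext_product V us}"
    if xs: "length xs = r" "set xs \<subseteq> set us" for xs
  proof (cases "distinct xs")
    case False
    then show ?thesis
      using ext_product_not_distinct[of xs] xs us(2) E.span_zero[OF cl] by auto
  next
    case True
    have "card (set us) \<le> card (set xs)"
      using card_length[of us] us(1) distinct_card[OF True] xs(1) by simp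
    then have eq: "set xs = set us" using xs(2) card_seteq by blast
    then have "distinct us" using distinct_card[OF True] us xs by (simp add: card_distinct)
    then have "mset xs = mset us" using eq True set_eq_iff_mset_eq_distinct by blast
    then obtain \<sigma> where "\<sigma> permutes {..<length us}" "permute_list \<sigma> us = xs"
      by (rule mset_eq_permutation)
    then show ?thesis using ext_product_permute[of \<sigma> us] us by simp
  qed
  then have "ext_product V ` {xs. length xs = r \<and> set xs \<subseteq> set us}
      \<subseteq> vs_span (ext_power r V) {ext_product V us}" by blast
  note E.span_minimal[OF E.span_submodule[OF cl] this]
  then have "carrier (ext_power r V) \<subseteq> vs_span (ext_power r V) {ext_product V us}"
    unfolding ext_span[OF us(2,3)] .
  then show ?thesis by (intro subset_antisym E.span_is_subset2 cl)
qed

end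

context scalar_extension begin

lemma
  fixes V :: "('k, 'v, 'g) rep"
  assumes V: "kspace V" and F: "multilinear (replicate r V) F"
  shows sym_val_functional: "symmetric_on r (carrier V) F \<Longrightarrow>
      functional (sym_power r V) (coset_val (tensor_val F))"
    and sym_val_product: "\<And>xs. symmetric_on r (carrier V) F \<Longrightarrow> length xs = r \<Longrightarrow>
      set xs \<subseteq> carrier V \<Longrightarrow> coset_val (tensor_val F) (sym_product V xs) = F xs"
    and alt_val_functional: "alternating_on r (carrier V) F \<Longrightarrow>
      functional (ext_power r V) (coset_val (tensor_val F))"
    and alt_val_product: "\<And>xs. alternating_on r (carrier V) F \<Longrightarrow> length xs = r \<Longrightarrow>
      set xs \<subseteq> carrier V \<Longrightarrow> coset_val (tensor_val F) (ext_product V xs) = F xs"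
proof -
  interpret power_space V r using V by (simp add: power_space_def kspace_rep_def)
  have fnl: "functional T (tensor_val F)"
    by (rule tensor_val_functional[OF kspaces_replicate F])
  have val: "tensor_val F (pt xs) = F xs" if "length xs = r" "set xs \<subseteq> carrier V" for xs
    by (rule tensor_val_pure[OF kspaces_replicate F]) (unfold power_tuple_iff, use that in blast)
  have sym_zero: "tensor_val F u = 0"
    if sym: "symmetric_on r (carrier V) F" and u: "u \<in> sym_rels r V" for u
  proof (rule functional_eq_on_span[OF T.kspace_axioms fnl functional_0 sym_gens_closed])
    show "u \<in> vs_span T (sym_gens r V)" using u unfolding sym_rels_span .
    fix x assume "x \<in> sym_gens r V"
    then obtain w \<sigma> where w: "w \<in> carrier T" and \<sigma>: "\<sigma> permutes {..<r}"
      and x: "x = place_perm \<sigma> w \<ominus>\<^bsub>T\<^esub> w"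
      unfolding sym_gens_def by blast
    let ?L = "{xs. length xs = r \<and> set xs \<subseteq> carrier V}"
    \<comment> \<open>The relations involve arbitrary tensors \<open>w\<close>, whereas symmetry of
      \<open>F\<close> concerns lists of vectors. Both sides are functionals, so pure tensors
      suffice.\<close>
    have "tensor_val F (place_perm \<sigma> w) = tensor_val F w"
    proof (rule functional_eq_on_span[OF T.kspace_axioms functional_hom[OF place_perm_hom[OF \<sigma>] fnl] fnl])
      show "pt ` ?L \<subseteq> carrier T" using power_pure_closed by blast
      have "vs_span V (carrier V) = carrier V"
        using in_own_span[of "carrier V"] span_is_subset2[of "carrier V"] by blast
      from power_span[OF _ this] show "w \<in> vs_span T (pt ` ?L)"
        using w by simp
      show "tensor_val F (place_perm \<sigma> x) = tensor_val F x" if "x \<in> pt ` ?L" for x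
      proof -
        obtain xs where xs: "x = pt xs" "length xs = r" "set xs \<subseteq> carrier V"
          using \<open>x \<in> pt ` ?L\<close> by blast
        have "tensor_val F (pt (permute_list \<sigma> xs)) = F (permute_list \<sigma> xs)"
          by (rule val) (use xs \<sigma> in simp_all)
        then show ?thesis
          using sym xs \<sigma> val[OF xs(2,3)] unfolding symmetric_on_def xs(1) place_perm_pure[OF \<sigma> xs(2,3)]
          by simp
      qed
    qed
    then show "tensor_val F x = 0"
      unfolding x using functional_minus[OF T.kspace_axioms fnl hom_k_closed[OF place_perm_hom[OF \<sigma>] w] w]
      by simp
  qed
  have alt_zero: "tensor_val F u = 0"
    if alt: "alternating_on r (carrier V) F" and u: "u \<in> alt_rels r V" for u
  proof (rule functional_eq_on_span[OF T.kspace_axioms fnl functional_0 alt_gens_closed])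
    show "u \<in> vs_span T (alt_gens r V)" using u unfolding alt_rels_span .
    fix x assume "x \<in> alt_gens r V"
    then obtain xs where xs: "set xs \<subseteq> carrier V" "length xs = r" "\<not> distinct xs" "x = pt xs"
      unfolding alt_gens_def by blast
    then show "tensor_val F x = 0" using val alt unfolding alternating_on_def by simp
  qed
  show "functional (sym_power r V) (coset_val (tensor_val F))" if "symmetric_on r (carrier V) F"
    unfolding sym_power_def
    by (rule coset_val_functional[OF T.kspace_axioms sym.U fnl sym_zero[OF that]])
  show "functional (ext_power r V) (coset_val (tensor_val F))" if "alternating_on r (carrier V) F"
    unfolding ext_power_def
    by (rule coset_val_functional[OF T.kspace_axioms alt.U fnl alt_zero[OF that]])
  show "coset_val (tensor_val F) (sym_product V xs) = F xs"
    if "symmetric_on r (carrier V) F" "length xs = r" "set xs \<subseteq> carrier V" for xs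
  proof -
    have "coset_val (tensor_val F) (sym_product V xs) = tensor_val F (pt xs)"
      unfolding sym_product_def that(2)
      by (rule coset_val[OF T.kspace_axioms sym.U fnl sym_zero[OF that(1)] power_pure_closed[OF that(2,3)]])
    then show ?thesis unfolding val[OF that(2,3)] .
  qed
  show "coset_val (tensor_val F) (ext_product V xs) = F xs"
    if "alternating_on r (carrier V) F" "length xs = r" "set xs \<subseteq> carrier V" for xs
  proof -
    have "coset_val (tensor_val F) (ext_product V xs) = tensor_val F (pt xs)"
      unfolding ext_product_def that(2)
      by (rule coset_val[OF T.kspace_axioms alt.U fnl alt_zero[OF that(1)] power_pure_closed[OF that(2,3)]])
    then show ?thesis unfolding val[OF that(2,3)] .
  qed
qed

end

section \<open>Group actions on symmetric and exterior powers\<close>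

lemma
  assumes G: "group G" and V: "representation G V"
  shows sym_representation: "representation G (sym_power r V)"
    and act_sym_product: "\<And>g xs. g \<in> carrier G \<Longrightarrow> length xs = r \<Longrightarrow> set xs \<subseteq> carrier V \<Longrightarrow>
      act (sym_power r V) g (sym_product V xs) = sym_product V (map (act V g) xs)"
    and ext_representation: "representation G (ext_power r V)"
    and act_ext_product: "\<And>g xs. g \<in> carrier G \<Longrightarrow> length xs = r \<Longrightarrow> set xs \<subseteq> carrier V \<Longrightarrow>
      act (ext_power r V) g (ext_product V xs) = ext_product V (map (act V g) xs)"
proof -
  interpret power_space V r
    using representation_kspace[OF V] by (simp add: power_space_def kspace_rep_def)
  interpret V: representation G V by (rule V)
  note PR = power_representation[OF G V, of r]
  interpret P: representation G T by (rule PR)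
  note act_pt = act_power_pure[OF G V, of _ _ r]
  have map_closed: "set (map (act V g) xs) \<subseteq> carrier V" if "g \<in> carrier G" "set xs \<subseteq> carrier V" for g xs
    using that hom_k_closed[OF V.act_linear[OF that(1)]] by auto
  let ?L = "{xs. length xs = r \<and> set xs \<subseteq> carrier V}"
  have L: "pt ` ?L \<subseteq> carrier T" using power_pure_closed by blast
  have "vs_span V (carrier V) = carrier V"
    using in_own_span[of "carrier V"] span_is_subset2[of "carrier V"] by blast
  from power_span[OF _ this] have span: "vs_span T (pt ` ?L) = carrier T" by simp
  \<comment> \<open>Place permutations commute with the diagonal action. This is clear on pure
    tensors, which span, and it makes the symmetric relations invariant.\<close>
  have comm: "act T g (place_perm \<sigma> w) = place_perm \<sigma> (act T g w)"
    if g: "g \<in> carrier G" and \<sigma>: "\<sigma> permutes {..<r}" and w: "w \<in> carrier T" for g \<sigma> w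
  proof -
    have comp: "(\<lambda>w. f (h w)) \<in> LinearCombinations.module_hom class_ring T T"
      if "f \<in> LinearCombinations.module_hom class_ring T T"
        "h \<in> LinearCombinations.module_hom class_ring T T" for f h
      by (rule hom_kI)
        (simp_all add: hom_k_closed[OF that(1)] hom_k_closed[OF that(2)] hom_k_add[OF that(1)]
          hom_k_add[OF that(2)] hom_k_smult[OF that(1)] hom_k_smult[OF that(2)])
    show ?thesis
    proof (rule T.hom_eq_on_span[OF T.kspace_axioms comp[OF P.act_linear[OF g] place_perm_hom[OF \<sigma>]]
          comp[OF place_perm_hom[OF \<sigma>] P.act_linear[OF g]] L])
      show "w \<in> vs_span T (pt ` ?L)" using w span by simp
      fix x assume "x \<in> pt ` ?L"
      then obtain xs where xs: "x = pt xs" "length xs = r" "set xs \<subseteq> carrier V" by blast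
      have "act T g (pt (permute_list \<sigma> xs)) = pt (map (act V g) (permute_list \<sigma> xs))"
        by (rule act_pt) (use xs g \<sigma> in simp_all)
      moreover have "place_perm \<sigma> (pt (map (act V g) xs)) = pt (permute_list \<sigma> (map (act V g) xs))"
        by (rule place_perm_pure[OF \<sigma> _ map_closed[OF g xs(3)]]) (use xs in simp)
      ultimately show "act T g (place_perm \<sigma> x) = place_perm \<sigma> (act T g x)"
        unfolding xs(1) place_perm_pure[OF \<sigma> xs(2,3)] act_pt[OF g xs(2,3)]
        using xs \<sigma> by (simp add: permute_list_map)
    qed
  qed
  have sym_inv: "act T g u \<in> sym_rels r V" if g: "g \<in> carrier G" and u: "u \<in> sym_rels r V" for g u
  proof (rule T.hom_image_span[OF T.kspace_axioms P.act_linear[OF g] sym_gens_closed sym.U])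
    show "u \<in> vs_span T (sym_gens r V)" using u unfolding sym_rels_span .
    show "act T g ` sym_gens r V \<subseteq> sym_rels r V"
    proof (rule image_subsetI)
      fix x assume "x \<in> sym_gens r V"
      then obtain w \<sigma> where w: "w \<in> carrier T" and \<sigma>: "\<sigma> permutes {..<r}"
        and x: "x = place_perm \<sigma> w \<ominus>\<^bsub>T\<^esub> w"
        unfolding sym_gens_def by blast
      have "act T g x = place_perm \<sigma> (act T g w) \<ominus>\<^bsub>T\<^esub> act T g w"
        unfolding x T.hom_minus[OF T.kspace_axioms P.act_linear[OF g]
            hom_k_closed[OF place_perm_hom[OF \<sigma>] w] w] comm[OF g \<sigma> w] ..
      then have "act T g x \<in> sym_gens r V"
        unfolding sym_gens_def using hom_k_closed[OF P.act_linear[OF g] w] \<sigma> by blast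
      then show "act T g x \<in> sym_rels r V"
        unfolding sym_rels_span by (rule T.span_base[OF sym_gens_closed])
    qed
  qed
  have alt_inv: "act T g u \<in> alt_rels r V" if g: "g \<in> carrier G" and u: "u \<in> alt_rels r V" for g u
  proof (rule T.hom_image_span[OF T.kspace_axioms P.act_linear[OF g] alt_gens_closed alt.U])
    show "u \<in> vs_span T (alt_gens r V)" using u unfolding alt_rels_span .
    show "act T g ` alt_gens r V \<subseteq> alt_rels r V"
    proof (rule image_subsetI)
      fix x assume "x \<in> alt_gens r V"
      then obtain xs where xs: "set xs \<subseteq> carrier V" "length xs = r" "\<not> distinct xs" "x = pt xs"
        unfolding alt_gens_def by blast
      have "\<not> distinct (map (act V g) xs)" using xs(3) by (simp add: distinct_map)
      moreover have "length (map (act V g) xs) = r" using xs(2) by simp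
      ultimately have "act T g x \<in> alt_gens r V"
        unfolding alt_gens_def xs(4) act_pt[OF g xs(2,1)] using map_closed[OF g xs(1)] by blast
      then show "act T g x \<in> alt_rels r V"
        unfolding alt_rels_span by (rule T.span_base[OF alt_gens_closed])
    qed
  qed
  show "representation G (sym_power r V)"
    unfolding sym_power_def by (rule quot_representation[OF PR sym.U sym_inv])
  show "representation G (ext_power r V)"
    unfolding ext_power_def by (rule quot_representation[OF PR alt.U alt_inv])
  show "act (sym_power r V) g (sym_product V xs) = sym_product V (map (act V g) xs)"
    if "g \<in> carrier G" "length xs = r" "set xs \<subseteq> carrier V" for g xs
    unfolding sym_power_def sym_product_def length_map that(2) act_pt[OF that, symmetric]
    by (rule quot_representation(2)[OF PR sym.U sym_inv _ power_pure_closed[OF that(2,3)]])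
      (assumption | rule that(1))+
  show "act (ext_power r V) g (ext_product V xs) = ext_product V (map (act V g) xs)"
    if "g \<in> carrier G" "length xs = r" "set xs \<subseteq> carrier V" for g xs
    unfolding ext_power_def ext_product_def length_map that(2) act_pt[OF that, symmetric]
    by (rule quot_representation(2)[OF PR alt.U alt_inv _ power_pure_closed[OF that(2,3)]])
      (assumption | rule that(1))+
qed

subsection \<open>Determinants indexed by finite sets\<close>

text \<open>Any finite set may index the matrix, so minors are restrictions and the boxes of a
  diagram can serve as indices. Rows and columns share the index set, hence only principal minors
  are expressible; others are reached by permuting the vectors that label the columns.\<close>

definition ldet :: "'i set \<Rightarrow> ('i \<Rightarrow> 'i \<Rightarrow> 'a::comm_ring_1) \<Rightarrow> 'a" where
  "ldet S m = (\<Sum>p | p permutes S. of_int (sign p) * (\<Prod>i\<in>S. m i (p i)))"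

lemma ldet_cong:
  assumes "\<And>i j. i \<in> S \<Longrightarrow> j \<in> S \<Longrightarrow> m i j = n i j"
  shows "ldet S m = ldet S n"
  unfolding ldet_def
  by (intro sum.cong arg_cong2[where f = "(*)"] prod.cong) (auto simp: assms permutes_in_image)

text \<open>Rows and columns are relabelled by the same bijection, so no sign appears. In
  particular, reversing the order of both leaves the determinant unchanged.\<close>

lemma ldet_reindex:
  assumes f: "bij_betw f A B" and A: "finite A"
  shows "ldet B m = ldet A (\<lambda>i j. m (f i) (f j))"
proof -
  have inj: "inj_on f A" using f by (rule bij_betw_imp_inj_on)
  have f': "bij_betw (inv_into A f) B A" using f by (rule bij_betw_inv_into)
  have "ldet A (\<lambda>i j. m (f i) (f j)) = ldet B m"
    unfolding ldet_def
  proof (rule sum.reindex_bij_witness[where j = "map_permutation A f"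
        and i = "map_permutation B (inv_into A f)"]; clarify)
    fix p assume p: "p permutes A"
    show "map_permutation B (inv_into A f) (map_permutation A f p) = p"
      by (rule map_permutation_compose_inv[OF f p]) (simp add: inj)
    show "map_permutation A f p permutes B" by (rule map_permutation_permutes[OF f p])
    have "(\<Prod>i\<in>B. m i (map_permutation A f p i)) = (\<Prod>i\<in>A. m (f i) (map_permutation A f p (f i)))"
      by (rule prod.reindex_bij_betw[OF f, symmetric])
    also have "\<dots> = (\<Prod>i\<in>A. m (f i) (f (p i)))"
      by (rule prod.cong) (simp_all add: map_permutation_apply[OF inj])
    finally show "of_int (sign (map_permutation A f p)) * (\<Prod>i\<in>B. m i (map_permutation A f p i)) =
        of_int (sign p) * (\<Prod>i\<in>A. m (f i) (f (p i)))"
      using sign_map_permutation[OF inj p A] by simp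
  next
    fix p assume p: "p permutes B"
    show "map_permutation A f (map_permutation B (inv_into A f) p) = p"
      by (rule map_permutation_compose_inv[OF f' p]) (use f in \<open>simp add: bij_betw_inv_into_right\<close>)
    show "map_permutation B (inv_into A f) p permutes A" by (rule map_permutation_permutes[OF f' p])
  qed
  then show ?thesis by simp
qed

text \<open>The bridge to matrices over an initial segment. Multiplicativity, transposition and the
  vanishing for equal columns are imported through it.\<close>

lemma ldet_det:
  assumes "bij_betw f {0..<n} S"
  shows "ldet S m = det (mat n n (\<lambda>(i, j). m (f i) (f j)))"
proof -
  have "ldet S m = ldet {0..<n} (\<lambda>i j. m (f i) (f j))"
    by (rule ldet_reindex[OF assms]) simp
  also have "\<dots> = det (mat n n (\<lambda>(i, j). m (f i) (f j)))"
    unfolding ldet_def det_def'[OF mat_carrier]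
  proof (intro sum.cong refl arg_cong2[where f = "(*)"] prod.cong)
    fix p i assume "p \<in> {p. p permutes {0..<n}}" "i \<in> {0..<n}"
    moreover from this have "p i < n" using permutes_in_image[of p "{0..<n}" i] by simp
    ultimately show "m (f i) (f (p i)) = mat n n (\<lambda>(i, j). m (f i) (f j)) $$ (i, p i)" by simp
  qed
  finally show ?thesis .
qed

lemma ldet_mult:
  assumes S: "finite S"
  shows "ldet S (\<lambda>i j. \<Sum>k\<in>S. m i k * n k j) = ldet S m * ldet S n"
proof -
  obtain f where f: "bij_betw f {0..<card S} S"
    using ex_bij_betw_nat_finite[OF S] by blast
  have "mat (card S) (card S) (\<lambda>(i, j). \<Sum>k\<in>S. m (f i) k * n k (f j)) =
      mat (card S) (card S) (\<lambda>(i, j). m (f i) (f j)) * mat (card S) (card S) (\<lambda>(i, j). n (f i) (f j))"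
    by (rule eq_matI)
      (auto simp: scalar_prod_def sum.reindex_bij_betw[OF f, of "\<lambda>k. m _ k * n k _", symmetric])
  then show ?thesis
    unfolding ldet_det[OF f] by (simp add: det_mult[of _ "card S"])
qed

lemma ldet_delta:
  assumes S: "finite S"
  shows "ldet S (\<lambda>i j. if i = j then 1 else 0) = (1 :: 'a::comm_ring_1)"
proof -
  obtain f where f: "bij_betw f {0..<card S} S"
    using ex_bij_betw_nat_finite[OF S] by blast
  have "mat (card S) (card S) (\<lambda>(i, j). if f i = f j then 1 else 0) = (1\<^sub>m (card S) :: 'a mat)"
    by (rule eq_matI) (use bij_betw_imp_inj_on[OF f] in \<open>auto simp: inj_on_def\<close>)
  then show ?thesis unfolding ldet_det[OF f] by simp
qed

lemma ldet_transpose: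
  assumes S: "finite S"
  shows "ldet S (\<lambda>i j. m j i) = ldet S m"
proof -
  obtain f where f: "bij_betw f {0..<card S} S"
    using ex_bij_betw_nat_finite[OF S] by blast
  have "mat (card S) (card S) (\<lambda>(i, j). m (f j) (f i)) =
      transpose_mat (mat (card S) (card S) (\<lambda>(i, j). m (f i) (f j)))"
    by (rule eq_matI) auto
  then show ?thesis
    unfolding ldet_det[OF f] by (simp add: det_transpose[of _ "card S"])
qed

lemma ldet_identical_columns:
  assumes S: "finite S" and ab: "a \<in> S" "b \<in> S" "a \<noteq> b" and eq: "\<And>i. i \<in> S \<Longrightarrow> m i a = m i b"
  shows "ldet S m = 0"
proof -
  obtain f where f: "bij_betw f {0..<card S} S"
    using ex_bij_betw_nat_finite[OF S] by blast
  obtain i j where ij: "i < card S" "j < card S" "f i = a" "f j = b"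
  proof -
    have "a \<in> f ` {0..<card S}" "b \<in> f ` {0..<card S}"
      using ab bij_betw_imp_surj_on[OF f] by simp_all
    then show ?thesis using that by (elim imageE) simp
  qed
  show ?thesis
    unfolding ldet_det[OF f]
  proof (rule det_identical_columns[OF _ _ ij(1,2)])
    show "i \<noteq> j" using ab ij by auto
    show "col (mat (card S) (card S) (\<lambda>(i, j). m (f i) (f j))) i =
        col (mat (card S) (card S) (\<lambda>(i, j). m (f i) (f j))) j"
      using ij eq bij_betwE[OF f] by (intro eq_vecI) auto
  qed simp
qed

lemma ldet_column_linear:
  assumes S: "finite S" and c: "c \<in> S"
  shows "ldet S (\<lambda>i j. if j = c then \<alpha> * x i + \<beta> * y i else m i j) =
    \<alpha> * ldet S (\<lambda>i j. if j = c then x i else m i j) + \<beta> * ldet S (\<lambda>i j. if j = c then y i else m i j)"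
proof -
  \<comment> \<open>Each product in the Leibniz sum has exactly one factor from column
    \<open>c\<close>, namely the one in row p^-1(c).\<close>
  have split: "(\<Prod>i\<in>S. if p i = c then z i else m i (p i)) =
      z (inv_into UNIV p c) * (\<Prod>i\<in>S - {inv_into UNIV p c}. m i (p i))"
    if p: "p permutes S" for p z
  proof -
    have eq: "p i = c \<longleftrightarrow> i = inv_into UNIV p c" for i
      using permutes_inv_eq[OF p, of c i] by auto
    have "inv_into UNIV p c \<in> S" using permutes_in_image[OF permutes_inv[OF p]] c by simp
    then show ?thesis
      unfolding prod.remove[OF S \<open>inv_into UNIV p c \<in> S\<close>] eq
      by (intro arg_cong2[where f = "(*)"] prod.cong) auto
  qed
  show ?thesis
    unfolding ldet_def sum_distrib_left sum.distrib[symmetric]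
    by (rule sum.cong) (auto simp: split algebra_simps)
qed

text \<open>A permutation that moves a member of \<open>S\<close> into \<open>T\<close> picks up a
  zero entry. The remaining ones preserve \<open>S\<close>, hence also \<open>T\<close>, and factor
  uniquely into a permutation of \<open>S\<close> and one of \<open>T\<close>.\<close>

lemma ldet_block:
  assumes fin: "finite S" "finite T" and disj: "S \<inter> T = {}"
    and zero: "\<And>i j. i \<in> S \<Longrightarrow> j \<in> T \<Longrightarrow> m i j = 0"
  shows "ldet (S \<union> T) m = ldet S m * ldet T m"
proof -
  let ?F = "\<lambda>r. of_int (sign r) * (\<Prod>i\<in>S \<union> T. m i (r i))"
  let ?R = "{r. r permutes S \<union> T \<and> r ` S \<subseteq> S}"
  have "ldet (S \<union> T) m = (\<Sum>r\<in>?R. ?F r)"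
    unfolding ldet_def
  proof (rule sum.mono_neutral_right)
    show "\<forall>r\<in>{r. r permutes S \<union> T} - ?R. ?F r = 0"
    proof
      fix r assume "r \<in> {r. r permutes S \<union> T} - ?R"
      then obtain i where r: "r permutes S \<union> T" and i: "i \<in> S" "r i \<notin> S" by blast
      then have "r i \<in> T" using permutes_in_image[OF r, of i] by auto
      then have "(\<Prod>i\<in>S \<union> T. m i (r i)) = 0"
        using zero[OF i(1)] i fin by (intro prod_zero) auto
      then show "?F r = 0" by simp
    qed
  qed (use fin in \<open>auto intro: finite_permutations\<close>)
  also have "\<dots> = (\<Sum>(p, q)\<in>{p. p permutes S} \<times> {q. q permutes T}. ?F (p \<circ> q))"
  proof (rule sum.reindex_bij_witness[where i = "\<lambda>(p, q). p \<circ> q"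
        and j = "\<lambda>r. (restrict_id r S, restrict_id r T)"])
    fix r assume "r \<in> ?R"
    then have r: "r permutes S \<union> T" and rS: "r ` S \<subseteq> S" by auto
    have inj: "inj r" by (rule permutes_inj[OF r])
    have S: "r ` S = S"
      by (rule card_subset_eq[OF fin(1) rS]) (rule card_image, rule inj_on_subset[OF inj], simp)
    have "r ` T = r ` ((S \<union> T) - S)" using disj by (intro arg_cong[where f = "\<lambda>A. r ` A"]) blast
    also have "\<dots> = r ` (S \<union> T) - r ` S" by (rule image_set_diff[OF inj])
    also have "\<dots> = T" unfolding permutes_image[OF r] S using disj by blast
    finally have T: "r ` T = T" .
    show *: "(\<lambda>(p, q). p \<circ> q) (restrict_id r S, restrict_id r T) = r"
    proof
      fix x
      consider "x \<in> S" "x \<notin> T" | "x \<in> T" "r x \<in> T" "r x \<notin> S" | "x \<notin> S" "x \<notin> T" "r x = x"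
        using disj T permutes_not_in[OF r, of x] by blast
      then show "(\<lambda>(p, q). p \<circ> q) (restrict_id r S, restrict_id r T) x = r x"
        by cases (simp_all add: restrict_id_def)
    qed
    have "restrict_id r A permutes A" if "r ` A = A" for A
    proof (rule bij_imp_permutes)
      have "bij_betw r A A" using inj_on_subset[OF inj] that by (simp add: bij_betw_def)
      then show "bij_betw (restrict_id r A) A A" by (rule bij_betw_cong[THEN iffD1, rotated]) simp
    qed simp
    then show "(restrict_id r S, restrict_id r T) \<in> {p. p permutes S} \<times> {q. q permutes T}"
      using S T by simp
    show "(case (restrict_id r S, restrict_id r T) of (p, q) \<Rightarrow> ?F (p \<circ> q)) = ?F r"
      using * by (simp only: prod.case)
  next
    fix z assume "z \<in> {p. p permutes S} \<times> {q. q permutes T}"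
    then obtain p q where z: "z = (p, q)" and p: "p permutes S" and q: "q permutes T" by auto
    have qS: "q x = x" if "x \<in> S" for x using permutes_not_in[OF q, of x] disj that by auto
    have pT: "p x = x" if "x \<in> T" for x using permutes_not_in[OF p, of x] disj that by auto
    have qT: "q x \<in> T" if "x \<in> T" for x using permutes_in_image[OF q] that by simp
    show "(restrict_id ((\<lambda>(p, q). p \<circ> q) z) S, restrict_id ((\<lambda>(p, q). p \<circ> q) z) T) = z"
      using permutes_not_in[OF p] permutes_not_in[OF q] qS pT qT
      by (auto simp: z restrict_id_def fun_eq_iff)
    have "p \<circ> q permutes S \<union> T"
      using p q by (intro permutes_compose) (auto intro: permutes_subset)
    then show "(\<lambda>(p, q). p \<circ> q) z \<in> ?R"
      using qS permutes_in_image[OF p] by (auto simp: z)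
  qed
  also have "\<dots> = (\<Sum>(p, q)\<in>{p. p permutes S} \<times> {q. q permutes T}.
      (of_int (sign p) * (\<Prod>i\<in>S. m i (p i))) * (of_int (sign q) * (\<Prod>i\<in>T. m i (q i))))"
  proof (intro sum.cong refl, clarify)
    fix p q assume p: "p permutes S" and q: "q permutes T"
    have "permutation p" "permutation q"
      using p q fin by (auto simp: permutation_permutes)
    then have sgn: "sign (p \<circ> q) = sign p * sign q" by (rule sign_compose)
    have "(\<Prod>i\<in>S \<union> T. m i ((p \<circ> q) i)) = (\<Prod>i\<in>S. m i ((p \<circ> q) i)) * (\<Prod>i\<in>T. m i ((p \<circ> q) i))"
      by (rule prod.union_disjoint[OF fin disj])
    also have "(\<Prod>i\<in>S. m i ((p \<circ> q) i)) = (\<Prod>i\<in>S. m i (p i))"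
      using permutes_not_in[OF q] disj by (intro prod.cong) (auto simp: disjoint_iff)
    also have "(\<Prod>i\<in>T. m i ((p \<circ> q) i)) = (\<Prod>i\<in>T. m i (q i))"
    proof (intro prod.cong refl)
      fix i assume "i \<in> T"
      then have "q i \<notin> S" using permutes_in_image[OF q] disj by (auto simp: disjoint_iff)
      then show "m i ((p \<circ> q) i) = m i (q i)" using permutes_not_in[OF p] by simp
    qed
    finally show "?F (p \<circ> q) = of_int (sign p) * (\<Prod>i\<in>S. m i (p i)) * (of_int (sign q) * (\<Prod>i\<in>T. m i (q i)))"
      by (simp add: sgn algebra_simps)
  qed
  also have "\<dots> = ldet S m * ldet T m"
    unfolding ldet_def sum_product sum.cartesian_product ..
  finally show ?thesis .
qed

lemma ldet_blocks:
  assumes "finite I" "\<And>i. i \<in> I \<Longrightarrow> finite (A i)" "disjoint_family_on A I"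
    and "\<And>i j x y. i \<in> I \<Longrightarrow> j \<in> I \<Longrightarrow> i \<noteq> j \<Longrightarrow> x \<in> A i \<Longrightarrow> y \<in> A j \<Longrightarrow> m x y = 0"
  shows "ldet (\<Union>i\<in>I. A i) m = (\<Prod>i\<in>I. ldet (A i) m)"
  using assms
proof (induction I rule: finite_induct)
  case empty
  then show ?case by (simp add: ldet_def sign_id)
next
  case (insert i I)
  have "ldet (A i \<union> (\<Union>i\<in>I. A i)) m = ldet (A i) m * ldet (\<Union>i\<in>I. A i) m"
  proof (rule ldet_block)
    show "A i \<inter> (\<Union>i\<in>I. A i) = {}"
      using insert.prems(2) insert.hyps by (auto simp: disjoint_family_on_def)
    show "m x y = 0" if "x \<in> A i" "y \<in> (\<Union>i\<in>I. A i)" for x y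
    proof -
      from that(2) obtain j where "j \<in> I" "y \<in> A j" by blast
      then show ?thesis using insert.hyps(2) insert.prems(3)[of i j x y] that(1) by auto
    qed
  qed (use insert in auto)
  also have "ldet (\<Union>i\<in>I. A i) m = (\<Prod>i\<in>I. ldet (A i) m)"
  proof (rule insert.IH)
    show "disjoint_family_on A I" using insert.prems(2) by (auto simp: disjoint_family_on_def)
    show "finite (A i)" if "i \<in> I" for i using insert.prems(1) that by simp
    show "m x y = 0" if "i \<in> I" "j \<in> I" "i \<noteq> j" "x \<in> A i" "y \<in> A j" for i j x y
      by (rule insert.prems(3)[OF _ _ that(3-5)]) (use that in simp_all)
  qed
  finally show ?case using insert.hyps by simp
qed

text \<open>
  Jacobi's complementary minor theorem for \<open>N = M\<^sup>-\<^sup>T\<close>: multiply \<open>M\<close> by the matrix obtained from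
  \<open>N\<^sup>T\<close> by replacing the columns in \<open>S\<close> by unit vectors.
\<close>

lemma ldet_complementary_minor:
  assumes fin: "finite S" "finite T" and disj: "S \<inter> T = {}"
    and inverse: "\<And>i i'. i \<in> S \<union> T \<Longrightarrow> i' \<in> S \<union> T \<Longrightarrow>
      (\<Sum>b\<in>S \<union> T. M i b * N i' b) = (if i = i' then 1 else 0)"
  shows "ldet S M = ldet (S \<union> T) M * ldet T N"
proof -
  let ?Q = "\<lambda>b c. if c \<in> S then (if b = c then 1 else 0) else N c b"
  let ?P = "\<lambda>i c. \<Sum>b\<in>S \<union> T. M i b * ?Q b c"
  have PS: "?P i c = M i c" if "c \<in> S" for i c
  proof -
    have "?P i c = (\<Sum>b\<in>S \<union> T. if b = c then M i b else 0)"
      using that by (intro sum.cong) auto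
    then show ?thesis using that fin by simp
  qed
  have PT: "?P i c = (if i = c then 1 else 0)" if "i \<in> S \<union> T" "c \<in> T" for i c
  proof -
    have "c \<notin> S" using that disj by blast
    then have "?P i c = (\<Sum>b\<in>S \<union> T. M i b * N c b)" by simp
    then show ?thesis using inverse[OF that(1), of c] that by simp
  qed
  have "ldet (S \<union> T) ?P = ldet S ?P * ldet T ?P"
    by (rule ldet_block[OF fin disj]) (use PT disj in auto)
  also have "ldet S ?P = ldet S M"
    by (rule ldet_cong) (rule PS)
  also have "ldet T ?P = ldet T (\<lambda>i j. if i = j then 1 else 0)"
    by (rule ldet_cong) (rule PT, auto)
  also have "\<dots> = 1" by (rule ldet_delta[OF fin(2)])
  finally have 1: "ldet (S \<union> T) ?P = ldet S M" by simp
  \<comment> \<open>The zero block of \<open>?Q\<close> lies in the rows of \<open>T\<close> and the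
    columns of \<open>S\<close>, so the two sets change roles in \<open>ldet_block\<close>.\<close>
  have "ldet (T \<union> S) ?Q = ldet T ?Q * ldet S ?Q"
    by (rule ldet_block[OF fin(2,1)]) (use disj in auto)
  also have "ldet T ?Q = ldet T (\<lambda>i j. N j i)"
    by (rule ldet_cong) (use disj in auto)
  also have "\<dots> = ldet T N" by (rule ldet_transpose[OF fin(2)])
  also have "ldet S ?Q = ldet S (\<lambda>i j. if i = j then 1 else 0)"
    by (rule ldet_cong) auto
  also have "\<dots> = 1" by (rule ldet_delta[OF fin(1)])
  finally have 2: "ldet (S \<union> T) ?Q = ldet T N" by (simp add: Un_commute)
  show ?thesis
    using ldet_mult[of "S \<union> T" M ?Q] fin 1 2 by simp
qed

lemma ldet_inverse:
  fixes M :: "'i \<Rightarrow> 'i \<Rightarrow> 'a::field"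
  assumes S: "finite S" and nz: "ldet S M \<noteq> 0"
  obtains N where "\<And>i i'. i \<in> S \<Longrightarrow> i' \<in> S \<Longrightarrow> (\<Sum>b\<in>S. M i b * N i' b) = (if i = i' then 1 else 0)"
proof -
  obtain f where f: "bij_betw f {0..<card S} S"
    using ex_bij_betw_nat_finite[OF S] by blast
  let ?n = "card S"
  let ?A = "mat ?n ?n (\<lambda>(i, j). M (f i) (f j))"
  have A: "?A \<in> carrier_mat ?n ?n" by simp
  have "?A \<in> Units (ring_mat TYPE('a) ?n ())"
    by (rule det_non_zero_imp_unit[OF A]) (use nz ldet_det[OF f, of M] in simp)
  then obtain B where "B \<in> carrier (ring_mat TYPE('a) ?n ())"
    "?A \<otimes>\<^bsub>ring_mat TYPE('a) ?n ()\<^esub> B = \<one>\<^bsub>ring_mat TYPE('a) ?n ()\<^esub>"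
    unfolding Units_def by blast
  then have B: "B \<in> carrier_mat ?n ?n" "?A * B = 1\<^sub>m ?n"
    unfolding ring_mat_simps .
  let ?g = "inv_into {0..<?n} f"
  have g: "?g i < ?n" "f (?g i) = i" if "i \<in> S" for i
    using that bij_betwE[OF bij_betw_inv_into[OF f]] bij_betw_inv_into_right[OF f] by auto
  have gf: "?g (f k) = k" if "k < ?n" for k using bij_betw_inv_into_left[OF f] that by simp
  \<comment> \<open>The indices of \<open>B\<close> are exchanged: the sum runs over the second
    index of both matrices, so the partner of \<open>M\<close> is the transpose of its
    inverse.\<close>
  show ?thesis
  proof (rule that[of "\<lambda>i' b. B $$ (?g b, ?g i')"])
    fix i i' assume i: "i \<in> S" "i' \<in> S"
    have "(\<Sum>b\<in>S. M i b * B $$ (?g b, ?g i')) = (\<Sum>k\<in>{0..<?n}. M i (f k) * B $$ (?g (f k), ?g i'))"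
      by (rule sum.reindex_bij_betw[OF f, of "\<lambda>b. M i b * B $$ (?g b, ?g i')", symmetric])
    also have "\<dots> = (\<Sum>k\<in>{0..<?n}. ?A $$ (?g i, k) * B $$ (k, ?g i'))"
      using g[OF i(1)] by (intro sum.cong refl) (simp add: gf)
    also have "\<dots> = (?A * B) $$ (?g i, ?g i')"
      using g(1)[OF i(1)] g(1)[OF i(2)] B(1)
      by (subst index_mult_mat) (auto simp: scalar_prod_def)
    also have "\<dots> = (if i = i' then 1 else 0)"
    proof -
      have "?g i = ?g i' \<longleftrightarrow> i = i'" 
        by (rule inj_on_eq_iff[OF bij_betw_imp_inj_on[OF bij_betw_inv_into[OF f]] i])
      then show ?thesis unfolding B(2) index_one_mat(1)[OF g(1)[OF i(1)] g(1)[OF i(2)]] by (simp only:)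
    qed
    finally show "(\<Sum>b\<in>S. M i b * B $$ (?g b, ?g i')) = (if i = i' then 1 else 0)" .
  qed
qed

subsection \<open>The generic field\<close>

text \<open>Rational functions in countably many indeterminates; a monomial is a finitely supported
  exponent function on the natural numbers. With infinitely many indeterminates one type serves
  matrices of every size.\<close>

type_synonym 'k generic_field = "((nat \<Rightarrow>\<^sub>0 nat) \<Rightarrow>\<^sub>0 'k) fract"

definition poly_fract :: "((nat \<Rightarrow>\<^sub>0 nat) \<Rightarrow>\<^sub>0 'k::field) \<Rightarrow> 'k generic_field" where
  "poly_fract p = Fract p 1"

lemma poly_fract_simps [simp]:
  "poly_fract (p + q) = poly_fract p + poly_fract q" "poly_fract (p * q) = poly_fract p * poly_fract q" "poly_fract 0 = 0" "poly_fract 1 = 1"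
  "poly_fract p = poly_fract q \<longleftrightarrow> p = q"
  by (simp_all add: poly_fract_def eq_fract Zero_fract_def One_fract_def)

lemma poly_fract_minus: "poly_fract (- p) = - poly_fract p"
  using poly_fract_simps(1)[of p "- p"] by (simp add: eq_neg_iff_add_eq_0 add.commute del: poly_fract_simps(1))

lemma poly_fract_sum: "poly_fract (\<Sum>i\<in>A. f i) = (\<Sum>i\<in>A. poly_fract (f i))"
  by (induction A rule: infinite_finite_induct) auto

lemma poly_fract_prod: "poly_fract (\<Prod>i\<in>A. f i) = (\<Prod>i\<in>A. poly_fract (f i))"
  by (induction A rule: infinite_finite_induct) auto

lemma poly_fract_sign: "poly_fract (of_int (sign p)) = of_int (sign p)"
  by (simp add: sign_def poly_fract_minus)

lemma poly_fract_ldet: "poly_fract (ldet S m) = ldet S (\<lambda>i j. poly_fract (m i j))"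
  by (simp add: ldet_def poly_fract_sum poly_fract_prod poly_fract_sign)

definition generic_scalar :: "'k::field \<Rightarrow> 'k generic_field" where
  "generic_scalar c = poly_fract (Poly_Mapping.single 0 c)"

text \<open>The monomial consisting of the single indeterminate attached to position (i, b) of the
  generic matrix. The pair is coded as one natural number because indeterminates are numbered by
  naturals.\<close>

definition entry_exponent :: "nat \<Rightarrow> nat \<Rightarrow> nat \<Rightarrow>\<^sub>0 nat" where
  "entry_exponent i b = Poly_Mapping.single (prod_encode (i, b)) 1"

definition generic_entry :: "nat \<Rightarrow> nat \<Rightarrow> 'k::field generic_field" where
  "generic_entry i b = poly_fract (Poly_Mapping.single (entry_exponent i b) 1)"

interpretation generic: scalar_extension generic_scalar
  by unfold_locales (simp_all add: generic_scalar_def single_add mult_single flip: poly_fract_simps(1,2))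

lemma prod_monomials:
  "(\<Prod>i\<in>A. Poly_Mapping.single (m i) 1) = Poly_Mapping.single (\<Sum>i\<in>A. m i) (1 :: 'k::field)"
  for m :: "'i \<Rightarrow> nat \<Rightarrow>\<^sub>0 nat"
  by (induction A rule: infinite_finite_induct) (simp_all add: mult_single)

text \<open>A product of generic entries thus remembers how often each entry occurs in each row,
  which is exactly what determines a product of monomials in symmetric powers.\<close>

lemma lookup_entry_exponents:
  "Poly_Mapping.lookup (\<Sum>b\<in>A. entry_exponent (r b) (c b)) (prod_encode (i, k)) =
    card {b \<in> A. r b = i \<and> c b = k}" if "finite A"
proof -
  have "Poly_Mapping.lookup (\<Sum>b\<in>A. entry_exponent (r b) (c b)) (prod_encode (i, k)) =
      (\<Sum>b\<in>A. if r b = i \<and> c b = k then 1 else 0)"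
    by (auto simp: lookup_sum entry_exponent_def lookup_single when_def intro!: sum.cong)
  then show ?thesis using that by (simp add: sum.If_cases Int_def)
qed

text \<open>The diagonal monomial arises in the Leibniz sum from the identity only, so its
  coefficient is 1 in every characteristic.\<close>

lemma generic_det_nonzero: "ldet {1..d} generic_entry \<noteq> (0 :: 'k::field generic_field)"
proof -
  let ?M = "\<lambda>p. \<Sum>i\<in>{1..d}. entry_exponent i (p i)"
  let ?D = "ldet {1..d} (\<lambda>i j. Poly_Mapping.single (entry_exponent i j) 1)
    :: (nat \<Rightarrow>\<^sub>0 nat) \<Rightarrow>\<^sub>0 'k"
  have D: "?D = (\<Sum>p | p permutes {1..d}. Poly_Mapping.single (?M p) (of_int (sign p)))"
    unfolding ldet_def prod_monomials
    by (intro sum.cong refl) (simp add: mult_single flip: single_of_int)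
  have "p = id" if p: "p permutes {1..d}" and eq: "?M p = ?M id" for p
  proof
    fix i show "p i = id i"
    proof (cases "i \<in> {1..d}")
      case True
      have "card {b \<in> {1..d}. b = i \<and> p b = i} = card {b \<in> {1..d}. b = i \<and> id b = i}"
        using eq lookup_entry_exponents[of "{1..d}" "\<lambda>b. b" p i i]
          lookup_entry_exponents[of "{1..d}" "\<lambda>b. b" id i i] by simp
      also have "{b \<in> {1..d}. b = i \<and> id b = i} = {i}" using True by auto
      finally have "card {b \<in> {1..d}. b = i \<and> p b = i} = 1" by simp
      then have "{b \<in> {1..d}. b = i \<and> p b = i} \<noteq> {}"
        by (metis card.empty zero_neq_one)
      then show ?thesis by auto
    next
      case False
      then show ?thesis using permutes_not_in[OF p] by simp
    qed
  qed
  then have "Poly_Mapping.lookup ?D (?M id) = (\<Sum>p | p permutes {1..d}. if p = id then 1 else 0)"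
    unfolding D lookup_sum
    by (intro sum.cong refl) (auto simp: lookup_single when_def sign_id)
  also have "\<dots> = 1" by (simp add: permutes_id finite_permutations)
  finally have "?D \<noteq> 0" by auto
  then have "poly_fract ?D \<noteq> poly_fract 0" unfolding poly_fract_simps(5) .
  then show ?thesis unfolding poly_fract_ldet generic_entry_def[abs_def, symmetric] by simp
qed

text \<open>
  A functional sending the members of a spanning set to distinct monomials is injective: it has
  a left inverse sending each monomial back.
\<close>

lemma monomial_functional_injective:
  fixes S :: "('k::field, 'v, 'm) module_scheme"
  assumes S: "kspace S" and \<phi>: "generic.functional S \<phi>"
    and G: "G \<subseteq> carrier S" "vs_span S G = carrier S"
    and mono: "\<And>g. g \<in> G \<Longrightarrow> \<phi> g = poly_fract (Poly_Mapping.single (E g) 1)"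
    and inj: "\<And>g h. g \<in> G \<Longrightarrow> h \<in> G \<Longrightarrow> E g = E h \<Longrightarrow> g = h"
    and x: "x \<in> carrier S" "\<phi> x = 0"
  shows "x = \<zero>\<^bsub>S\<^esub>"
proof -
  interpret kspace S by (rule S)
  \<comment> \<open>\<open>c\<close> inverts \<open>E\<close> on \<open>G\<close>. Outside the image
    of \<open>E\<close> the value only has to lie in the carrier.\<close>
  define c where "c m = (if m \<in> E ` G then inv_into G E m else \<zero>\<^bsub>S\<^esub>)" for m
  define \<rho> where "\<rho> p = (\<Oplus>\<^bsub>S\<^esub>m\<in>Poly_Mapping.keys p. Poly_Mapping.lookup p m \<odot>\<^bsub>S\<^esub> c m)"
    for p :: "(nat \<Rightarrow>\<^sub>0 nat) \<Rightarrow>\<^sub>0 'k"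
  have c: "c m \<in> carrier S" for m
    using G(1) by (auto simp: c_def inv_into_into)
  have cE: "c (E g) = g" if "g \<in> G" for g
    using that inj by (simp add: c_def inv_into_f_f inj_on_def)
  have \<rho>_superset: "\<rho> p = (\<Oplus>\<^bsub>S\<^esub>m\<in>A. Poly_Mapping.lookup p m \<odot>\<^bsub>S\<^esub> c m)"
    if "finite A" "Poly_Mapping.keys p \<subseteq> A" for p A
    unfolding \<rho>_def
    by (rule add.finprod_mono_neutral_cong_left) (use that c in \<open>auto simp: in_keys_iff\<close>)
  have add: "\<rho> (p + q) = \<rho> p \<oplus>\<^bsub>S\<^esub> \<rho> q" for p q
  proof -
    let ?A = "Poly_Mapping.keys p \<union> Poly_Mapping.keys q"
    have A: "finite ?A" "Poly_Mapping.keys p \<subseteq> ?A" "Poly_Mapping.keys q \<subseteq> ?A"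
      "Poly_Mapping.keys (p + q) \<subseteq> ?A"
      using Poly_Mapping.keys_add[of p q] by auto
    show ?thesis
      unfolding \<rho>_superset[OF A(1,2)] \<rho>_superset[OF A(1,3)] \<rho>_superset[OF A(1,4)]
      using c by (subst finsum_addf[symmetric])
        (auto intro!: finsum_cong' simp: lookup_add smult_distrib_left)
  qed
  have smult: "\<rho> (Poly_Mapping.map ((*) a) p) = a \<odot>\<^bsub>S\<^esub> \<rho> p" for a p
  proof -
    have hom: "(\<lambda>x. a \<odot>\<^bsub>S\<^esub> x) \<in> LinearCombinations.module_hom class_ring S S"
      by (rule hom_kI) (simp_all add: smult_distrib_right smult_smult mult.commute)
    show ?thesis
      unfolding \<rho>_superset[OF finite_keys keys_map_mult] lookup_map_mult
      unfolding \<rho>_def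
      using c by (subst hom_finsum[OF S hom]) (auto intro!: finsum_cong' simp: smult_smult)
  qed
  \<comment> \<open>\<open>\<rho>\<close> is defined on polynomials, whereas \<open>\<phi>\<close>
    takes values in the fraction field. So the claim includes that the value is a
    polynomial.\<close>
  have "\<exists>p. \<phi> x = poly_fract p \<and> \<rho> p = x" if "x \<in> vs_span S G" for x
    using that G(1)
  proof (induction rule: span_gen_induct)
    case zero
    show ?case using generic.functional_zero[OF S \<phi>] by (intro exI[of _ 0]) (simp add: \<rho>_def)
  next
    case (gen g)
    then show ?case
      using G(1) by (intro exI[of _ "Poly_Mapping.single (E g) 1"]) (auto simp: mono \<rho>_def cE)
  next
    case (add x y)
    then obtain p q where "\<phi> x = poly_fract p" "\<rho> p = x" "\<phi> y = poly_fract q" "\<rho> q = y" by blast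
    then show ?case
      using generic.functional_add[OF \<phi> add.hyps] \<open>\<And>p q. \<rho> (p + q) = \<rho> p \<oplus>\<^bsub>S\<^esub> \<rho> q\<close>
      by (intro exI[of _ "p + q"]) simp
  next
    case (smult a x)
    then obtain p where p: "\<phi> x = poly_fract p" "\<rho> p = x" by blast
    have "poly_fract (Poly_Mapping.map ((*) a) p) = generic_scalar a * poly_fract p"
      unfolding mult_map_scale_conv_mult generic_scalar_def by (rule poly_fract_simps(2))
    then show ?case
      using p generic.functional_smult[OF \<phi> smult.hyps, of a] \<open>\<And>a p. \<rho> (Poly_Mapping.map ((*) a) p) = a \<odot>\<^bsub>S\<^esub> \<rho> p\<close>
      by (intro exI[of _ "Poly_Mapping.map ((*) a) p"]) simp
  qed
  then obtain p where p: "\<phi> x = poly_fract p" "\<rho> p = x" using x(1) G(2) by blast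
  then have "poly_fract p = poly_fract 0" using x(2) by simp
  then have "p = 0" unfolding poly_fract_simps(5) .
  then show ?thesis using p(2) by (simp add: \<rho>_def)
qed

subsection \<open>Evaluating elements of the Schur functor\<close>

text \<open>Boxes are filled with vectors instead of basis indices. In this form the elements built
  from \<open>s_gen\<close> depend linearly on each entry and a group element acts entry by entry,
  which cannot be expressed with tableaux of indices.\<close>

definition s_gen :: "nat list \<Rightarrow> ('k::field, 'v, 'g) rep \<Rightarrow> (nat \<times> nat \<Rightarrow> 'v) \<Rightarrow>
    (('v list \<Rightarrow>\<^sub>0 'k) set set list \<Rightarrow>\<^sub>0 'k) set" where
  "s_gen lam V x = pure_tensor (map (\<lambda>r. sym_power r V) lam)
    (map (\<lambda>i. sym_product V (map (\<lambda>j. x (i, j)) [1..<part lam i + 1])) [1..<length lam + 1])"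

definition e_gen :: "nat list \<Rightarrow> ('k::field, 'v, 'g) rep \<Rightarrow> (nat \<times> nat \<Rightarrow> 'v) \<Rightarrow>
    (('v list \<Rightarrow>\<^sub>0 'k) set set list \<Rightarrow>\<^sub>0 'k) set" where
  "e_gen lam V x = (\<Oplus>\<^bsub>sym_multi lam V\<^esub>\<sigma>\<in>CPP lam.
    of_int (sign \<sigma>) \<odot>\<^bsub>sym_multi lam V\<^esub> s_gen lam V (\<lambda>b. x (inv_into UNIV \<sigma> b)))"

lemma e_tab_eq_e_gen: "e_tab lam V v t = e_gen lam V (\<lambda>b. v (t b))"
  unfolding e_tab_def e_gen_def s_tab_def s_gen_def ..

lemma young_Sigma: "young lam = (SIGMA i:{1..length lam}. {1..part lam i})"
  by (auto simp: young_def)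

lemma finite_young: "finite (young lam)"
  unfolding young_Sigma by simp

lemma CPP_permutes: "\<sigma> \<in> CPP lam \<Longrightarrow> \<sigma> permutes young lam"
  by (simp add: CPP_def)

definition young_row :: "nat list \<Rightarrow> (nat \<times> nat \<Rightarrow> 'v) \<Rightarrow> nat \<Rightarrow> 'v list" where
  "young_row lam x i = map (\<lambda>j. x (i, j)) [1..<part lam i + 1]"

lemma length_young_row [simp]: "length (young_row lam x i) = part lam i"
  by (simp add: young_row_def)

lemma set_young_row:
  "x \<in> young lam \<rightarrow> A \<Longrightarrow> 1 \<le> i \<Longrightarrow> i \<le> length lam \<Longrightarrow> set (young_row lam x i) \<subseteq> A"
  by (auto simp: young_row_def young_def)

lemma s_gen_rows:
  "s_gen lam V x = pure_tensor (map (\<lambda>r. sym_power r V) lam)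
    (map (\<lambda>i. sym_product V (young_row lam x (Suc i))) [0..<length lam])"
proof -
  have "[1..<length lam + 1] = map Suc [0..<length lam]" by (simp add: map_Suc_upt del: upt_Suc)
  then show ?thesis unfolding s_gen_def young_row_def by (simp only: map_map comp_def)
qed

lemma part_Suc: "i < length lam \<Longrightarrow> part lam (Suc i) = lam ! i"
  by (simp add: part_def)

lemma permuted_filling:
  "x \<in> young lam \<rightarrow> A \<Longrightarrow> \<sigma> \<in> CPP lam \<Longrightarrow> (\<lambda>b. x (inv_into UNIV \<sigma> b)) \<in> young lam \<rightarrow> A"
  using permutes_in_image[OF permutes_inv[OF CPP_permutes]] by (auto simp: Pi_iff)

context kspace_rep begin

lemma sym_spaces: "kspaces (map (\<lambda>r. sym_power r V) lam)"
proof (rule kspaces.intro)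
  fix W assume "W \<in> set (map (\<lambda>r. sym_power r V) lam)"
  then obtain r where W: "W = sym_power r V" by auto
  interpret power_space V r by unfold_locales
  show "kspace W" unfolding W by (rule sym_kspace)
qed

lemma multi_kspace: "kspace (sym_multi lam V)"
  unfolding sym_multi_def by (rule kspaces.tensor_kspace[OF sym_spaces])

lemma row_product_closed:
  assumes "x \<in> young lam \<rightarrow> carrier V" "i < length lam"
  shows "sym_product V (young_row lam x (Suc i)) \<in> carrier (sym_power (lam ! i) V)"
proof -
  interpret power_space V "lam ! i" by unfold_locales
  show ?thesis
    by (rule sym_product_closed) (use assms set_young_row[of x lam "carrier V" "Suc i"] in \<open>simp_all add: part_Suc\<close>)
qed

lemma s_gen_tuple:
  assumes "x \<in> young lam \<rightarrow> carrier V"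
  shows "map (\<lambda>i. sym_product V (young_row lam x (Suc i))) [0..<length lam]
    \<in> listset (map carrier (map (\<lambda>r. sym_power r V) lam))"
  unfolding mem_listset_iff using row_product_closed[OF assms] by simp

lemma s_gen_closed: "x \<in> young lam \<rightarrow> carrier V \<Longrightarrow> s_gen lam V x \<in> carrier (sym_multi lam V)"
  unfolding sym_multi_def s_gen_rows
  by (rule kspaces.pure_tensor_closed[OF sym_spaces]) (rule s_gen_tuple)

lemma e_gen_closed:
  assumes "x \<in> young lam \<rightarrow> carrier V"
  shows "e_gen lam V x \<in> carrier (sym_multi lam V)"
proof -
  interpret M: kspace "sym_multi lam V" by (rule multi_kspace)
  show ?thesis unfolding e_gen_def
    by (rule M.finsum_closed) (use s_gen_closed permuted_filling[OF assms] in auto)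
qed

lemma s_gen_span:
  assumes D: "D \<subseteq> carrier V" "vs_span V D = carrier V"
  shows "vs_span (sym_multi lam V) (s_gen lam V ` (young lam \<rightarrow> D)) = carrier (sym_multi lam V)"
proof -
  interpret M: kspace "sym_multi lam V" by (rule multi_kspace)
  let ?Ws = "map (\<lambda>r. sym_power r V) lam"
  let ?Ss = "map (\<lambda>r. sym_product V ` {xs. length xs = r \<and> set xs \<subseteq> D}) lam"
  have sub: "s_gen lam V ` (young lam \<rightarrow> D) \<subseteq> carrier (sym_multi lam V)"
    using s_gen_closed D(1) by (intro image_subsetI) (auto simp: Pi_iff subset_iff)
  have span: "vs_span (tensor_list ?Ws) (pure_tensor ?Ws ` listset ?Ss) = carrier (tensor_list ?Ws)"
  proof (rule kspaces.tensor_span[OF sym_spaces])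
    fix i assume i: "i < length ?Ws"
    interpret power_space V "lam ! i" by unfold_locales
    show "?Ss ! i \<subseteq> carrier (?Ws ! i)"
      using i D(1) sym_product_closed by (auto simp del: set_conv_nth)
    show "vs_span (?Ws ! i) (?Ss ! i) = carrier (?Ws ! i)"
      using i sym_span[OF D] by simp
  qed simp
  have "pure_tensor ?Ws ys \<in> s_gen lam V ` (young lam \<rightarrow> D)" if ys: "ys \<in> listset ?Ss" for ys
  proof -
    have len: "length ys = length lam" using ys by (simp add: mem_listset_iff)
    have "\<forall>i<length lam. \<exists>xs. ys ! i = sym_product V xs \<and> length xs = lam ! i \<and> set xs \<subseteq> D"
    proof (intro allI impI)
      fix i assume "i < length lam"
      then have "ys ! i \<in> sym_product V ` {xs. length xs = lam ! i \<and> set xs \<subseteq> D}"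
        using ys by (simp add: mem_listset_iff)
      then show "\<exists>xs. ys ! i = sym_product V xs \<and> length xs = lam ! i \<and> set xs \<subseteq> D" by blast
    qed
    then obtain X where X: "\<And>i. i < length lam \<Longrightarrow> ys ! i = sym_product V (X i)"
      "\<And>i. i < length lam \<Longrightarrow> length (X i) = lam ! i" "\<And>i. i < length lam \<Longrightarrow> set (X i) \<subseteq> D"
      by metis
    \<comment> \<open>Boxes are numbered from 1 and list positions from 0.\<close>
    let ?x = "\<lambda>(i, j). X (i - Suc 0) ! (j - Suc 0)"
    have row: "young_row lam ?x (Suc i) = X i" if "i < length lam" for i
      using X(2)[OF that] that by (intro nth_equalityI) (auto simp: young_row_def part_Suc simp del: upt_Suc)
    have "?x b \<in> D" if b: "b \<in> young lam" for b
    proof -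
      obtain i j where ij: "b = (i, j)" "1 \<le> i" "i \<le> length lam" "1 \<le> j" "j \<le> part lam i"
        using b by (auto simp: young_def)
      then have "i - 1 < length lam" "part lam i = lam ! (i - 1)" by (auto simp: part_def)
      then show ?thesis using X(2,3)[of "i - 1"] ij nth_mem[of "j - 1" "X (i - 1)"] by auto
    qed
    moreover have "ys = map (\<lambda>i. sym_product V (young_row lam ?x (Suc i))) [0..<length lam]"
      by (rule nth_equalityI) (simp_all add: len X(1) row)
    ultimately show ?thesis unfolding s_gen_rows by (intro image_eqI[of _ _ ?x]) auto
  qed
  then have "pure_tensor ?Ws ` listset ?Ss \<subseteq> s_gen lam V ` (young lam \<rightarrow> D)"
    by (rule image_subsetI)
  then have "pure_tensor ?Ws ` listset ?Ss \<subseteq> vs_span (sym_multi lam V) (s_gen lam V ` (young lam \<rightarrow> D))"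
    using M.in_own_span[OF sub] by (rule subset_trans)
  note M.span_minimal[OF M.span_submodule[OF sub] this]
  then have "carrier (sym_multi lam V) \<subseteq> vs_span (sym_multi lam V) (s_gen lam V ` (young lam \<rightarrow> D))"
    using span unfolding sym_multi_def by (simp only:)
  then show ?thesis by (intro subset_antisym M.span_is_subset2 sub)
qed

text \<open>Products in a symmetric power depend only on the multiset of factors. This is the
  converse direction to reading row contents off a generic monomial.\<close>

lemma s_gen_cong_mset:
  assumes x: "x \<in> young lam \<rightarrow> carrier V"
    and eq: "\<And>i. i < length lam \<Longrightarrow> mset (young_row lam x (Suc i)) = mset (young_row lam y (Suc i))"
  shows "s_gen lam V x = s_gen lam V y"
proof -
  have "sym_product V (young_row lam x (Suc i)) = sym_product V (young_row lam y (Suc i))"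
    if i: "i < length lam" for i
  proof -
    interpret power_space V "lam ! i" by unfold_locales
    show ?thesis
      by (rule sym_product_mset_eq[OF _ _ eq[OF i]])
        (use i set_young_row[OF x, of "Suc i"] in \<open>simp_all add: part_Suc\<close>)
  qed
  then show ?thesis unfolding s_gen_rows
    by (intro arg_cong[where f = "pure_tensor _"] map_cong) auto
qed

end

context scalar_extension begin

definition row_val :: "('v \<Rightarrow> 'l) \<Rightarrow> ('v list \<Rightarrow>\<^sub>0 'k) set set \<Rightarrow> 'l" where
  "row_val \<phi> = coset_val (tensor_val (\<lambda>xs. prod_list (map \<phi> xs)))"

text \<open>Each row has its own functional: with a common one, an antisymmetrised element would
  evaluate to 0 as soon as a column has two boxes. The \<open>Suc\<close> passes from list positions
  to row numbers.\<close>

definition multi_val :: "nat list \<Rightarrow> (nat \<Rightarrow> 'v \<Rightarrow> 'l) \<Rightarrow>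
    (('v list \<Rightarrow>\<^sub>0 'k) set set list \<Rightarrow>\<^sub>0 'k) set \<Rightarrow> 'l" where
  "multi_val lam a = tensor_val (\<lambda>ys. \<Prod>i<length lam. row_val (a (Suc i)) (ys ! i))"

lemma prod_update:
  fixes f :: "nat \<Rightarrow> 'a \<Rightarrow> 'l"
  assumes "i < length xs"
  shows "(\<Prod>j<length xs. f j (xs[i := x] ! j)) = f i x * (\<Prod>j\<in>{..<length xs} - {i}. f j (xs ! j))"
  using assms by (subst prod.remove[of _ i]) (auto intro!: arg_cong2[where f = "(*)"] prod.cong)

lemma prod_multilinear:
  assumes "\<And>i. i < length Vs \<Longrightarrow> functional (Vs ! i) (f i)" "kspaces Vs"
  shows "multilinear Vs (\<lambda>xs. \<Prod>j<length Vs. f j (xs ! j))"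
  unfolding multilinear_def
proof (intro ballI allI impI)
  fix xs i a b x y
  assume xs: "xs \<in> listset (map carrier Vs)" and i: "i < length Vs"
    and xy: "x \<in> carrier (Vs ! i)" "y \<in> carrier (Vs ! i)"
  interpret kspace "Vs ! i" by (rule kspaces.kspace_nth[OF assms(2) i])
  have len: "length Vs = length xs" using xs by (simp add: mem_listset_iff)
  have "f i (a \<odot>\<^bsub>Vs ! i\<^esub> x \<oplus>\<^bsub>Vs ! i\<^esub> b \<odot>\<^bsub>Vs ! i\<^esub> y) = \<kappa> a * f i x + \<kappa> b * f i y"
    using xy by (simp add: functional_add[OF assms(1)[OF i]] functional_smult[OF assms(1)[OF i]])
  then show "(\<Prod>j<length Vs. f j (xs[i := a \<odot>\<^bsub>Vs ! i\<^esub> x \<oplus>\<^bsub>Vs ! i\<^esub> b \<odot>\<^bsub>Vs ! i\<^esub> y] ! j)) =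
      \<kappa> a * (\<Prod>j<length Vs. f j (xs[i := x] ! j)) + \<kappa> b * (\<Prod>j<length Vs. f j (xs[i := y] ! j))"
    unfolding len prod_update[OF i[unfolded len]] by (simp add: algebra_simps)
qed

lemma
  fixes V :: "('k, 'v, 'g) rep"
  assumes V: "kspace V" and \<phi>: "functional V \<phi>"
  shows row_val_functional: "functional (sym_power r V) (row_val \<phi>)"
    and row_val_product: "length xs = r \<Longrightarrow> set xs \<subseteq> carrier V \<Longrightarrow>
      row_val \<phi> (sym_product V xs) = prod_list (map \<phi> xs)"
proof -
  interpret kspace_rep V using V by (simp add: kspace_rep_def)
  have ml: "multilinear (replicate r V) (\<lambda>xs. prod_list (map \<phi> xs))"
  proof -
    have "multilinear (replicate r V) (\<lambda>xs. \<Prod>j<length (replicate r V). \<phi> (xs ! j))"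
      by (rule prod_multilinear[OF _ kspaces_replicate]) (simp add: \<phi>)
    moreover have "prod_list (map \<phi> xs) = (\<Prod>j<length (replicate r V). \<phi> (xs ! j))"
      if "length xs = r" for xs
      using that by (simp add: prod.list_conv_set_nth atLeast0LessThan)
    ultimately show ?thesis
      unfolding multilinear_def by (simp add: mem_listset_iff)
  qed
  have sym: "symmetric_on r (carrier V) (\<lambda>xs. prod_list (map \<phi> xs))"
    unfolding symmetric_on_def
  proof (intro allI impI)
    fix xs :: "'v list" and \<sigma> assume "length xs = r" "\<sigma> permutes {..<r}"
    then have "mset (map \<phi> (permute_list \<sigma> xs)) = mset (map \<phi> xs)" by simp
    then show "prod_list (map \<phi> (permute_list \<sigma> xs)) = prod_list (map \<phi> xs)"
      by (simp only: prod_mset_prod_list[symmetric])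
  qed
  show "functional (sym_power r V) (row_val \<phi>)"
    unfolding row_val_def by (rule sym_val_functional[OF V ml sym])
  show "row_val \<phi> (sym_product V xs) = prod_list (map \<phi> xs)"
    if "length xs = r" "set xs \<subseteq> carrier V"
    unfolding row_val_def by (rule sym_val_product[OF V ml sym that])
qed

context
  fixes V :: "('k, 'v, 'g) rep" and a :: "nat \<Rightarrow> 'v \<Rightarrow> 'l"
  assumes V: "kspace V" and a: "\<And>i. functional V (a i)"
begin

interpretation kspace_rep V using V by (simp add: kspace_rep_def)

lemma multi_val_multilinear:
  "multilinear (map (\<lambda>r. sym_power r V) lam)
    (\<lambda>ys. \<Prod>i<length lam. row_val (a (Suc i)) (ys ! i))"
proof -
  have "multilinear (map (\<lambda>r. sym_power r V) lam)
      (\<lambda>ys. \<Prod>i<length (map (\<lambda>r. sym_power r V) lam). row_val (a (Suc i)) (ys ! i))"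
    by (rule prod_multilinear[OF _ sym_spaces]) (simp add: row_val_functional[OF V a])
  then show ?thesis by simp
qed

lemma multi_val_functional: "functional (sym_multi lam V) (multi_val lam a)"
  unfolding sym_multi_def multi_val_def
  by (rule tensor_val_functional[OF sym_spaces multi_val_multilinear])

lemma multi_val_s_gen:
  assumes x: "x \<in> young lam \<rightarrow> carrier V"
  shows "multi_val lam a (s_gen lam V x) = (\<Prod>b\<in>young lam. a (fst b) (x b))"
proof -
  have "multi_val lam a (s_gen lam V x) =
      (\<Prod>i<length lam. row_val (a (Suc i)) (sym_product V (young_row lam x (Suc i))))"
    unfolding multi_val_def s_gen_rows tensor_val_pure[OF sym_spaces multi_val_multilinear s_gen_tuple[OF x]]
    by simp
  also have "\<dots> = (\<Prod>i<length lam. \<Prod>j\<in>{1..part lam (Suc i)}. a (Suc i) (x (Suc i, j)))"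
  proof (rule prod.cong)
    fix i assume "i \<in> {..<length lam}"
    then have "row_val (a (Suc i)) (sym_product V (young_row lam x (Suc i))) =
        prod_list (map (a (Suc i)) (young_row lam x (Suc i)))"
      using set_young_row[OF x, of "Suc i"] by (intro row_val_product[OF V a refl]) auto
    also have "\<dots> = (\<Prod>j\<leftarrow>[1..<part lam (Suc i) + 1]. a (Suc i) (x (Suc i, j)))"
      unfolding young_row_def map_map comp_def ..
    also have "\<dots> = (\<Prod>j\<in>{1..part lam (Suc i)}. a (Suc i) (x (Suc i, j)))"
      by (subst prod.distinct_set_conv_list[symmetric]) (simp_all add: atLeastLessThanSuc_atLeastAtMost del: upt_Suc)
    finally show "row_val (a (Suc i)) (sym_product V (young_row lam x (Suc i))) =
        (\<Prod>j\<in>{1..part lam (Suc i)}. a (Suc i) (x (Suc i, j)))" .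
  qed simp
  also have "\<dots> = (\<Prod>i\<in>{1..length lam}. \<Prod>j\<in>{1..part lam i}. a i (x (i, j)))"
    by (rule prod.reindex_bij_witness[of _ "\<lambda>i. i - 1" Suc]) auto
  also have "\<dots> = (\<Prod>b\<in>young lam. a (fst b) (x b))"
    unfolding young_Sigma by (subst prod.Sigma) (auto intro: prod.cong)
  finally show ?thesis .
qed

text \<open>The zeros between boxes of different columns remove from the Leibniz sum over all
  permutations of the diagram those outside \<open>CPP\<close>. So the alternating sum defining
  \<open>e_gen\<close> becomes a single determinant.\<close>

lemma multi_val_e_gen:
  assumes x: "x \<in> young lam \<rightarrow> carrier V"
  shows "multi_val lam a (e_gen lam V x) =
    ldet (young lam) (\<lambda>b c. if snd b = snd c then a (fst b) (x c) else 0)"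
proof -
  interpret M: kspace "sym_multi lam V" by (rule multi_kspace)
  let ?m = "\<lambda>b c. if snd b = snd c then a (fst b) (x c) else 0"
  have cl: "s_gen lam V (\<lambda>b. x (inv_into UNIV \<sigma> b)) \<in> carrier (sym_multi lam V)"
    if "\<sigma> \<in> CPP lam" for \<sigma>
    by (rule s_gen_closed[OF permuted_filling[OF x that]])
  have "multi_val lam a (e_gen lam V x) = (\<Sum>\<sigma>\<in>CPP lam.
      multi_val lam a (of_int (sign \<sigma>) \<odot>\<^bsub>sym_multi lam V\<^esub> s_gen lam V (\<lambda>b. x (inv_into UNIV \<sigma> b))))"
    unfolding e_gen_def
    by (rule functional_finsum[OF M.kspace_axioms multi_val_functional]) (rule M.smult_closed'[OF cl])
  also have "\<dots> = (\<Sum>\<sigma>\<in>CPP lam. of_int (sign \<sigma>) * (\<Prod>b\<in>young lam. a (fst b) (x (inv_into UNIV \<sigma> b))))"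
    by (intro sum.cong refl)
      (simp only: functional_smult[OF multi_val_functional cl] \<kappa>_sign multi_val_s_gen[OF permuted_filling[OF x]])
  \<comment> \<open>Inversion is a sign-preserving bijection of \<open>CPP\<close>, and it puts the
    sum into the shape of the Leibniz formula.\<close>
  also have "\<dots> = (\<Sum>\<sigma>\<in>CPP lam. of_int (sign \<sigma>) * (\<Prod>b\<in>young lam. a (fst b) (x (\<sigma> b))))"
  proof -
    have inv_inv: "inv_into UNIV (inv_into UNIV \<sigma>) = \<sigma>" if "\<sigma> \<in> CPP lam" for \<sigma>
      by (rule permutes_inv_inv[OF CPP_permutes[OF that]])
    have inv_CPP: "inv_into UNIV \<sigma> \<in> CPP lam" if \<sigma>: "\<sigma> \<in> CPP lam" for \<sigma>
      unfolding CPP_def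
    proof (intro CollectI conjI ballI)
      note p = CPP_permutes[OF \<sigma>]
      show "inv_into UNIV \<sigma> permutes young lam" by (rule permutes_inv[OF p])
      fix b assume "b \<in> young lam"
      then have "inv_into UNIV \<sigma> b \<in> young lam"
        using permutes_in_image[OF permutes_inv[OF p]] by simp
      then have "snd (\<sigma> (inv_into UNIV \<sigma> b)) = snd (inv_into UNIV \<sigma> b)"
        using \<sigma> by (simp add: CPP_def)
      then show "snd (inv_into UNIV \<sigma> b) = snd b" by (simp add: permutes_inverses(1)[OF p])
    qed
    have "sign (inv_into UNIV \<sigma>) = sign \<sigma>" if "\<sigma> \<in> CPP lam" for \<sigma>
    proof -
      have "permutation \<sigma>"
        using CPP_permutes[OF that] finite_young permutation_permutes by blast
      then show ?thesis by (rule sign_inverse)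
    qed
    then show ?thesis
      by (intro sum.reindex_bij_witness[of _ "inv_into UNIV" "inv_into UNIV"])
        (simp_all add: inv_inv inv_CPP)
  qed
  also have "\<dots> = (\<Sum>\<sigma>\<in>CPP lam. of_int (sign \<sigma>) * (\<Prod>b\<in>young lam. ?m b (\<sigma> b)))"
    by (intro sum.cong refl arg_cong2[where f = "(*)"] prod.cong) (auto simp: CPP_def)
  also have "\<dots> = ldet (young lam) ?m"
    unfolding ldet_def
  proof (rule sum.mono_neutral_left)
    show "\<forall>\<sigma>\<in>{p. p permutes young lam} - CPP lam. of_int (sign \<sigma>) * (\<Prod>b\<in>young lam. ?m b (\<sigma> b)) = 0"
    proof
      fix \<sigma> assume "\<sigma> \<in> {p. p permutes young lam} - CPP lam"
      then obtain b where "b \<in> young lam" "snd (\<sigma> b) \<noteq> snd b" by (auto simp: CPP_def)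
      then have "(\<Prod>b\<in>young lam. ?m b (\<sigma> b)) = 0"
        using finite_young[of lam] by (intro prod_zero bexI[of _ b]) simp_all
      then show "of_int (sign \<sigma>) * (\<Prod>b\<in>young lam. ?m b (\<sigma> b)) = 0" by simp
    qed
  qed (use finite_young finite_permutations in \<open>auto simp: CPP_def\<close>)
  finally show ?thesis .
qed

end

end

section \<open>Group action on the elements attached to fillings\<close>

lemma
  assumes G: "group G" and V: "representation G V"
  shows multi_representation: "representation G (sym_multi lam V)"
    and act_s_gen: "\<And>g x. g \<in> carrier G \<Longrightarrow> x \<in> young lam \<rightarrow> carrier V \<Longrightarrow>
      act (sym_multi lam V) g (s_gen lam V x) = s_gen lam V (\<lambda>b. act V g (x b))"
    and act_e_gen: "\<And>g x. g \<in> carrier G \<Longrightarrow> x \<in> young lam \<rightarrow> carrier V \<Longrightarrow>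
      act (sym_multi lam V) g (e_gen lam V x) = e_gen lam V (\<lambda>b. act V g (x b))"
proof -
  interpret kspace_rep V using representation_kspace[OF V] by (simp add: kspace_rep_def)
  interpret M: kspace "sym_multi lam V" by (rule multi_kspace)
  let ?Ws = "map (\<lambda>r. sym_power r V) lam"
  have Ws: "representation G W" if "W \<in> set ?Ws" for W
    using that sym_representation[OF G V] by auto
  show rep: "representation G (sym_multi lam V)"
    unfolding sym_multi_def by (rule tensor_representation[OF G Ws])
  show act_s: "act (sym_multi lam V) g (s_gen lam V x) = s_gen lam V (\<lambda>b. act V g (x b))"
    if g: "g \<in> carrier G" and x: "x \<in> young lam \<rightarrow> carrier V" for g x
  proof -
    have row: "act (sym_power (lam ! i) V) g (sym_product V (young_row lam x (Suc i))) =
        sym_product V (young_row lam (\<lambda>b. act V g (x b)) (Suc i))" if i: "i < length lam" for i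
    proof -
      have "act (sym_power (lam ! i) V) g (sym_product V (young_row lam x (Suc i))) =
          sym_product V (map (act V g) (young_row lam x (Suc i)))"
        by (rule act_sym_product[OF G V g])
          (use i set_young_row[OF x, of "Suc i"] in \<open>simp_all add: part_Suc\<close>)
      then show ?thesis by (simp add: young_row_def comp_def)
    qed
    have "act (sym_multi lam V) g (s_gen lam V x) = pure_tensor ?Ws
        (map2 (\<lambda>W y. act W g y) ?Ws (map (\<lambda>i. sym_product V (young_row lam x (Suc i))) [0..<length lam]))"
      unfolding sym_multi_def s_gen_rows
      by (rule act_pure_tensor[OF G Ws g s_gen_tuple[OF x]])
    also have "map2 (\<lambda>W y. act W g y) ?Ws (map (\<lambda>i. sym_product V (young_row lam x (Suc i))) [0..<length lam])
        = map (\<lambda>i. sym_product V (young_row lam (\<lambda>b. act V g (x b)) (Suc i))) [0..<length lam]"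
      by (rule nth_equalityI) (simp_all add: row)
    finally show ?thesis unfolding s_gen_rows .
  qed
  show "act (sym_multi lam V) g (e_gen lam V x) = e_gen lam V (\<lambda>b. act V g (x b))"
    if g: "g \<in> carrier G" and x: "x \<in> young lam \<rightarrow> carrier V" for g x
  proof -
    note hom = representation.act_linear[OF rep g]
    have cl: "s_gen lam V (\<lambda>b. x (inv_into UNIV \<sigma> b)) \<in> carrier (sym_multi lam V)"
      if "\<sigma> \<in> CPP lam" for \<sigma>
      by (rule s_gen_closed[OF permuted_filling[OF x that]])
    have "act (sym_multi lam V) g (e_gen lam V x) = (\<Oplus>\<^bsub>sym_multi lam V\<^esub>\<sigma>\<in>CPP lam.
        act (sym_multi lam V) g (of_int (sign \<sigma>) \<odot>\<^bsub>sym_multi lam V\<^esub>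
          s_gen lam V (\<lambda>b. x (inv_into UNIV \<sigma> b))))"
      unfolding e_gen_def
      by (rule M.hom_finsum[OF M.kspace_axioms hom]) (rule M.smult_closed'[OF cl])
    also have "\<dots> = e_gen lam V (\<lambda>b. act V g (x b))"
      unfolding e_gen_def
    proof (rule M.finsum_cong'[OF refl])
      show "(\<lambda>\<sigma>. of_int (sign \<sigma>) \<odot>\<^bsub>sym_multi lam V\<^esub> s_gen lam V (\<lambda>b. act V g (x (inv_into UNIV \<sigma> b))))
          \<in> CPP lam \<rightarrow> carrier (sym_multi lam V)"
      proof (intro Pi_I M.smult_closed')
        fix \<sigma> assume \<sigma>: "\<sigma> \<in> CPP lam"
        show "s_gen lam V (\<lambda>b. act V g (x (inv_into UNIV \<sigma> b))) \<in> carrier (sym_multi lam V)"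
          unfolding act_s[OF g permuted_filling[OF x \<sigma>], symmetric] by (rule hom_k_closed[OF hom cl[OF \<sigma>]])
      qed
      fix \<sigma> assume \<sigma>: "\<sigma> \<in> CPP lam"
      show "act (sym_multi lam V) g (of_int (sign \<sigma>) \<odot>\<^bsub>sym_multi lam V\<^esub> s_gen lam V (\<lambda>b. x (inv_into UNIV \<sigma> b)))
        = of_int (sign \<sigma>) \<odot>\<^bsub>sym_multi lam V\<^esub> s_gen lam V (\<lambda>b. act V g (x (inv_into UNIV \<sigma> b)))"
        unfolding hom_k_smult[OF hom cl[OF \<sigma>]] act_s[OF g permuted_filling[OF x \<sigma>]] ..
    qed
    finally show ?thesis .
  qed
qed

subsection \<open>Columns of a partition and of its complement\<close>

lemma part_antimono:
  assumes "is_partition lam" "1 \<le> i" "i \<le> i'"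
  shows "part lam i' \<le> part lam i"
proof (cases "i = i' \<or> length lam < i'")
  case True
  then show ?thesis by (auto simp: part_def)
next
  case False
  then have "lam ! (i - 1) \<ge> lam ! (i' - 1)"
    using assms by (intro sorted_wrt_nth_less[of "(\<ge>)"]) (auto simp: is_partition_def)
  then show ?thesis using False assms by (auto simp: part_def)
qed

lemma mem_young_iff: "(i, j) \<in> young lam \<longleftrightarrow> 1 \<le> i \<and> 1 \<le> j \<and> j \<le> part lam i"
  by (auto simp: young_def part_def split: if_splits)

text \<open>For \<open>j \<ge> 1\<close> and a partition with at most \<open>d\<close> parts this is
  the j-th part of the conjugate partition.\<close>

definition column_height :: "nat \<Rightarrow> nat list \<Rightarrow> nat \<Rightarrow> nat" where
  "column_height d lam j = card {i \<in> {1..d}. j \<le> part lam i}"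

lemma column_height_le: "column_height d lam j \<le> d"
proof -
  have "column_height d lam j \<le> card {1..d}"
    unfolding column_height_def by (rule card_mono) auto
  then show ?thesis by simp
qed

lemma initial_segment:
  assumes "D \<subseteq> {1..d::nat}" "\<And>i i'. i' \<in> D \<Longrightarrow> 1 \<le> i \<Longrightarrow> i \<le> i' \<Longrightarrow> i \<in> D"
  shows "D = {1..card D}"
proof (cases "D = {}")
  case False
  have fin: "finite D" using assms(1) finite_subset by blast
  have "D = {1..Max D}"
    using assms Max_in[OF fin False] Max_ge[OF fin] by fastforce
  then show ?thesis by (metis card_atLeastAtMost diff_Suc_1)
qed simp

text \<open>The rows that reach column \<open>j\<close> form an initial segment of the rows, so they
  are described by their number. This adjunction turns rows into columns for the shape and for its
  complement.\<close>

lemma le_part_iff_column_height: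
  assumes "is_partition lam" "i \<in> {1..d}"
  shows "j \<le> part lam i \<longleftrightarrow> i \<le> column_height d lam j"
proof -
  let ?D = "{i \<in> {1..d}. j \<le> part lam i}"
  have "?D = {1..card ?D}"
    by (rule initial_segment[of _ d]) (use part_antimono[OF assms(1)] in \<open>auto intro: order_trans\<close>)
  then have "i \<in> ?D \<longleftrightarrow> i \<in> {1..column_height d lam j}"
    unfolding column_height_def by (rule arg_cong)
  then show ?thesis using assms(2) by auto
qed

lemma young_columns:
  assumes lam: "is_partition lam" "length lam \<le> d" "part lam 1 \<le> s"
  shows "young lam = (\<Union>j\<in>{1..s}. {1..column_height d lam j} \<times> {j})"
proof -
  have "(i, j) \<in> young lam \<longleftrightarrow> j \<in> {1..s} \<and> i \<in> {1..column_height d lam j}" for i j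
  proof (cases "i \<in> {1..d}")
    case True
    then have "part lam i \<le> s" using part_antimono[OF lam(1), of 1 i] lam(3) by auto
    then show ?thesis
      using True le_part_iff_column_height[OF lam(1) True, of j] by (auto simp: mem_young_iff)
  next
    case False
    then show ?thesis
      using lam(2) column_height_le[of d lam j] by (auto simp: young_def)
  qed
  then show ?thesis by auto
qed

lemma part_Cons: "part (x # xs) i = (if i = 1 then x else if i = 0 then 0 else part xs (i - 1))"
  by (cases i) (auto simp: part_def nth_Cons')

text \<open>In a decreasing list all zeros are at the end, where \<open>part\<close> returns 0
  anyway; deleting them shifts nothing.\<close>

lemma part_filter_nonzero:
  assumes "sorted_wrt (\<ge>) xs"
  shows "part (filter (\<lambda>p. p \<noteq> 0) xs) i = part xs i"
  using assms
proof (induction xs arbitrary: i)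
  case (Cons x xs)
  show ?case
  proof (cases "x = 0")
    case True
    then have zero: "\<forall>y\<in>set xs. y = 0" using Cons.prems by auto
    then have "filter (\<lambda>p. p \<noteq> 0) (x # xs) = []" using True by (simp add: filter_empty_conv)
    moreover have "part (x # xs) i = 0"
      using True zero by (auto simp: part_def nth_Cons')
    ultimately show ?thesis by (simp add: part_def)
  qed (use Cons in \<open>simp add: part_Cons\<close>)
qed simp

lemma part_complement:
  assumes lam: "is_partition lam"
  shows "part (complement d s lam) i = (if 1 \<le> i \<and> i \<le> d then s - part lam (d + 1 - i) else 0)"
proof -
  let ?xs = "map (\<lambda>i. s - part lam i) (rev [1..<d + 1])"
  \<comment> \<open>The reversed list begins with row \<open>d\<close>, so the entry at position
    \<open>i\<close>, counted from 0, belongs to row \<open>d - i\<close>.\<close>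
  have nth: "?xs ! i = s - part lam (d - i)" if "i < d" for i
    using that by (simp add: rev_nth Suc_diff_Suc del: upt_Suc)
  have "sorted_wrt (\<ge>) ?xs"
    unfolding sorted_wrt_iff_nth_less
  proof (intro allI impI)
    fix i j assume ij: "i < j" "j < length ?xs"
    then have "part lam (d - i) \<le> part lam (d - j)"
      by (intro part_antimono[OF lam]) (auto simp del: upt_Suc)
    then have "s - part lam (d - j) \<le> s - part lam (d - i)" by (rule diff_le_mono2)
    then show "?xs ! j \<le> ?xs ! i" using ij nth[of i] nth[of j] by (simp del: upt_Suc)
  qed
  then have "part (complement d s lam) i = part ?xs i"
    unfolding complement_def by (rule part_filter_nonzero)
  also have "\<dots> = (if 1 \<le> i \<and> i \<le> d then s - part lam (d + 1 - i) else 0)"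
    using nth[of "i - 1"] by (auto simp: part_def simp del: upt_Suc)
  finally show ?thesis .
qed

lemma length_complement: "length (complement d s lam) \<le> d"
proof -
  have "length (complement d s lam) \<le> length (map (\<lambda>i. s - part lam i) (rev [1..<d + 1]))"
    unfolding complement_def by (rule length_filter_le)
  then show ?thesis by (simp del: upt_Suc)
qed

lemma young_complement_columns:
  assumes lam: "is_partition lam"
  shows "young (complement d s lam) =
    (\<Union>j\<in>{1..s}. {1..d - column_height d lam (s + 1 - j)} \<times> {j})"
proof -
  have "(i, j) \<in> young (complement d s lam) \<longleftrightarrow>
      j \<in> {1..s} \<and> i \<in> {1..d - column_height d lam (s + 1 - j)}" for i j
  proof (cases "i \<in> {1..d} \<and> j \<in> {1..s}")
    case True
    then have "d + 1 - i \<in> {1..d}" by auto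
    \<comment> \<open>A box lies in the complement exactly when the opposite box of the rectangle
      lies outside \<open>lam\<close>, which is the negation of the adjunction.\<close>
    from le_part_iff_column_height[OF lam this, of "s + 1 - j"] show ?thesis
      using True by (auto simp: mem_young_iff part_complement[OF lam])
  next
    case False
    then show ?thesis
      using column_height_le[of d lam "s + 1 - j"] by (auto simp: mem_young_iff part_complement[OF lam])
  qed
  then show ?thesis by auto
qed

text \<open>The determinant of \<open>multi_val_e_gen\<close> is block diagonal along the columns.
  The heights are left as a parameter so that the same formula applies to a shape and to its
  complement.\<close>

lemma (in scalar_extension) multi_val_columns:
  fixes V :: "('k, 'v, 'g) rep"
  assumes V: "kspace V" and a: "\<And>i. functional V (a i)" and x: "x \<in> young lam \<rightarrow> carrier V"
    and cols: "young lam = (\<Union>j\<in>{1..s}. {1..k j} \<times> {j})"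
  shows "multi_val lam a (e_gen lam V x) = (\<Prod>j\<in>{1..s}. ldet {1..k j} (\<lambda>i c. a i (x (c, j))))"
proof -
  let ?m = "\<lambda>b c. if snd b = snd c then a (fst b) (x c) else 0"
  have "multi_val lam a (e_gen lam V x) = ldet (\<Union>j\<in>{1..s}. {1..k j} \<times> {j}) ?m"
    unfolding multi_val_e_gen[OF V a x] cols ..
  also have "\<dots> = (\<Prod>j\<in>{1..s}. ldet ({1..k j} \<times> {j}) ?m)"
    by (rule ldet_blocks) (auto simp: disjoint_family_on_def)
  also have "\<dots> = (\<Prod>j\<in>{1..s}. ldet {1..k j} (\<lambda>i c. a i (x (c, j))))"
  proof (rule prod.cong)
    fix j
    have "bij_betw (\<lambda>i. (i, j)) {1..k j} ({1..k j} \<times> {j})"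
      by (auto simp: bij_betw_def inj_on_def)
    from ldet_reindex[OF this, of ?m] show
      "ldet ({1..k j} \<times> {j}) ?m = ldet {1..k j} (\<lambda>i c. a i (x (c, j)))" by simp
  qed simp
  finally show ?thesis .
qed


subsection \<open>Generic evaluation separates points\<close>

lemma count_young_row:
  assumes "1 \<le> i" "i \<le> length lam"
  shows "count (mset (young_row lam t i)) k = card {b \<in> young lam. fst b = i \<and> t b = k}"
proof -
  have "count (mset (young_row lam t i)) k
      = card {n. n < part lam i \<and> k = young_row lam t i ! n}"
    unfolding count_mset count_list_eq_length_filter length_filter_conv_card by simp
  also have "\<dots> = card {b \<in> young lam. fst b = i \<and> t b = k}"
  proof (rule bij_betw_same_card[of "\<lambda>n. (i, Suc n)"], rule bij_betw_byWitness[of _ "\<lambda>b. snd b - 1"])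
    show "(\<lambda>n. (i, Suc n)) ` {n. n < part lam i \<and> k = young_row lam t i ! n}
        \<subseteq> {b \<in> young lam. fst b = i \<and> t b = k}"
      using assms by (auto simp: young_row_def young_def simp del: upt_Suc)
    show "(\<lambda>b. snd b - 1) ` {b \<in> young lam. fst b = i \<and> t b = k}
        \<subseteq> {n. n < part lam i \<and> k = young_row lam t i ! n}"
      by (auto simp: young_row_def young_def simp del: upt_Suc)
  qed (auto simp: young_def)
  finally show ?thesis .
qed

lemma young_row_comp: "young_row lam (\<lambda>b. u (t b)) i = map u (young_row lam t i)"
  by (simp add: young_row_def)

text \<open>Distinct spanning elements differ in the contents of some row, and the exponents of
  their values record these contents. The entries have to be generic only in rows that occur in
  \<open>lam\<close>.\<close>

lemma generic_separates:
  fixes V :: "('k::field, 'v, 'g) rep"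
  assumes V: "kspace V" and a: "\<And>i. generic.functional V (a i)"
    and u: "u ` I \<subseteq> carrier V" "vs_span V (u ` I) = carrier V"
    and entry: "\<And>i b. i \<in> {1..length lam} \<Longrightarrow> b \<in> I \<Longrightarrow> a i (u b) = generic_entry i b"
    and z: "z \<in> carrier (sym_multi lam V)" "generic.multi_val lam a z = 0"
  shows "z = \<zero>\<^bsub>sym_multi lam V\<^esub>"
proof -
  interpret kspace_rep V using V by (simp add: kspace_rep_def)
  let ?G = "s_gen lam V ` (young lam \<rightarrow> u ` I)"
  let ?e = "\<lambda>t. \<Sum>b\<in>young lam. entry_exponent (fst b) (t b)"
  have val: "generic.multi_val lam a (s_gen lam V (\<lambda>b. u (t b))) = poly_fract (Poly_Mapping.single (?e t) 1)"
    if t: "t \<in> young lam \<rightarrow> I" for t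
  proof -
    have "(\<lambda>b. u (t b)) \<in> young lam \<rightarrow> carrier V" using t u(1) by (auto simp: Pi_iff)
    then have "generic.multi_val lam a (s_gen lam V (\<lambda>b. u (t b))) = (\<Prod>b\<in>young lam. a (fst b) (u (t b)))"
      by (rule generic.multi_val_s_gen[OF V a])
    also have "\<dots> = (\<Prod>b\<in>young lam. generic_entry (fst b) (t b))"
    proof (rule prod.cong[OF refl], rule entry)
      fix b assume b: "b \<in> young lam"
      then show "fst b \<in> {1..length lam}" by (auto simp: young_def)
      show "t b \<in> I" using t b by blast
    qed
    finally show ?thesis
      unfolding generic_entry_def poly_fract_prod[symmetric] prod_monomials .
  qed
  have G: "\<exists>t \<in> young lam \<rightarrow> I. g = s_gen lam V (\<lambda>b. u (t b))" if "g \<in> ?G" for g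
  proof -
    from that obtain x where x: "x \<in> young lam \<rightarrow> u ` I" "g = s_gen lam V x" by blast
    define t where "t b = inv_into I u (x b)" for b
    have "t \<in> young lam \<rightarrow> I"
      unfolding t_def by (intro Pi_I inv_into_into funcset_mem[OF x(1)])
    moreover have "s_gen lam V x = s_gen lam V (\<lambda>b. u (t b))"
    proof (rule s_gen_cong_mset)
      show "x \<in> young lam \<rightarrow> carrier V" using x(1) u(1) by auto
      fix i assume i: "i < length lam"
      have "x (Suc i, j) = u (t (Suc i, j))" if "j \<in> {1..part lam (Suc i)}" for j
      proof -
        have "x (Suc i, j) \<in> u ` I" 
          by (rule funcset_mem[OF x(1)]) (use i that in \<open>simp add: young_def\<close>)
        then show ?thesis by (simp add: t_def f_inv_into_f)
      qed
      then have "young_row lam x (Suc i) = young_row lam (\<lambda>b. u (t b)) (Suc i)"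
        unfolding young_row_def by (intro map_cong) (auto simp del: upt_Suc)
      then show "mset (young_row lam x (Suc i)) = mset (young_row lam (\<lambda>b. u (t b)) (Suc i))" by simp
    qed
    ultimately show ?thesis using x(2) by blast
  qed
  have eq: "g = h" if gh: "g \<in> ?G" "h \<in> ?G"
    and same: "generic.multi_val lam a g = generic.multi_val lam a h" for g h
  proof -
    obtain t where t: "t \<in> young lam \<rightarrow> I" "g = s_gen lam V (\<lambda>b. u (t b))" using G[OF gh(1)] by blast
    obtain t' where t': "t' \<in> young lam \<rightarrow> I" "h = s_gen lam V (\<lambda>b. u (t' b))" using G[OF gh(2)] by blast
    have "Poly_Mapping.single (?e t) (1::'k) = Poly_Mapping.single (?e t') 1"
      using same unfolding t(2) t'(2) val[OF t(1)] val[OF t'(1)] poly_fract_simps(5) .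
    then have "Poly_Mapping.keys (Poly_Mapping.single (?e t) (1::'k))
        = Poly_Mapping.keys (Poly_Mapping.single (?e t') (1::'k))" by (rule arg_cong)
    then have e: "?e t = ?e t'" by simp
    have "mset (young_row lam t (Suc i)) = mset (young_row lam t' (Suc i))" if "i < length lam" for i
    proof (rule multiset_eqI)
      fix k
      have "card {b \<in> young lam. fst b = Suc i \<and> t b = k} = card {b \<in> young lam. fst b = Suc i \<and> t' b = k}"
        using e lookup_entry_exponents[OF finite_young[of lam], of fst t "Suc i" k]
          lookup_entry_exponents[OF finite_young[of lam], of fst t' "Suc i" k] by simp
      then show "count (mset (young_row lam t (Suc i))) k = count (mset (young_row lam t' (Suc i))) k"
        using that by (simp add: count_young_row)
    qed
    then have "mset (young_row lam (\<lambda>b. u (t b)) (Suc i)) = mset (young_row lam (\<lambda>b. u (t' b)) (Suc i))"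
      if "i < length lam" for i
      using that by (simp add: young_row_comp)
    moreover have "(\<lambda>b. u (t b)) \<in> young lam \<rightarrow> carrier V" using t(1) u(1) by (auto simp: Pi_iff)
    ultimately show ?thesis unfolding t(2) t'(2) by (intro s_gen_cong_mset)
  qed
  \<comment> \<open>Different tableaux may produce the same spanning element, so the exponent is
    chosen from the value of the element and not from a tableau.\<close>
  define E where "E g = (SOME m. generic.multi_val lam a g = poly_fract (Poly_Mapping.single m 1))" for g
  have E: "generic.multi_val lam a g = poly_fract (Poly_Mapping.single (E g) 1)" if "g \<in> ?G" for g
  proof -
    obtain t where "t \<in> young lam \<rightarrow> I" "g = s_gen lam V (\<lambda>b. u (t b))" using G[OF \<open>g \<in> ?G\<close>] by blast
    then have "\<exists>m. generic.multi_val lam a g = poly_fract (Poly_Mapping.single m 1)" using val by blast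
    then show ?thesis unfolding E_def by (rule someI_ex)
  qed
  show ?thesis
  proof (rule monomial_functional_injective[OF multi_kspace generic.multi_val_functional[OF V a] _ _ E _ z])
    show "?G \<subseteq> carrier (sym_multi lam V)"
      using s_gen_closed u(1) by (intro image_subsetI) (auto simp: Pi_iff subset_iff)
    show "vs_span (sym_multi lam V) ?G = carrier (sym_multi lam V)" by (rule s_gen_span[OF u])
    show "g = h" if "g \<in> ?G" "h \<in> ?G" "E g = E h" for g h
      by (rule eq[OF that(1,2)]) (simp add: E[OF that(1)] E[OF that(2)] that(3))
  qed
qed

subsection \<open>Frames\<close>

lemma dual_rep_simps [simp]:
  "\<zero>\<^bsub>dual_rep G V\<^esub> = (\<lambda>x\<in>carrier V. 0)"
  "\<phi> \<oplus>\<^bsub>dual_rep G V\<^esub> \<psi> = (\<lambda>x\<in>carrier V. \<phi> x + \<psi> x)"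
  "a \<odot>\<^bsub>dual_rep G V\<^esub> \<phi> = (\<lambda>x\<in>carrier V. a * \<phi> x)"
  "act (dual_rep G V) h \<phi> = (\<lambda>x\<in>carrier V. \<phi> (act V (inv\<^bsub>G\<^esub> h) x))"
  by (simp_all add: dual_rep_def)

text \<open>With the identity as embedding, functionals are the members of the dual space before
  restriction to extensional functions, so the results on functionals apply to them.\<close>

interpretation form: scalar_extension "id :: 'k::field \<Rightarrow> 'k"
  by unfold_locales simp_all

lemma carrier_dual_rep:
  "carrier (dual_rep G V) = {\<phi> \<in> extensional (carrier V). form.functional V \<phi>}"
  by (simp add: dual_rep_def form.functional_def)

lemma
  assumes "\<phi> \<in> carrier (dual_rep G V)"
  shows dual_functional: "form.functional V \<phi>"
    and dual_extensional: "\<phi> \<in> extensional (carrier V)"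
  using assms by (auto simp: carrier_dual_rep)

lemma dual_restrict_mem:
  fixes V :: "('k::field, 'v, 'g) rep"
  assumes V: "kspace V" and f: "form.functional V f"
  shows "restrict f (carrier V) \<in> carrier (dual_rep G V)"
proof -
  interpret kspace V by (rule V)
  have "form.functional V (restrict f (carrier V))"
    unfolding form.functional_def id_apply
  proof (intro conjI ballI allI)
    fix x y a assume x: "x \<in> carrier V"
    show "restrict f (carrier V) (a \<odot>\<^bsub>V\<^esub> x) = a * restrict f (carrier V) x"
      unfolding restrict_apply'[OF x] restrict_apply'[OF smult_closed'[OF x]]
      by (rule form.functional_smult[OF f x, unfolded id_apply])
    assume y: "y \<in> carrier V"
    show "restrict f (carrier V) (x \<oplus>\<^bsub>V\<^esub> y) = restrict f (carrier V) x + restrict f (carrier V) y"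
      unfolding restrict_apply'[OF x] restrict_apply'[OF y] restrict_apply'[OF a_closed[OF x y]]
      by (rule form.functional_add[OF f x y])
  qed
  then show ?thesis unfolding carrier_dual_rep by blast
qed

lemma dual_kspace:
  fixes V :: "('k::field, 'v, 'g) rep"
  assumes V: "kspace V"
  shows "kspace (dual_rep G V)"
proof -
  note mem = dual_restrict_mem[OF V]
  show ?thesis
  proof (rule kspaceI)
    show "\<zero>\<^bsub>dual_rep G V\<^esub> \<in> carrier (dual_rep G V)"
      unfolding dual_rep_simps(1) by (rule mem) (simp add: form.functional_def)
    fix \<phi> :: "'v \<Rightarrow> 'k" and a b :: 'k
    show "(a * b) \<odot>\<^bsub>dual_rep G V\<^esub> \<phi> = a \<odot>\<^bsub>dual_rep G V\<^esub> (b \<odot>\<^bsub>dual_rep G V\<^esub> \<phi>)"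
      "(a + b) \<odot>\<^bsub>dual_rep G V\<^esub> \<phi> = a \<odot>\<^bsub>dual_rep G V\<^esub> \<phi> \<oplus>\<^bsub>dual_rep G V\<^esub> b \<odot>\<^bsub>dual_rep G V\<^esub> \<phi>"
      "0 \<odot>\<^bsub>dual_rep G V\<^esub> \<phi> = \<zero>\<^bsub>dual_rep G V\<^esub>"
      unfolding dual_rep_simps(1-3) by (rule restrict_ext; simp add: algebra_simps)+
    fix \<psi> \<chi> :: "'v \<Rightarrow> 'k"
    show "\<phi> \<oplus>\<^bsub>dual_rep G V\<^esub> \<psi> = \<psi> \<oplus>\<^bsub>dual_rep G V\<^esub> \<phi>"
      "(\<phi> \<oplus>\<^bsub>dual_rep G V\<^esub> \<psi>) \<oplus>\<^bsub>dual_rep G V\<^esub> \<chi> = \<phi> \<oplus>\<^bsub>dual_rep G V\<^esub> (\<psi> \<oplus>\<^bsub>dual_rep G V\<^esub> \<chi>)"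
      "a \<odot>\<^bsub>dual_rep G V\<^esub> (\<phi> \<oplus>\<^bsub>dual_rep G V\<^esub> \<psi>) =
        a \<odot>\<^bsub>dual_rep G V\<^esub> \<phi> \<oplus>\<^bsub>dual_rep G V\<^esub> a \<odot>\<^bsub>dual_rep G V\<^esub> \<psi>"
      unfolding dual_rep_simps(1-3) by (rule restrict_ext; simp add: algebra_simps)+
    assume \<phi>: "\<phi> \<in> carrier (dual_rep G V)"
    note f = dual_functional[OF \<phi>]
    show "a \<odot>\<^bsub>dual_rep G V\<^esub> \<phi> \<in> carrier (dual_rep G V)"
      unfolding dual_rep_simps(3)
      by (rule mem) (use f in \<open>simp add: form.functional_def algebra_simps\<close>)
    show "\<phi> \<oplus>\<^bsub>dual_rep G V\<^esub> \<zero>\<^bsub>dual_rep G V\<^esub> = \<phi>" "1 \<odot>\<^bsub>dual_rep G V\<^esub> \<phi> = \<phi>"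
      unfolding dual_rep_simps(1-3)
      using dual_extensional[OF \<phi>] by (auto simp: extensional_def)
    assume \<psi>: "\<psi> \<in> carrier (dual_rep G V)"
    show "\<phi> \<oplus>\<^bsub>dual_rep G V\<^esub> \<psi> \<in> carrier (dual_rep G V)"
      unfolding dual_rep_simps(2)
      by (rule mem) (use f dual_functional[OF \<psi>] in \<open>simp add: form.functional_def algebra_simps\<close>)
  qed
qed

lemma dual_representation:
  fixes V :: "('k::field, 'v, 'g) rep"
  assumes V: "representation G V"
  shows "representation G (dual_rep G V)"
proof -
  interpret RV: representation G V by (rule V)
  interpret G: group G by (rule RV.group)
  note hom = RV.act_linear
  have closed: "act V g x \<in> carrier V" if "g \<in> carrier G" "x \<in> carrier V" for g x
    using hom_k_closed[OF hom[OF that(1)] that(2)] .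
  show ?thesis
  proof (rule representation.intro)
    show "vectorspace class_ring (dual_rep G V)"
      using dual_kspace[OF representation_kspace[OF V]] unfolding kspace_def .
    show "act (dual_rep G V) g \<in> LinearCombinations.module_hom class_ring (dual_rep G V) (dual_rep G V)"
      if g: "g \<in> carrier G" for g
    proof (rule hom_kI)
      note g' = G.inv_closed[OF g]
      note h = hom[OF g']
      fix \<phi> \<psi> :: "'v \<Rightarrow> 'k" and a :: 'k
      assume \<phi>: "\<phi> \<in> carrier (dual_rep G V)"
      have "form.functional V (\<lambda>x. \<phi> (act V (inv\<^bsub>G\<^esub> g) x))"
        by (rule form.functional_hom[OF h dual_functional[OF \<phi>]])
      then show "act (dual_rep G V) g \<phi> \<in> carrier (dual_rep G V)"
        unfolding dual_rep_simps by (rule dual_restrict_mem[OF representation_kspace[OF V]])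
      show "act (dual_rep G V) g (a \<odot>\<^bsub>dual_rep G V\<^esub> \<phi>) = a \<odot>\<^bsub>dual_rep G V\<^esub> act (dual_rep G V) g \<phi>"
        using closed[OF g'] by (auto intro!: restrict_ext)
      show "act (dual_rep G V) g (\<phi> \<oplus>\<^bsub>dual_rep G V\<^esub> \<psi>) =
          act (dual_rep G V) g \<phi> \<oplus>\<^bsub>dual_rep G V\<^esub> act (dual_rep G V) g \<psi>"
        using closed[OF g'] by (auto intro!: restrict_ext)
    qed
    show "act (dual_rep G V) \<one>\<^bsub>G\<^esub> \<phi> = \<phi>" if "\<phi> \<in> carrier (dual_rep G V)" for \<phi>
    proof -
      have "act (dual_rep G V) \<one>\<^bsub>G\<^esub> \<phi> = restrict \<phi> (carrier V)"
        unfolding dual_rep_simps by (rule restrict_ext) (simp add: RV.act_one)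
      then show ?thesis using dual_extensional[OF that] by (simp add: extensional_restrict)
    qed
    show "act (dual_rep G V) (g \<otimes>\<^bsub>G\<^esub> h) \<phi> = act (dual_rep G V) g (act (dual_rep G V) h \<phi>)"
      if "g \<in> carrier G" "h \<in> carrier G" "\<phi> \<in> carrier (dual_rep G V)" for g h \<phi>
      unfolding dual_rep_simps
      by (rule restrict_ext) (use that closed in \<open>simp add: G.inv_mult_group RV.act_mult\<close>)
  qed (rule RV.group)
qed

text \<open>Spanning and duality together force \<open>u\<close> to be a basis with dual basis
  \<open>\<phi>\<close>. The dual basis is carried along so that a group element can move both at
  once.\<close>

definition frame ::
  "('g, 'm) monoid_scheme \<Rightarrow> nat \<Rightarrow> ('k::field, 'v, 'g) rep \<Rightarrow> (nat \<Rightarrow> 'v) \<Rightarrow> (nat \<Rightarrow> 'v \<Rightarrow> 'k) \<Rightarrow> bool" where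
  "frame G d V u \<phi> \<longleftrightarrow> u ` {1..d} \<subseteq> carrier V \<and> vs_span V (u ` {1..d}) = carrier V \<and>
    \<phi> ` {1..d} \<subseteq> carrier (dual_rep G V) \<and>
    (\<forall>b\<in>{1..d}. \<forall>c\<in>{1..d}. \<phi> b (u c) = (if b = c then 1 else 0))"

lemma frame_subset: "frame G d V u \<phi> \<Longrightarrow> u ` {1..d} \<subseteq> carrier V"
  unfolding frame_def by (elim conjE)

lemma frame_closed: "frame G d V u \<phi> \<Longrightarrow> b \<in> {1..d} \<Longrightarrow> u b \<in> carrier V"
  by (rule subsetD[OF frame_subset imageI])

lemma frame_span: "frame G d V u \<phi> \<Longrightarrow> vs_span V (u ` {1..d}) = carrier V"
  unfolding frame_def by (elim conjE)

lemma frame_dual_subset: "frame G d V u \<phi> \<Longrightarrow> \<phi> ` {1..d} \<subseteq> carrier (dual_rep G V)"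
  unfolding frame_def by (elim conjE)

lemma frame_dual_closed: "frame G d V u \<phi> \<Longrightarrow> b \<in> {1..d} \<Longrightarrow> \<phi> b \<in> carrier (dual_rep G V)"
  by (rule subsetD[OF frame_dual_subset imageI])

lemma frame_delta:
  "frame G d V u \<phi> \<Longrightarrow> b \<in> {1..d} \<Longrightarrow> c \<in> {1..d} \<Longrightarrow> \<phi> b (u c) = (if b = c then 1 else 0)"
  unfolding frame_def by (elim conjE) (drule (1) bspec)+

lemma (in scalar_extension) functional_form:
  "form.functional V f \<Longrightarrow> functional V (\<lambda>x. \<kappa> (f x))"
  by (simp add: functional_def form.functional_def)

lemma (in scalar_extension) functional_sum:
  "(\<And>b. b \<in> B \<Longrightarrow> functional V (f b)) \<Longrightarrow> functional V (\<lambda>x. \<Sum>b\<in>B. c b * f b x)"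
  by (simp add: functional_def sum.distrib sum_distrib_left algebra_simps)

text \<open>Expansion in coordinates for functionals with values in the extension field: both sides
  are functionals and they agree on the frame.\<close>

lemma (in scalar_extension) frame_expansion:
  assumes V: "kspace V" and F: "frame G d V u \<phi>" and \<psi>: "functional V \<psi>" and x: "x \<in> carrier V"
  shows "\<psi> x = (\<Sum>b\<in>{1..d}. \<psi> (u b) * \<kappa> (\<phi> b x))"
proof (rule functional_eq_on_span[OF V \<psi> _ frame_subset[OF F]])
  show "functional V (\<lambda>x. \<Sum>b\<in>{1..d}. \<psi> (u b) * \<kappa> (\<phi> b x))"
    by (intro functional_sum functional_form dual_functional[OF frame_dual_closed[OF F]])
  show "x \<in> vs_span V (u ` {1..d})" using x frame_span[OF F] by simp
  fix y assume "y \<in> u ` {1..d}"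
  then obtain c where c: "c \<in> {1..d}" "y = u c" by blast
  have "(\<Sum>b\<in>{1..d}. \<psi> (u b) * \<kappa> (\<phi> b y)) = (\<Sum>b\<in>{1..d}. if b = c then \<psi> (u b) else 0)"
    unfolding c(2) by (intro sum.cong refl) (simp add: frame_delta[OF F _ c(1)])
  then show "\<psi> y = (\<Sum>b\<in>{1..d}. \<psi> (u b) * \<kappa> (\<phi> b y))" using c by simp
qed

lemma frame_dual_span:
  assumes V: "kspace V" and F: "frame G d V u \<phi>"
  shows "vs_span (dual_rep G V) (\<phi> ` {1..d}) = carrier (dual_rep G V)"
proof -
  interpret D: kspace "dual_rep G V" by (rule dual_kspace[OF V])
  note sub = frame_dual_subset[OF F]
  have "f \<in> vs_span (dual_rep G V) (\<phi> ` {1..d})" if f: "f \<in> carrier (dual_rep G V)" for f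
  proof -
    \<comment> \<open>The coordinates of \<open>f\<close> in the dual basis are its values on the
      frame.\<close>
    let ?g = "\<Oplus>\<^bsub>dual_rep G V\<^esub>b\<in>{1..d}. f (u b) \<odot>\<^bsub>dual_rep G V\<^esub> \<phi> b"
    have g: "?g \<in> vs_span (dual_rep G V) (\<phi> ` {1..d})"
      by (intro D.span_finsum D.span_smult D.span_base sub imageI)
    have gc: "?g \<in> carrier (dual_rep G V)" by (rule D.span_closed[OF sub g])
    have "f x = ?g x" if x: "x \<in> carrier V" for x
    proof -
      have ev: "form.functional (dual_rep G V) (\<lambda>f. f x)"
        using x by (simp add: form.functional_def)
      have "?g x = (\<Sum>b\<in>{1..d}. (f (u b) \<odot>\<^bsub>dual_rep G V\<^esub> \<phi> b) x)"
        by (rule form.functional_finsum[OF D.kspace_axioms ev])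
          (intro D.smult_closed' frame_dual_closed[OF F])
      also have "\<dots> = (\<Sum>b\<in>{1..d}. f (u b) * \<phi> b x)" using x by simp
      also have "\<dots> = f x"
        by (rule form.frame_expansion[OF V F dual_functional[OF f] x, unfolded id_apply, symmetric])
      finally show ?thesis by simp
    qed
    then have "f = ?g"
      using dual_extensional[OF f] dual_extensional[OF gc] by (rule extensionalityI[rotated 2])
    then show ?thesis using g by (simp only:)
  qed
  then show ?thesis using D.span_closed[OF sub] by blast
qed

lemma frame_act:
  assumes V: "representation G V" and F: "frame G d V u \<phi>" and g: "g \<in> carrier G"
  shows "frame G d V (\<lambda>b. act V g (u b)) (\<lambda>b. act (dual_rep G V) g (\<phi> b))"
proof -
  interpret RV: representation G V by (rule V)
  interpret G: group G by (rule RV.group)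
  interpret kspace V by (rule representation_kspace[OF V])
  note hom = RV.act_linear
  note homD = representation.act_linear[OF dual_representation[OF V]]
  have inv_act: "act V (inv\<^bsub>G\<^esub> g) (act V g x) = x" "act V g (act V (inv\<^bsub>G\<^esub> g) x) = x"
    if "x \<in> carrier V" for x
    using RV.act_mult[of "inv\<^bsub>G\<^esub> g" g x] RV.act_mult[of g "inv\<^bsub>G\<^esub> g" x] RV.act_one[OF that] g that
    by simp_all
  have sub: "(\<lambda>b. act V g (u b)) ` {1..d} \<subseteq> carrier V"
    using hom_k_closed[OF hom[OF g] frame_closed[OF F]] by blast
  \<comment> \<open>Every \<open>x\<close> is the image under \<open>g\<close> of g^-1 x, and that
    vector lies in the span of the old frame.\<close>
  have "x \<in> vs_span V ((\<lambda>b. act V g (u b)) ` {1..d})" if x: "x \<in> carrier V" for x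
  proof -
    have x': "act V (inv\<^bsub>G\<^esub> g) x \<in> carrier V" using hom_k_closed[OF hom x] g by simp
    have "act V g (act V (inv\<^bsub>G\<^esub> g) x) \<in> vs_span V ((\<lambda>b. act V g (u b)) ` {1..d})"
    proof (rule hom_image_span[OF kspace_axioms hom[OF g] frame_subset[OF F] span_submodule[OF sub]])
      show "act V g ` u ` {1..d} \<subseteq> vs_span V ((\<lambda>b. act V g (u b)) ` {1..d})"
        unfolding image_image by (rule in_own_span[OF sub])
      show "act V (inv\<^bsub>G\<^esub> g) x \<in> vs_span V (u ` {1..d})" using x' frame_span[OF F] by simp
    qed
    then show ?thesis unfolding inv_act(2)[OF x] .
  qed
  then have "vs_span V ((\<lambda>b. act V g (u b)) ` {1..d}) = carrier V" using span_closed[OF sub] by blast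
  moreover have "(\<lambda>b. act (dual_rep G V) g (\<phi> b)) ` {1..d} \<subseteq> carrier (dual_rep G V)"
    using hom_k_closed[OF homD[OF g] frame_dual_closed[OF F]] by blast
  moreover have "act (dual_rep G V) g (\<phi> b) (act V g (u c)) = (if b = c then 1 else 0)"
    if "b \<in> {1..d}" "c \<in> {1..d}" for b c
    unfolding dual_rep_simps restrict_apply'[OF hom_k_closed[OF hom[OF g] frame_closed[OF F that(2)]]]
      inv_act(1)[OF frame_closed[OF F that(2)]]
    by (rule frame_delta[OF F that])
  ultimately show ?thesis using sub unfolding frame_def by blast
qed

lemma frame_permute:
  assumes F: "frame G d V u \<phi>" and p: "p permutes {1..d}"
  shows "frame G d V (\<lambda>b. u (p b)) (\<lambda>b. \<phi> (p b))"
proof -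
  have img: "(\<lambda>b. f (p b)) ` {1..d} = f ` {1..d}" for f :: "nat \<Rightarrow> 'x"
    using permutes_image[OF p] by (simp only: image_image[symmetric])
  have mem: "p b \<in> {1..d}" if "b \<in> {1..d}" for b
    using permutes_in_image[OF p, of b] that by blast
  have inj: "p b = p c \<longleftrightarrow> b = c" for b c
    using permutes_inj[OF p] by (simp add: inj_eq)
  have "\<phi> (p b) (u (p c)) = (if b = c then 1 else 0)" if "b \<in> {1..d}" "c \<in> {1..d}" for b c
    using frame_delta[OF F mem[OF that(1)] mem[OF that(2)]] unfolding inj .
  then show ?thesis
    using frame_subset[OF F] frame_span[OF F] frame_dual_subset[OF F] unfolding frame_def img by blast
qed

lemma frame_of_basis:
  fixes V :: "('k::field, 'v, 'g) rep"
  assumes V: "kspace V" and findim: "vectorspace.fin_dim class_ring V"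
    and dim: "vectorspace.dim class_ring V = d" and basis: "indexed_basis V B v"
  obtains u \<phi> where "frame G d V u \<phi>" "u ` {1..d} = v ` B"
proof -
  interpret kspace V by (rule V)
  let ?A = "v ` B"
  have b: "basis ?A" using basis by (simp add: indexed_basis_def)
  have A: "?A \<subseteq> carrier V" "lin_indpt ?A" "gen_set ?A" using b by (simp_all add: basis_def)
  have finA: "finite ?A" by (rule fin_dim_li_fin[OF findim A(2,1)])
  have card: "card ?A = d" using dim_basis[OF finA b] dim by simp
  obtain u where u: "bij_betw u {1..d} ?A"
    using ex_bij_betw_nat_finite_1[OF finA] card by auto
  have uA: "u ` {1..d} = ?A" using u by (rule bij_betw_imp_surj_on)
  have ex1: "\<exists>!a. a \<in> ?A \<rightarrow>\<^sub>E UNIV \<and> lincomb a ?A = x" if "x \<in> carrier V" for x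
    using basis_criterion[OF finA A(1)] b that by simp
  \<comment> \<open>The coordinates of \<open>x\<close> in the given basis. Their linearity and
    their values on basis vectors all follow from uniqueness.\<close>
  define co where "co x = (THE a. a \<in> ?A \<rightarrow>\<^sub>E UNIV \<and> lincomb a ?A = x)" for x
  have co: "co x \<in> ?A \<rightarrow>\<^sub>E UNIV" "lincomb (co x) ?A = x" if "x \<in> carrier V" for x
    using theI'[OF ex1[OF that]] unfolding co_def by auto
  have co_unique: "co x b = a b" if "a \<in> ?A \<rightarrow>\<^sub>E UNIV" "lincomb a ?A = x" "x \<in> carrier V" for a x b
    using the1_equality[OF ex1[OF that(3)], of a] that(1,2) unfolding co_def by simp
  have cocl: "lincomb a ?A \<in> carrier V" for a
    by (rule lincomb_closed[OF A(1)]) simp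
  have lc: "lincomb a ?A = (\<Oplus>\<^bsub>V\<^esub>y\<in>?A. a y \<odot>\<^bsub>V\<^esub> y)" for a
    by (simp add: lincomb_def)
  have co_add: "co (x \<oplus>\<^bsub>V\<^esub> y) b = co x b + co y b"
    if x: "x \<in> carrier V" and y: "y \<in> carrier V" and b: "b \<in> ?A" for x y b
  proof -
    let ?a = "\<lambda>z\<in>?A. co x z + co y z"
    have "lincomb ?a ?A = (\<Oplus>\<^bsub>V\<^esub>z\<in>?A. co x z \<odot>\<^bsub>V\<^esub> z \<oplus>\<^bsub>V\<^esub> co y z \<odot>\<^bsub>V\<^esub> z)"
      unfolding lc by (rule finsum_cong'[OF refl]) (use A(1) in \<open>auto simp: smult_distrib_left\<close>)
    also have "\<dots> = lincomb (co x) ?A \<oplus>\<^bsub>V\<^esub> lincomb (co y) ?A"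
      unfolding lc by (rule finsum_addf) (use A(1) in auto)
    finally have "lincomb ?a ?A = x \<oplus>\<^bsub>V\<^esub> y" using co(2) x y by simp
    then have "co (x \<oplus>\<^bsub>V\<^esub> y) b = ?a b" by (rule co_unique[OF _ _ a_closed[OF x y], rotated]) simp
    then show ?thesis using b by simp
  qed
  have co_smult: "co (c \<odot>\<^bsub>V\<^esub> x) b = c * co x b"
    if x: "x \<in> carrier V" and b: "b \<in> ?A" for c x b
  proof -
    let ?a = "\<lambda>z\<in>?A. c * co x z"
    have hom: "(\<lambda>x. c \<odot>\<^bsub>V\<^esub> x) \<in> LinearCombinations.module_hom class_ring V V"
      by (rule hom_kI) (simp_all add: smult_distrib_right smult_smult mult.commute)
    have "lincomb ?a ?A = (\<Oplus>\<^bsub>V\<^esub>z\<in>?A. c \<odot>\<^bsub>V\<^esub> (co x z \<odot>\<^bsub>V\<^esub> z))"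
      unfolding lc by (rule finsum_cong'[OF refl]) (use A(1) in \<open>auto simp: smult_smult\<close>)
    also have "\<dots> = c \<odot>\<^bsub>V\<^esub> lincomb (co x) ?A"
      unfolding lc by (rule hom_finsum[OF V hom, symmetric]) (use A(1) in auto)
    finally have "lincomb ?a ?A = c \<odot>\<^bsub>V\<^esub> x" using co(2) x by simp
    then have "co (c \<odot>\<^bsub>V\<^esub> x) b = ?a b" by (rule co_unique[OF _ _ smult_closed'[OF x], rotated]) simp
    then show ?thesis using b by simp
  qed
  have co_basis: "co y b = (if b = y then 1 else 0)" if y: "y \<in> ?A" and b: "b \<in> ?A" for y b
  proof -
    let ?a = "\<lambda>z\<in>?A. if z = y then 1 else 0"
    have "lincomb ?a ?A = (\<Oplus>\<^bsub>V\<^esub>z\<in>?A. if y = z then z else \<zero>\<^bsub>V\<^esub>)"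
      unfolding lc by (rule finsum_cong'[OF refl]) (use A(1) in auto)
    also have "\<dots> = y"
      using add.finprod_singleton[OF y finA, of "\<lambda>z. z"] A(1) by (simp add: Pi_iff subset_iff)
    finally have "co y b = ?a b"
      by (rule co_unique[OF _ _ subsetD[OF A(1) y], rotated]) simp
    then show ?thesis using b by simp
  qed
  define \<phi> where "\<phi> b = (\<lambda>x\<in>carrier V. co x (u b))" for b
  have mem: "u b \<in> ?A" if "b \<in> {1..d}" for b using uA that by blast
  have "\<phi> ` {1..d} \<subseteq> carrier (dual_rep G V)"
    using mem by (auto simp: \<phi>_def carrier_dual_rep form.functional_def co_add co_smult)
  moreover have "\<phi> b (u c) = (if b = c then 1 else 0)" if "b \<in> {1..d}" "c \<in> {1..d}" for b c
  proof -
    have "u b = u c \<longleftrightarrow> b = c" by (rule inj_on_eq_iff[OF bij_betw_imp_inj_on[OF u] that])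
    moreover have "u c \<in> carrier V" using mem[OF that(2)] A(1) by blast
    ultimately show ?thesis using co_basis[OF mem[OF that(2)] mem[OF that(1)]] by (simp add: \<phi>_def)
  qed
  ultimately have "frame G d V u \<phi>" unfolding frame_def uA using A by blast
  then show ?thesis using uA by (rule that)
qed


subsection \<open>The Schur functor is independent of the basis\<close>

context kspace_rep begin

lemma e_gen_cong:
  assumes y: "y \<in> young lam \<rightarrow> carrier V" and xy: "\<And>b. b \<in> young lam \<Longrightarrow> x b = y b"
  shows "e_gen lam V x = e_gen lam V y"
proof -
  interpret M: kspace "sym_multi lam V" by (rule multi_kspace)
  have s: "s_gen lam V (\<lambda>b. x (inv_into UNIV \<sigma> b)) = s_gen lam V (\<lambda>b. y (inv_into UNIV \<sigma> b))"
    if \<sigma>: "\<sigma> \<in> CPP lam" for \<sigma>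
  proof -
    have eq: "x (inv_into UNIV \<sigma> b) = y (inv_into UNIV \<sigma> b)" if "b \<in> young lam" for b
      by (rule xy) (use that permutes_in_image[OF permutes_inv[OF CPP_permutes[OF \<sigma>]]] in simp)
    have "young_row lam (\<lambda>b. x (inv_into UNIV \<sigma> b)) (Suc i) = young_row lam (\<lambda>b. y (inv_into UNIV \<sigma> b)) (Suc i)"
      if "i < length lam" for i
      unfolding young_row_def
      by (rule map_cong[OF refl], rule eq) (use that in \<open>auto simp: young_def simp del: upt_Suc\<close>)
    then show ?thesis unfolding s_gen_rows
      by (intro arg_cong[where f = "pure_tensor _"] map_cong refl arg_cong[where f = "sym_product V"]) simp
  qed
  show ?thesis
    unfolding e_gen_def
  proof (rule M.finsum_cong'[OF refl])
    show "(\<lambda>\<sigma>. of_int (sign \<sigma>) \<odot>\<^bsub>sym_multi lam V\<^esub> s_gen lam V (\<lambda>b. y (inv_into UNIV \<sigma> b)))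
        \<in> CPP lam \<rightarrow> carrier (sym_multi lam V)"
      by (intro Pi_I M.smult_closed' s_gen_closed permuted_filling[OF y])
  qed (simp only: s)
qed

end

text \<open>
  Multilinearity of \<open>e_gen\<close> need not be verified in the tensor product: it suffices to compare
  generic evaluations, which are determinants.
\<close>

lemma e_gen_linear:
  fixes V :: "('k::field, 'v, 'g) rep"
  assumes V: "kspace V" and F: "frame G d V u \<phi>" and x: "x \<in> young lam \<rightarrow> carrier V"
    and c: "c \<in> young lam" and pq: "p \<in> carrier V" "q \<in> carrier V"
  shows "e_gen lam V (x(c := \<alpha> \<odot>\<^bsub>V\<^esub> p \<oplus>\<^bsub>V\<^esub> \<beta> \<odot>\<^bsub>V\<^esub> q)) =
    \<alpha> \<odot>\<^bsub>sym_multi lam V\<^esub> e_gen lam V (x(c := p)) \<oplus>\<^bsub>sym_multi lam V\<^esub>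
    \<beta> \<odot>\<^bsub>sym_multi lam V\<^esub> e_gen lam V (x(c := q))"
proof -
  interpret kspace_rep V using V by (simp add: kspace_rep_def)
  interpret M: kspace "sym_multi lam V" by (rule multi_kspace)
  \<comment> \<open>The rows of a generic matrix, read as forms in the coordinates of the frame. The
    row number is unbounded, so every row of the diagram is covered.\<close>
  define a where "a i = (\<lambda>x. \<Sum>b\<in>{1..d}. generic_entry i b * generic_scalar (\<phi> b x))" for i
  have a: "generic.functional V (a i)" for i
    unfolding a_def
    by (intro generic.functional_sum generic.functional_form dual_functional[OF frame_dual_closed[OF F]])
  have entry: "a i (u b) = generic_entry i b" if b: "b \<in> {1..d}" for i b
  proof -
    have "a i (u b) = (\<Sum>c\<in>{1..d}. if c = b then generic_entry i c else 0)"
      unfolding a_def by (intro sum.cong refl) (simp add: frame_delta[OF F _ b])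
    then show ?thesis using b by simp
  qed
  have upd: "x(c := z) \<in> young lam \<rightarrow> carrier V" if "z \<in> carrier V" for z
    using x that by auto
  let ?z = "\<alpha> \<odot>\<^bsub>V\<^esub> p \<oplus>\<^bsub>V\<^esub> \<beta> \<odot>\<^bsub>V\<^esub> q"
  have z: "?z \<in> carrier V" using pq by (intro a_closed smult_closed')
  let ?m = "\<lambda>b c'. if snd b = snd c' then a (fst b) (x c') else 0"
  let ?f = "\<lambda>z b. if snd b = snd c then a (fst b) z else 0"
  have val: "generic.multi_val lam a (e_gen lam V (x(c := z))) =
      ldet (young lam) (\<lambda>b c'. if c' = c then ?f z b else ?m b c')" if "z \<in> carrier V" for z
    unfolding generic.multi_val_e_gen[OF V a upd[OF that]] by (rule ldet_cong) auto
  have "?f ?z b = generic_scalar \<alpha> * ?f p b + generic_scalar \<beta> * ?f q b" for b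
    using pq by (simp add: generic.functional_add[OF a] generic.functional_smult[OF a])
  then have lin: "generic.multi_val lam a (e_gen lam V (x(c := ?z))) =
      generic_scalar \<alpha> * generic.multi_val lam a (e_gen lam V (x(c := p))) +
      generic_scalar \<beta> * generic.multi_val lam a (e_gen lam V (x(c := q)))"
    unfolding val[OF z] val[OF pq(1)] val[OF pq(2)]
    using ldet_column_linear[OF finite_young c, of "generic_scalar \<alpha>" "?f p" "generic_scalar \<beta>" "?f q" ?m]
    by (simp only:)
  let ?l = "e_gen lam V (x(c := ?z))"
  let ?p = "e_gen lam V (x(c := p))" and ?q = "e_gen lam V (x(c := q))"
  let ?r = "\<alpha> \<odot>\<^bsub>sym_multi lam V\<^esub> ?p \<oplus>\<^bsub>sym_multi lam V\<^esub> \<beta> \<odot>\<^bsub>sym_multi lam V\<^esub> ?q"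
  note cl = e_gen_closed[OF upd[OF z]] e_gen_closed[OF upd[OF pq(1)]] e_gen_closed[OF upd[OF pq(2)]]
  have r: "?r \<in> carrier (sym_multi lam V)" using cl by (intro M.a_closed M.smult_closed')
  note ev = generic.multi_val_functional[OF V a, of lam]
  have "generic.multi_val lam a (?l \<ominus>\<^bsub>sym_multi lam V\<^esub> ?r) = 0"
    unfolding generic.functional_minus[OF multi_kspace ev cl(1) r]
      generic.functional_add[OF ev M.smult_closed'[OF cl(2)] M.smult_closed'[OF cl(3)]]
      generic.functional_smult[OF ev cl(2)] generic.functional_smult[OF ev cl(3)] lin by simp
  moreover have "?l \<ominus>\<^bsub>sym_multi lam V\<^esub> ?r \<in> carrier (sym_multi lam V)"
    using cl(1) r by (rule M.minus_closed)
  ultimately have "?l \<ominus>\<^bsub>sym_multi lam V\<^esub> ?r = \<zero>\<^bsub>sym_multi lam V\<^esub>"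
    using generic_separates[OF V a frame_subset[OF F] frame_span[OF F] entry] by blast
  moreover have "?l = (?l \<ominus>\<^bsub>sym_multi lam V\<^esub> ?r) \<oplus>\<^bsub>sym_multi lam V\<^esub> ?r"
    unfolding M.minus_eq M.a_assoc[OF cl(1) M.a_inv_closed[OF r] r] M.l_neg[OF r] M.r_zero[OF cl(1)] ..
  ultimately show ?thesis using M.l_zero[OF r] by (simp only:)
qed

lemma e_gen_mem_span:
  fixes V :: "('k::field, 'v, 'g) rep"
  assumes V: "kspace V" and F: "frame G d V u \<phi>"
    and D: "D \<subseteq> carrier V" "vs_span V D = carrier V" and x: "x \<in> young lam \<rightarrow> carrier V"
  shows "e_gen lam V x \<in> vs_span (sym_multi lam V) (e_gen lam V ` (young lam \<rightarrow> D))"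
proof -
  interpret kspace_rep V using V by (simp add: kspace_rep_def)
  interpret M: kspace "sym_multi lam V" by (rule multi_kspace)
  let ?W = "vs_span (sym_multi lam V) (e_gen lam V ` (young lam \<rightarrow> D))"
  have sub: "e_gen lam V ` (young lam \<rightarrow> D) \<subseteq> carrier (sym_multi lam V)"
    using e_gen_closed D(1) by (intro image_subsetI) (auto simp: Pi_iff subset_iff)
  \<comment> \<open>Entries are replaced box by box; \<open>A\<close> contains the boxes whose entry
    may still lie outside \<open>D\<close>.\<close>
  have "e_gen lam V x \<in> ?W"
    if "finite A" "A \<subseteq> young lam" "x \<in> young lam \<rightarrow> carrier V" "\<And>b. b \<in> young lam - A \<Longrightarrow> x b \<in> D" for A x
    using that
  proof (induction A arbitrary: x rule: finite_induct)
    case empty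
    then have "x \<in> young lam \<rightarrow> D" by auto
    then show ?case by (intro M.span_base[OF sub] imageI)
  next
    case (insert c A)
    have c: "c \<in> young lam" using insert.prems(1) by simp
    note lin = e_gen_linear[OF V F insert.prems(2) c]
    have "e_gen lam V (x(c := z)) \<in> ?W" if "z \<in> vs_span V D" for z
      using that D(1)
    proof (induction rule: span_gen_induct)
      case zero
      have "e_gen lam V (x(c := \<zero>\<^bsub>V\<^esub>)) = e_gen lam V (x(c := 0 \<odot>\<^bsub>V\<^esub> \<zero>\<^bsub>V\<^esub> \<oplus>\<^bsub>V\<^esub> 0 \<odot>\<^bsub>V\<^esub> \<zero>\<^bsub>V\<^esub>))" by simp
      also have "\<dots> = 0 \<odot>\<^bsub>sym_multi lam V\<^esub> e_gen lam V (x(c := \<zero>\<^bsub>V\<^esub>)) \<oplus>\<^bsub>sym_multi lam V\<^esub>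
          0 \<odot>\<^bsub>sym_multi lam V\<^esub> e_gen lam V (x(c := \<zero>\<^bsub>V\<^esub>))"
        by (rule lin[OF zero_closed zero_closed])
      also have "\<dots> = \<zero>\<^bsub>sym_multi lam V\<^esub>"
      proof -
        have "x(c := \<zero>\<^bsub>V\<^esub>) \<in> young lam \<rightarrow> carrier V" using insert.prems(2) by auto
        from e_gen_closed[OF this] show ?thesis by simp
      qed
      finally show ?case using M.span_zero[OF sub] by (simp only:)
    next
      case (gen z)
      show ?case
      proof (rule insert.IH)
        show "A \<subseteq> young lam" using insert.prems(1) by simp
        show "x(c := z) \<in> young lam \<rightarrow> carrier V" using insert.prems(2) gen D(1) by auto
        show "(x(c := z)) b \<in> D" if "b \<in> young lam - A" for b
          using that gen insert.prems(3)[of b] by (cases "b = c") auto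
      qed
    next
      case (add y z)
      have "e_gen lam V (x(c := y \<oplus>\<^bsub>V\<^esub> z)) = e_gen lam V (x(c := 1 \<odot>\<^bsub>V\<^esub> y \<oplus>\<^bsub>V\<^esub> 1 \<odot>\<^bsub>V\<^esub> z))"
        using add.hyps by simp
      also have "\<dots> \<in> ?W"
        unfolding lin[OF add.hyps] by (intro M.span_add M.span_smult sub add.IH)
      finally show ?case .
    next
      case (smult a z)
      have "e_gen lam V (x(c := a \<odot>\<^bsub>V\<^esub> z)) = e_gen lam V (x(c := a \<odot>\<^bsub>V\<^esub> z \<oplus>\<^bsub>V\<^esub> 0 \<odot>\<^bsub>V\<^esub> z))"
        using smult.hyps by simp
      also have "\<dots> \<in> ?W"
        unfolding lin[OF smult.hyps smult.hyps] by (intro M.span_add M.span_smult sub smult.IH)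
      finally show ?case .
    qed
    from this[of "x c"] show ?case
      using funcset_mem[OF insert.prems(2) c] D(2) by simp
  qed
  from this[OF finite_young subset_refl x] show ?thesis by blast
qed

text \<open>Multilinearity gives the same span for fillings from every spanning set of
  \<open>V\<close>. The bases given for the two Schur functors can therefore be exchanged for a
  frame and its dual.\<close>

lemma
  fixes V :: "('k::field, 'v, 'g) rep"
  assumes V: "kspace V" and F: "frame G d V u \<phi>"
    and v: "v ` B \<subseteq> carrier V" "vs_span V (v ` B) = carrier V"
  shows schur_eq: "schur lam V B v = (sym_multi lam V)
      \<lparr>carrier := vs_span (sym_multi lam V) (e_gen lam V ` (young lam \<rightarrow> carrier V))\<rparr>"
    and schur_span: "D \<subseteq> carrier V \<Longrightarrow> vs_span V D = carrier V \<Longrightarrow>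
      vs_span (schur lam V B v) (e_gen lam V ` (young lam \<rightarrow> D)) = carrier (schur lam V B v)"
proof -
  interpret kspace_rep V using V by (simp add: kspace_rep_def)
  interpret M: kspace "sym_multi lam V" by (rule multi_kspace)
  let ?C = "e_gen lam V ` (young lam \<rightarrow> carrier V)"
  have C: "?C \<subseteq> carrier (sym_multi lam V)" using e_gen_closed by blast
  have span_eq: "vs_span (sym_multi lam V) (e_gen lam V ` (young lam \<rightarrow> D)) = vs_span (sym_multi lam V) ?C"
    if D: "D \<subseteq> carrier V" "vs_span V D = carrier V" for D
  proof
    have DC: "e_gen lam V ` (young lam \<rightarrow> D) \<subseteq> ?C" using D(1) by (intro image_mono Pi_mono)
    then show "vs_span (sym_multi lam V) (e_gen lam V ` (young lam \<rightarrow> D)) \<subseteq> vs_span (sym_multi lam V) ?C"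
      by (rule M.span_is_monotone)
    have "?C \<subseteq> vs_span (sym_multi lam V) (e_gen lam V ` (young lam \<rightarrow> D))"
      using e_gen_mem_span[OF V F D] by blast
    then show "vs_span (sym_multi lam V) ?C \<subseteq> vs_span (sym_multi lam V) (e_gen lam V ` (young lam \<rightarrow> D))"
      by (rule M.span_minimal[OF M.span_submodule[OF subset_trans[OF DC C]]])
  qed
  have "{e_tab lam V v t | t. t \<in> tableaux lam B} = e_gen lam V ` (young lam \<rightarrow> v ` B)"
  proof
    show "{e_tab lam V v t | t. t \<in> tableaux lam B} \<subseteq> e_gen lam V ` (young lam \<rightarrow> v ` B)"
    proof clarify
      fix t assume "t \<in> tableaux lam B"
      then have "(\<lambda>b. v (t b)) \<in> young lam \<rightarrow> v ` B" by (auto simp: tableaux_def)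
      then show "e_tab lam V v t \<in> e_gen lam V ` (young lam \<rightarrow> v ` B)"
        unfolding e_tab_eq_e_gen by (rule imageI)
    qed
    show "e_gen lam V ` (young lam \<rightarrow> v ` B) \<subseteq> {e_tab lam V v t | t. t \<in> tableaux lam B}"
    proof (rule image_subsetI)
      fix x assume x: "x \<in> young lam \<rightarrow> v ` B"
      let ?t = "\<lambda>b\<in>young lam. inv_into B v (x b)"
      have "?t \<in> tableaux lam B"
        unfolding tableaux_def by (intro restrict_PiE_iff[THEN iffD2] ballI inv_into_into funcset_mem[OF x])
      moreover have "e_gen lam V (\<lambda>b. v (?t b)) = e_gen lam V x"
      proof (rule e_gen_cong)
        show "x \<in> young lam \<rightarrow> carrier V" using x v(1) by auto
        show "v (?t b) = x b" if "b \<in> young lam" for b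
          using that f_inv_into_f[OF funcset_mem[OF x that]] by simp
      qed
      ultimately show "e_gen lam V x \<in> {e_tab lam V v t | t. t \<in> tableaux lam B}"
        unfolding e_tab_eq_e_gen by blast
    qed
  qed
  then show eq: "schur lam V B v = (sym_multi lam V)\<lparr>carrier := vs_span (sym_multi lam V) ?C\<rparr>"
    unfolding schur_def by (simp only: span_eq[OF v])
  show "vs_span (schur lam V B v) (e_gen lam V ` (young lam \<rightarrow> D)) = carrier (schur lam V B v)"
    if D: "D \<subseteq> carrier V" "vs_span V D = carrier V"
  proof -
    have "e_gen lam V ` (young lam \<rightarrow> D) \<subseteq> vs_span (sym_multi lam V) ?C"
      using M.in_own_span[OF C] D(1) by blast
    from M.span_li_not_depend(1)[OF this M.span_submodule[OF C]] show ?thesis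
      unfolding eq by (simp add: span_eq[OF D])
  qed
qed

lemma schur_representation:
  fixes V :: "('k::field, 'v, 'g) rep"
  assumes G: "group G" and V: "representation G V" and F: "frame G d V u \<phi>"
    and v: "v ` B \<subseteq> carrier V" "vs_span V (v ` B) = carrier V"
  shows "representation G (schur lam V B v)"
proof -
  note K = representation_kspace[OF V]
  interpret kspace_rep V using K by (simp add: kspace_rep_def)
  interpret M: kspace "sym_multi lam V" by (rule multi_kspace)
  note R = multi_representation[OF G V, of lam]
  let ?C = "e_gen lam V ` (young lam \<rightarrow> carrier V)"
  have C: "?C \<subseteq> carrier (sym_multi lam V)" using e_gen_closed by blast
  show ?thesis
    unfolding schur_eq[OF K F v]
  proof (rule sub_representation[OF R M.span_submodule[OF C]])
    fix g x assume g: "g \<in> carrier G" and x: "x \<in> vs_span (sym_multi lam V) ?C"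
    show "act (sym_multi lam V) g x \<in> vs_span (sym_multi lam V) ?C"
    proof (rule M.hom_image_span[OF M.kspace_axioms representation.act_linear[OF R g] C M.span_submodule[OF C] _ x])
      have "act (sym_multi lam V) g (e_gen lam V y) \<in> ?C" if y: "y \<in> young lam \<rightarrow> carrier V" for y
        unfolding act_e_gen[OF G V g y]
        using hom_k_closed[OF representation.act_linear[OF V g]] y by (intro imageI) auto
      then show "act (sym_multi lam V) g ` ?C \<subseteq> vs_span (sym_multi lam V) ?C"
        using M.in_own_span[OF C] by blast
    qed
  qed
qed

subsection \<open>Isomorphisms from separating functionals\<close>

text \<open>Having equal values under all pairs of functionals is a linear relation between
  \<open>X\<close> and \<open>Y\<close>. Separation makes it single-valued in both directions and
  the spanning sets make it total, so it is the graph of an isomorphism. The second half of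
  \<open>left\<close> provides equivariance.\<close>

lemma (in scalar_extension) isomorphic_repsI:
  fixes X :: "('k, 'v, 'g) rep" and Y :: "('k, 'w, 'g) rep"
  assumes X: "representation G X" and Y: "representation G Y"
    and \<Phi>: "\<And>p. p \<in> P \<Longrightarrow> functional X (\<Phi> p)" and \<Psi>: "\<And>p. p \<in> P \<Longrightarrow> functional Y (\<Psi> p)"
    and sepX: "\<And>x. x \<in> carrier X \<Longrightarrow> (\<And>p. p \<in> P \<Longrightarrow> \<Phi> p x = 0) \<Longrightarrow> x = \<zero>\<^bsub>X\<^esub>"
    and sepY: "\<And>y. y \<in> carrier Y \<Longrightarrow> (\<And>p. p \<in> P \<Longrightarrow> \<Psi> p y = 0) \<Longrightarrow> y = \<zero>\<^bsub>Y\<^esub>"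
    and S: "S \<subseteq> carrier X" "vs_span X S = carrier X"
    and T: "T \<subseteq> carrier Y" "vs_span Y T = carrier Y"
    and left: "\<And>x. x \<in> S \<Longrightarrow> \<exists>y\<in>carrier Y. (\<forall>p\<in>P. \<Phi> p x = \<Psi> p y) \<and>
      (\<forall>g\<in>carrier G. \<forall>p\<in>P. \<Phi> p (act X g x) = \<Psi> p (act Y g y))"
    and right: "\<And>y. y \<in> T \<Longrightarrow> \<exists>x\<in>carrier X. \<forall>p\<in>P. \<Phi> p x = \<Psi> p y"
  shows "isomorphic_reps G X Y"
proof -
  interpret X: kspace X by (rule representation_kspace[OF X])
  interpret Y: kspace Y by (rule representation_kspace[OF Y])
  have eqX: "x = x'" if x: "x \<in> carrier X" "x' \<in> carrier X" and eq: "\<And>p. p \<in> P \<Longrightarrow> \<Phi> p x = \<Phi> p x'" for x x'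
  proof -
    have "x \<ominus>\<^bsub>X\<^esub> x' = \<zero>\<^bsub>X\<^esub>"
    proof (rule sepX[OF X.minus_closed[OF x]])
      fix p assume p: "p \<in> P"
      show "\<Phi> p (x \<ominus>\<^bsub>X\<^esub> x') = 0"
        unfolding functional_minus[OF X.kspace_axioms \<Phi>[OF p] x] eq[OF p] by (rule diff_self)
    qed
    moreover have "x = (x \<ominus>\<^bsub>X\<^esub> x') \<oplus>\<^bsub>X\<^esub> x'"
      unfolding X.minus_eq X.a_assoc[OF x(1) X.a_inv_closed[OF x(2)] x(2)] X.l_neg[OF x(2)] X.r_zero[OF x(1)] ..
    ultimately show ?thesis using X.l_zero[OF x(2)] by (simp only:)
  qed
  have eqY: "y = y'" if y: "y \<in> carrier Y" "y' \<in> carrier Y" and eq: "\<And>p. p \<in> P \<Longrightarrow> \<Psi> p y = \<Psi> p y'" for y y'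
  proof -
    have "y \<ominus>\<^bsub>Y\<^esub> y' = \<zero>\<^bsub>Y\<^esub>"
    proof (rule sepY[OF Y.minus_closed[OF y]])
      fix p assume p: "p \<in> P"
      show "\<Psi> p (y \<ominus>\<^bsub>Y\<^esub> y') = 0"
        unfolding functional_minus[OF Y.kspace_axioms \<Psi>[OF p] y] eq[OF p] by (rule diff_self)
    qed
    moreover have "y = (y \<ominus>\<^bsub>Y\<^esub> y') \<oplus>\<^bsub>Y\<^esub> y'"
      unfolding Y.minus_eq Y.a_assoc[OF y(1) Y.a_inv_closed[OF y(2)] y(2)] Y.l_neg[OF y(2)] Y.r_zero[OF y(1)] ..
    ultimately show ?thesis using Y.l_zero[OF y(2)] by (simp only:)
  qed
  \<comment> \<open>Partners can be added and scaled, so their existence passes from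
    \<open>S\<close> to its span.\<close>
  have exY: "\<exists>y\<in>carrier Y. \<forall>p\<in>P. \<Phi> p x = \<Psi> p y" if "x \<in> vs_span X S" for x
    using that S(1)
  proof (induction rule: X.span_gen_induct)
    case zero
    show ?case
      by (rule bexI[OF _ Y.zero_closed])
        (simp add: functional_zero[OF X.kspace_axioms \<Phi>] functional_zero[OF Y.kspace_axioms \<Psi>])
  next
    case (gen x)
    then show ?case using left by blast
  next
    case (add x x')
    then obtain y y' where y: "y \<in> carrier Y" "\<forall>p\<in>P. \<Phi> p x = \<Psi> p y"
      "y' \<in> carrier Y" "\<forall>p\<in>P. \<Phi> p x' = \<Psi> p y'" by blast
    show ?case
      by (rule bexI[OF _ Y.a_closed[OF y(1,3)]])
        (use y add.hyps in \<open>simp add: functional_add[OF \<Phi>] functional_add[OF \<Psi>]\<close>)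
  next
    case (smult a x)
    then obtain y where y: "y \<in> carrier Y" "\<forall>p\<in>P. \<Phi> p x = \<Psi> p y" by blast
    show ?case
      by (rule bexI[OF _ Y.smult_closed'[OF y(1), of a]])
        (use y smult.hyps in \<open>simp add: functional_smult[OF \<Phi>] functional_smult[OF \<Psi>]\<close>)
  qed
  have exX: "\<exists>x\<in>carrier X. \<forall>p\<in>P. \<Phi> p x = \<Psi> p y" if "y \<in> vs_span Y T" for y
    using that T(1)
  proof (induction rule: Y.span_gen_induct)
    case zero
    show ?case
      by (rule bexI[OF _ X.zero_closed])
        (simp add: functional_zero[OF X.kspace_axioms \<Phi>] functional_zero[OF Y.kspace_axioms \<Psi>])
  next
    case (gen y)
    then show ?case using right by blast
  next
    case (add y y')
    then obtain x x' where x: "x \<in> carrier X" "\<forall>p\<in>P. \<Phi> p x = \<Psi> p y"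
      "x' \<in> carrier X" "\<forall>p\<in>P. \<Phi> p x' = \<Psi> p y'" by blast
    show ?case
      by (rule bexI[OF _ X.a_closed[OF x(1,3)]])
        (use x add.hyps in \<open>simp add: functional_add[OF \<Phi>] functional_add[OF \<Psi>]\<close>)
  next
    case (smult a y)
    then obtain x where x: "x \<in> carrier X" "\<forall>p\<in>P. \<Phi> p x = \<Psi> p y" by blast
    show ?case
      by (rule bexI[OF _ X.smult_closed'[OF x(1), of a]])
        (use x smult.hyps in \<open>simp add: functional_smult[OF \<Phi>] functional_smult[OF \<Psi>]\<close>)
  qed
  \<comment> \<open>The choice is harmless: by \<open>eqY\<close> there is only one partner.\<close>
  define f where "f x = (SOME y. y \<in> carrier Y \<and> (\<forall>p\<in>P. \<Phi> p x = \<Psi> p y))" for x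
  have f: "f x \<in> carrier Y \<and> (\<forall>p\<in>P. \<Phi> p x = \<Psi> p (f x))" if "x \<in> carrier X" for x
  proof -
    have "\<exists>y. y \<in> carrier Y \<and> (\<forall>p\<in>P. \<Phi> p x = \<Psi> p y)"
      using exY[of x] that unfolding S(2) by blast
    then show ?thesis unfolding f_def by (rule someI_ex)
  qed
  have fc: "f x \<in> carrier Y" if "x \<in> carrier X" for x using f[OF that] by (rule conjunct1)
  have f\<Psi>: "\<Psi> p (f x) = \<Phi> p x" if "x \<in> carrier X" "p \<in> P" for x p using f[OF that(1)] that(2) by simp
  have f_eq: "f x = y" if "x \<in> carrier X" "y \<in> carrier Y" "\<And>p. p \<in> P \<Longrightarrow> \<Phi> p x = \<Psi> p y" for x y
    by (rule eqY[OF fc[OF that(1)] that(2)]) (simp add: f\<Psi>[OF that(1)] that(3))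
  have hom: "f \<in> LinearCombinations.module_hom class_ring X Y"
  proof (rule hom_kI)
    fix x x' a assume x: "x \<in> carrier X"
    show "f x \<in> carrier Y" by (rule fc[OF x])
    show "f (a \<odot>\<^bsub>X\<^esub> x) = a \<odot>\<^bsub>Y\<^esub> f x"
      by (rule f_eq[OF X.smult_closed'[OF x] Y.smult_closed'[OF fc[OF x]]])
        (simp add: functional_smult[OF \<Phi> x] functional_smult[OF \<Psi> fc[OF x]] f\<Psi>[OF x])
    assume x': "x' \<in> carrier X"
    show "f (x \<oplus>\<^bsub>X\<^esub> x') = f x \<oplus>\<^bsub>Y\<^esub> f x'"
      by (rule f_eq[OF X.a_closed[OF x x'] Y.a_closed[OF fc[OF x] fc[OF x']]])
        (simp add: functional_add[OF \<Phi> x x'] functional_add[OF \<Psi> fc[OF x] fc[OF x']] f\<Psi>[OF x] f\<Psi>[OF x'])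
  qed
  have bij: "bij_betw f (carrier X) (carrier Y)"
  proof (rule bij_betw_imageI)
    show "inj_on f (carrier X)"
    proof (rule inj_onI)
      fix x x' assume x: "x \<in> carrier X" "x' \<in> carrier X" and "f x = f x'"
      then show "x = x'" using f\<Psi>[OF x(1)] f\<Psi>[OF x(2)] by (intro eqX[OF x]) simp
    qed
    show "f ` carrier X = carrier Y"
    proof
      show "carrier Y \<subseteq> f ` carrier X"
      proof
        fix y assume y: "y \<in> carrier Y"
        then obtain x where x: "x \<in> carrier X" "\<forall>p\<in>P. \<Phi> p x = \<Psi> p y"
          using exX[of y] unfolding T(2) by blast
        have "f x = y" by (rule f_eq[OF x(1) y]) (use x(2) in blast)
        then show "y \<in> f ` carrier X" using x(1) by blast
      qed
    qed (use fc in blast)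
  qed
  \<comment> \<open>Both sides are linear in \<open>x\<close>, so members of \<open>S\<close>
    suffice, and for these the partner given by \<open>left\<close> remains one after applying
    \<open>g\<close>.\<close>
  have equiv: "f (act X g x) = act Y g (f x)" if g: "g \<in> carrier G" and x: "x \<in> carrier X" for g x
  proof (rule f_eq)
    note hX = representation.act_linear[OF X g] and hY = representation.act_linear[OF Y g]
    show "act X g x \<in> carrier X" by (rule hom_k_closed[OF hX x])
    show "act Y g (f x) \<in> carrier Y" by (rule hom_k_closed[OF hY fc[OF x]])
    fix p assume p: "p \<in> P"
    show "\<Phi> p (act X g x) = \<Psi> p (act Y g (f x))"
    proof (rule functional_eq_on_span[OF X.kspace_axioms functional_hom[OF hX \<Phi>[OF p]]
          functional_hom[OF hom functional_hom[OF hY \<Psi>[OF p]]] S(1)])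
      show "x \<in> vs_span X S" using x S(2) by simp
      fix z assume z: "z \<in> S"
      then obtain y where y: "y \<in> carrier Y" "\<forall>p\<in>P. \<Phi> p z = \<Psi> p y"
        "\<forall>g\<in>carrier G. \<forall>p\<in>P. \<Phi> p (act X g z) = \<Psi> p (act Y g y)" using left by blast
      have "f z = y" by (rule f_eq[OF subsetD[OF S(1) z] y(1)]) (use y(2) in blast)
      then show "\<Phi> p (act X g z) = \<Psi> p (act Y g (f z))" using y(3) g p by simp
    qed
  qed
  have "linear_map class_ring X Y f"
    using X.vectorspace_axioms Y.vectorspace_axioms hom
    by (simp add: linear_map_def mod_hom_def mod_hom_axioms_def vectorspace_def)
  then show ?thesis unfolding isomorphic_reps_def using X Y bij equiv by blast
qed


subsection \<open>Powers of the determinant\<close>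

definition volume :: "('k::field, 'v, 'g) rep \<Rightarrow> nat \<Rightarrow> (nat \<Rightarrow> 'v) \<Rightarrow> ('v list \<Rightarrow>\<^sub>0 'k) set set" where
  "volume V d u = ext_product V (map u [1..<d + 1])"

definition volumes ::
  "('k::field, 'v, 'g) rep \<Rightarrow> nat \<Rightarrow> nat \<Rightarrow> (nat \<Rightarrow> nat \<Rightarrow> 'v) \<Rightarrow> (('v list \<Rightarrow>\<^sub>0 'k) set set list \<Rightarrow>\<^sub>0 'k) set"
  where "volumes V d s z =
    pure_tensor (replicate s (ext_power d V)) (map (\<lambda>j. volume V d (z j)) [1..<s + 1])"

lemma nth_upt_Suc: "n < d \<Longrightarrow> map f [1..<d + 1] ! n = f (Suc n)"
  by (simp add: nth_append del: upt_Suc)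

lemma ext_kspaces:
  assumes V: "kspace V"
  shows "kspaces (replicate s (ext_power d V))"
proof -
  interpret power_space V d using V by (simp add: power_space_def kspace_rep_def)
  show ?thesis by (rule kspaces.intro) (use ext_kspace in auto)
qed

context scalar_extension begin

text \<open>The \<open>d\<close> rows \<open>a i\<close> form one d-form on the exterior power.
  Columns are counted from 1 and list entries from 0, hence \<open>b - 1\<close>.\<close>

definition det_val :: "nat \<Rightarrow> (nat \<Rightarrow> 'v \<Rightarrow> 'l) \<Rightarrow> ('v list \<Rightarrow>\<^sub>0 'k) set set \<Rightarrow> 'l" where
  "det_val d a = coset_val (tensor_val (\<lambda>xs. ldet {1..d} (\<lambda>i b. a i (xs ! (b - 1)))))"

definition det_power_val :: "nat \<Rightarrow> nat \<Rightarrow> (nat \<Rightarrow> 'v \<Rightarrow> 'l) \<Rightarrow>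
    (('v list \<Rightarrow>\<^sub>0 'k) set set list \<Rightarrow>\<^sub>0 'k) set \<Rightarrow> 'l" where
  "det_power_val d s a = tensor_val (\<lambda>ys. \<Prod>j<s. det_val d a (ys ! j))"

context
  fixes V :: "('k, 'v, 'g) rep" and a :: "nat \<Rightarrow> 'v \<Rightarrow> 'l"
  assumes V: "kspace V" and a: "\<And>i. functional V (a i)"
begin

lemma det_multilinear:
  "multilinear (replicate d V) (\<lambda>xs. ldet {1..d} (\<lambda>i b. a i (xs ! (b - 1))))"
  unfolding multilinear_def
proof (intro ballI allI impI)
  interpret kspace V by (rule V)
  fix xs n \<alpha> \<beta> x y
  assume xs: "xs \<in> listset (map carrier (replicate d V))" and n': "n < length (replicate d V)"
    and xy: "x \<in> carrier (replicate d V ! n)" "y \<in> carrier (replicate d V ! n)"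
  have n: "n < d" using n' by simp
  have V_nth: "replicate d V ! n = V" using n by simp
  have x: "x \<in> carrier V" and y: "y \<in> carrier V" using xy unfolding V_nth .
  have len: "length xs = d" using xs by (simp add: mem_listset_iff)
  have col: "ldet {1..d} (\<lambda>i b. a i (xs[n := z] ! (b - 1))) =
      ldet {1..d} (\<lambda>i b. if b = Suc n then a i z else a i (xs ! (b - 1)))" for z
    by (rule ldet_cong) (use len n in \<open>auto simp: nth_list_update\<close>)
  have lin: "a i (\<alpha> \<odot>\<^bsub>V\<^esub> x \<oplus>\<^bsub>V\<^esub> \<beta> \<odot>\<^bsub>V\<^esub> y) = \<kappa> \<alpha> * a i x + \<kappa> \<beta> * a i y" for i
    unfolding functional_add[OF a smult_closed'[OF x] smult_closed'[OF y]]
      functional_smult[OF a x] functional_smult[OF a y] ..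
  show "ldet {1..d} (\<lambda>i b. a i (xs[n := \<alpha> \<odot>\<^bsub>replicate d V ! n\<^esub> x \<oplus>\<^bsub>replicate d V ! n\<^esub>
        \<beta> \<odot>\<^bsub>replicate d V ! n\<^esub> y] ! (b - 1))) =
      \<kappa> \<alpha> * ldet {1..d} (\<lambda>i b. a i (xs[n := x] ! (b - 1))) +
      \<kappa> \<beta> * ldet {1..d} (\<lambda>i b. a i (xs[n := y] ! (b - 1)))"
    unfolding V_nth col lin by (rule ldet_column_linear) (use n in auto)
qed

lemma det_alternating:
  "alternating_on d (carrier V) (\<lambda>xs. ldet {1..d} (\<lambda>i b. a i (xs ! (b - 1))))"
  unfolding alternating_on_def
proof (intro allI impI)
  fix xs :: "'v list" assume "length xs = d" "\<not> distinct xs"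
  then obtain i j where ij: "i < d" "j < d" "i \<noteq> j" "xs ! i = xs ! j"
    unfolding distinct_conv_nth by blast
  show "ldet {1..d} (\<lambda>i b. a i (xs ! (b - 1))) = 0"
    by (rule ldet_identical_columns[of _ "Suc i" "Suc j"]) (use ij in auto)
qed

lemma det_val_functional: "functional (ext_power d V) (det_val d a)"
  unfolding det_val_def by (rule alt_val_functional[OF V det_multilinear det_alternating])

lemma det_val_volume:
  assumes u: "u ` {1..d} \<subseteq> carrier V"
  shows "det_val d a (volume V d u) = ldet {1..d} (\<lambda>i b. a i (u b))"
proof -
  have "set (map u [1..<d + 1]) \<subseteq> carrier V" using u by (auto simp: image_subset_iff simp del: upt_Suc)
  moreover have "length (map u [1..<d + 1]) = d" by (simp del: upt_Suc)
  ultimately have "det_val d a (volume V d u) = ldet {1..d} (\<lambda>i b. a i (map u [1..<d + 1] ! (b - 1)))"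
    unfolding det_val_def volume_def by (intro alt_val_product[OF V det_multilinear det_alternating])
  also have "\<dots> = ldet {1..d} (\<lambda>i b. a i (u b))"
  proof (rule ldet_cong)
    fix i b assume "b \<in> {1..d}"
    then show "a i (map u [1..<d + 1] ! (b - 1)) = a i (u b)"
      by (subst nth_upt_Suc) auto
  qed
  finally show ?thesis .
qed

lemma det_power_multilinear:
  "multilinear (replicate s (ext_power d V)) (\<lambda>ys. \<Prod>j<s. det_val d a (ys ! j))"
proof -
  have "multilinear (replicate s (ext_power d V))
      (\<lambda>ys. \<Prod>j<length (replicate s (ext_power d V)). det_val d a (ys ! j))"
    by (rule prod_multilinear[OF _ ext_kspaces[OF V]]) (simp add: det_val_functional)
  then show ?thesis by simp
qed

lemma det_power_val_functional: "functional (tensor_power s (ext_power d V)) (det_power_val d s a)"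
  unfolding det_power_val_def by (rule tensor_val_functional[OF ext_kspaces[OF V] det_power_multilinear])

end

end

lemma volume_closed:
  assumes "kspace V" "u ` {1..d} \<subseteq> carrier V"
  shows "volume V d u \<in> carrier (ext_power d V)"
proof -
  interpret power_space V d using assms(1) by (simp add: power_space_def kspace_rep_def)
  show ?thesis unfolding volume_def
    by (rule ext_product_closed) (use assms(2) in \<open>auto simp: image_subset_iff simp del: upt_Suc\<close>)
qed

lemma volumes_tuple:
  assumes V: "kspace V" and z: "\<And>j. j \<in> {1..s} \<Longrightarrow> z j ` {1..d} \<subseteq> carrier V"
  shows "map (\<lambda>j. volume V d (z j)) [1..<s + 1] \<in> listset (map carrier (replicate s (ext_power d V)))"
  unfolding mem_listset_iff
proof (intro conjI allI impI)
  fix n assume "n < length (map carrier (replicate s (ext_power d V)))"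
  then have n: "n < s" by simp
  have "volume V d (z (Suc n)) \<in> carrier (ext_power d V)"
    by (rule volume_closed[OF V z]) (use n in auto)
  then show "map (\<lambda>j. volume V d (z j)) [1..<s + 1] ! n \<in> map carrier (replicate s (ext_power d V)) ! n"
    unfolding nth_upt_Suc[OF n] using n by simp
qed (simp del: upt_Suc)

lemma volumes_closed:
  assumes V: "kspace V" and z: "\<And>j. j \<in> {1..s} \<Longrightarrow> z j ` {1..d} \<subseteq> carrier V"
  shows "volumes V d s z \<in> carrier (tensor_power s (ext_power d V))"
  unfolding volumes_def
  by (rule kspaces.pure_tensor_closed[OF ext_kspaces[OF V] volumes_tuple[OF V z]])

lemma (in scalar_extension) det_power_val_volumes:
  assumes V: "kspace V" and a: "\<And>i. functional V (a i)"
    and z: "\<And>j. j \<in> {1..s} \<Longrightarrow> z j ` {1..d} \<subseteq> carrier V"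
  shows "det_power_val d s a (volumes V d s z) = (\<Prod>j\<in>{1..s}. ldet {1..d} (\<lambda>i b. a i (z j b)))"
proof -
  have "det_power_val d s a (volumes V d s z) =
      (\<Prod>n<s. det_val d a (map (\<lambda>j. volume V d (z j)) [1..<s + 1] ! n))"
    unfolding det_power_val_def volumes_def
    by (rule tensor_val_pure[OF ext_kspaces[OF V] det_power_multilinear[OF V a] volumes_tuple[OF V z]])
  also have "\<dots> = (\<Prod>n<s. ldet {1..d} (\<lambda>i b. a i (z (Suc n) b)))"
  proof (rule prod.cong[OF refl])
    fix n assume "n \<in> {..<s}"
    then have n: "n < s" by simp
    show "det_val d a (map (\<lambda>j. volume V d (z j)) [1..<s + 1] ! n) = ldet {1..d} (\<lambda>i b. a i (z (Suc n) b))"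
      unfolding nth_upt_Suc[OF n] by (rule det_val_volume[OF V a z]) (use n in auto)
  qed
  also have "\<dots> = (\<Prod>j\<in>{1..s}. ldet {1..d} (\<lambda>i b. a i (z j b)))"
    by (rule prod.reindex_bij_witness[of _ "\<lambda>j. j - 1" Suc]) auto
  finally show ?thesis .
qed

text \<open>Each exterior power is a line spanned by the volume element of any frame, so the frames
  may differ from factor to factor.\<close>

lemma volumes_span:
  assumes V: "kspace V" and F: "\<And>j. j \<in> {1..s} \<Longrightarrow> frame G d V (z j) (\<zeta> j)"
  shows "vs_span (tensor_power s (ext_power d V)) {volumes V d s z} = carrier (tensor_power s (ext_power d V))"
proof -
  interpret power_space V d using V by (simp add: power_space_def kspace_rep_def)
  note ks = ext_kspaces[OF V, of s d]
  have z: "z j ` {1..d} \<subseteq> carrier V" if "j \<in> {1..s}" for j by (rule frame_subset[OF F[OF that]])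
  let ?zs = "map (\<lambda>j. volume V d (z j)) [1..<s + 1]"
  let ?Ss = "map (\<lambda>y. {y}) ?zs"
  \<comment> \<open>Taking singletons as spanning sets of the factors leaves a single pure
    tensor.\<close>
  have "listset ?Ss = {?zs}"
    by (auto simp: mem_listset_iff simp del: upt_Suc intro: nth_equalityI)
  moreover have "vs_span (tensor_power s (ext_power d V)) (pure_tensor (replicate s (ext_power d V)) ` listset ?Ss)
      = carrier (tensor_power s (ext_power d V))"
  proof (rule kspaces.tensor_span[OF ks])
    fix n assume "n < length (replicate s (ext_power d V))"
    then have n: "n < s" by simp
    then have j: "Suc n \<in> {1..s}" by auto
    have Ss: "?Ss ! n = {volume V d (z (Suc n))}"
      using nth_upt_Suc[OF n, of "\<lambda>j. volume V d (z j)"] n by (simp del: upt_Suc)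
    have E: "replicate s (ext_power d V) ! n = ext_power d V" using n by simp
    show "?Ss ! n \<subseteq> carrier (replicate s (ext_power d V) ! n)"
      unfolding Ss E using volume_closed[OF V z[OF j]] by simp
    have set: "set (map (z (Suc n)) [1..<d + 1]) = z (Suc n) ` {1..d}"
      by (simp add: atLeastLessThanSuc_atLeastAtMost del: upt_Suc)
    show "vs_span (replicate s (ext_power d V) ! n) (?Ss ! n) = carrier (replicate s (ext_power d V) ! n)"
      unfolding Ss E unfolding volume_def
      by (rule ext_power_line)
        (use frame_subset[OF F[OF j]] frame_span[OF F[OF j]] in \<open>simp_all only: set length_map length_upt diff_add_inverse2\<close>)
  qed (simp del: upt_Suc)
  ultimately show ?thesis unfolding volumes_def by simp
qed

lemma act_volumes:
  assumes G: "group G" and V: "representation G V" and g: "g \<in> carrier G"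
    and z: "\<And>j. j \<in> {1..s} \<Longrightarrow> z j ` {1..d} \<subseteq> carrier V"
  shows "act (tensor_power s (ext_power d V)) g (volumes V d s z) = volumes V d s (\<lambda>j b. act V g (z j b))"
proof -
  note K = representation_kspace[OF V]
  have vol: "act (ext_power d V) g (volume V d (z j)) = volume V d (\<lambda>b. act V g (z j b))"
    if j: "j \<in> {1..s}" for j
  proof -
    have "act (ext_power d V) g (volume V d (z j)) = ext_product V (map (act V g) (map (z j) [1..<d + 1]))"
      unfolding volume_def
      by (rule act_ext_product[OF G V g])
        (use z[OF j] in \<open>auto simp: image_subset_iff simp del: upt_Suc\<close>)
    then show ?thesis unfolding volume_def map_map comp_def .
  qed
  have "act (tensor_power s (ext_power d V)) g (volumes V d s z) =
      pure_tensor (replicate s (ext_power d V)) (map (act (ext_power d V) g) (map (\<lambda>j. volume V d (z j)) [1..<s + 1]))"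
    unfolding volumes_def
  proof (rule act_power_pure[OF G ext_representation[OF G V] g])
    show "set (map (\<lambda>j. volume V d (z j)) [1..<s + 1]) \<subseteq> carrier (ext_power d V)"
      using volume_closed[OF K z] by (auto simp del: upt_Suc)
  qed (simp del: upt_Suc)
  also have "map (act (ext_power d V) g) (map (\<lambda>j. volume V d (z j)) [1..<s + 1]) =
      map (\<lambda>j. volume V d (\<lambda>b. act V g (z j b))) [1..<s + 1]"
    unfolding map_map comp_def by (rule map_cong[OF refl], rule vol) (auto simp del: upt_Suc)
  finally show ?thesis unfolding volumes_def .
qed

subsection \<open>Evaluation at a generic pair of dual matrices\<close>

text \<open>Completes the distinct basis indices in a column to a permutation of all indices, so
  that the column becomes part of a permuted frame.\<close>

lemma extend_to_permutation:
  assumes A: "A \<subseteq> S" and S: "finite S" and h: "inj_on h A" "h ` A \<subseteq> S"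
  obtains p where "p permutes S" "\<And>a. a \<in> A \<Longrightarrow> p a = h a"
proof -
  have "finite A" using finite_subset[OF A S] .
  then have "card (S - A) = card (S - h ` A)"
    using A h S by (simp add: card_Diff_subset card_image)
  then obtain f where f: "bij_betw f (S - A) (S - h ` A)"
    using S by (meson finite_Diff finite_same_card_bij)
  let ?p = "\<lambda>a. if a \<in> A then h a else if a \<in> S then f a else a"
  have 1: "bij_betw ?p A (h ` A)" using h(1) by (simp add: bij_betw_def inj_on_def)
  have 2: "bij_betw ?p (S - A) (S - h ` A)" by (rule bij_betw_cong[THEN iffD1, OF _ f]) auto
  have "bij_betw ?p (A \<union> (S - A)) (h ` A \<union> (S - h ` A))"
    by (rule bij_betw_combine[OF 1 2]) blast
  moreover have "A \<union> (S - A) = S" "h ` A \<union> (S - h ` A) = S" using A h(2) by blast+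
  ultimately have "?p permutes S" using A by (intro bij_imp_permutes) auto
  then show ?thesis by (rule that) simp
qed

lemma (in kspace) span_singleton:
  assumes x: "x \<in> vs_span V {y}" and y: "y \<in> carrier V"
  obtains c where "x = c \<odot>\<^bsub>V\<^esub> y"
proof -
  have "{y} \<subseteq> carrier V" using y by simp
  with x have "\<exists>c. x = c \<odot>\<^bsub>V\<^esub> y"
  proof (induction rule: span_gen_induct)
    case zero
    show ?case by (rule exI[of _ 0]) (simp add: y)
  next
    case (gen x)
    then show ?case by (intro exI[of _ 1]) (simp add: y)
  next
    case (add x x')
    then obtain c c' where "x = c \<odot>\<^bsub>V\<^esub> y" "x' = c' \<odot>\<^bsub>V\<^esub> y" by blast
    then show ?case by (intro exI[of _ "c + c'"]) (simp add: smult_distrib_left y)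
  next
    case (smult a x)
    then obtain c where "x = c \<odot>\<^bsub>V\<^esub> y" by blast
    then show ?case by (intro exI[of _ "a * c"]) (simp add: smult_smult y)
  qed
  then show ?thesis using that by blast
qed

lemma complement_bij: "bij_betw (\<lambda>i. d + 1 - i) {1..d - k} {k + 1..d :: nat}"
  by (rule bij_betw_byWitness[of _ "\<lambda>i. d + 1 - i"]) auto

text \<open>\<open>\<beta>\<close> is the inverse transpose of \<open>\<alpha>\<close>; in this form
  the relation is symmetric in the two matrices.\<close>

definition dual_matrices :: "nat \<Rightarrow> (nat \<Rightarrow> nat \<Rightarrow> 'a::field) \<Rightarrow> (nat \<Rightarrow> nat \<Rightarrow> 'a) \<Rightarrow> bool" where
  "dual_matrices d \<alpha> \<beta> \<longleftrightarrow> (\<forall>i\<in>{1..d}. \<forall>j\<in>{1..d}. (\<Sum>b\<in>{1..d}. \<alpha> i b * \<beta> j b) = (if i = j then 1 else 0))"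

lemma dual_matrices_sym: "dual_matrices d \<alpha> \<beta> \<Longrightarrow> dual_matrices d \<beta> \<alpha>"
  unfolding dual_matrices_def
proof (intro ballI)
  fix i j assume *: "\<forall>i\<in>{1..d}. \<forall>j\<in>{1..d}. (\<Sum>b\<in>{1..d}. \<alpha> i b * \<beta> j b) = (if i = j then 1 else 0)"
    and ij: "i \<in> {1..d}" "j \<in> {1..d}"
  have "(\<Sum>b\<in>{1..d}. \<beta> i b * \<alpha> j b) = (\<Sum>b\<in>{1..d}. \<alpha> j b * \<beta> i b)"
    by (simp only: mult.commute)
  also have "\<dots> = (if j = i then 1 else 0)" by (rule *[rule_format, OF ij(2,1)])
  finally show "(\<Sum>b\<in>{1..d}. \<beta> i b * \<alpha> j b) = (if i = j then 1 else 0)"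
    unfolding eq_commute[of j i] .
qed

lemma dual_matrices_det:
  assumes "dual_matrices d \<alpha> \<beta>"
  shows "ldet {1..d} \<alpha> \<noteq> 0"
proof
  assume "ldet {1..d} \<alpha> = 0"
  moreover have "ldet {1..d} \<alpha> * ldet {1..d} (\<lambda>b j. \<beta> j b) = ldet {1..d} (\<lambda>i j. if i = j then 1 else 0)"
    unfolding ldet_mult[OF finite_atLeastAtMost, symmetric]
    by (rule ldet_cong) (rule assms[unfolded dual_matrices_def, rule_format])
  ultimately show False by (simp add: ldet_delta)
qed

lemma dual_matrices_exist:
  assumes "ldet {1..d} \<alpha> \<noteq> 0"
  obtains \<beta> where "dual_matrices d \<alpha> \<beta>"
proof -
  obtain \<beta> where "\<And>i j. i \<in> {1..d} \<Longrightarrow> j \<in> {1..d} \<Longrightarrow> (\<Sum>b\<in>{1..d}. \<alpha> i b * \<beta> j b) = (if i = j then 1 else 0)"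
    using ldet_inverse[OF finite_atLeastAtMost assms] by blast
  then show ?thesis by (intro that[of \<beta>]) (unfold dual_matrices_def, intro ballI)
qed

locale framed_rep = scalar_extension \<kappa>
  for \<kappa> :: "'k::field \<Rightarrow> 'l::field" +
  fixes G :: "('g, 'm) monoid_scheme" and V :: "('k, 'v, 'g) rep"
    and d :: nat and u :: "nat \<Rightarrow> 'v" and \<phi> :: "nat \<Rightarrow> 'v \<Rightarrow> 'k"
  assumes rep: "representation G V" and frame: "frame G d V u \<phi>"
begin

abbreviation D where "D \<equiv> dual_rep G V"

lemmas V_kspace = representation_kspace[OF rep]
lemmas D_kspace = dual_kspace[OF V_kspace, of G]
lemmas D_rep = dual_representation[OF rep]
lemmas group = representation.group[OF rep]

text \<open>The dual basis of \<open>\<phi>\<close> consists of the evaluations at the vectors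
  \<open>u b\<close>. It is required because the results on Schur functors are also applied to the
  dual space, and they ask for a frame there.\<close>

lemma dual_frame: "frame G d D \<phi> (\<lambda>b. \<lambda>f\<in>carrier D. f (u b))"
  unfolding frame_def
proof (intro conjI ballI)
  show "\<phi> ` {1..d} \<subseteq> carrier D" by (rule frame_dual_subset[OF frame])
  show "vs_span D (\<phi> ` {1..d}) = carrier D" by (rule frame_dual_span[OF V_kspace frame])
  show "(\<lambda>b. \<lambda>f\<in>carrier D. f (u b)) ` {1..d} \<subseteq> carrier (dual_rep G D)"
  proof (rule image_subsetI)
    fix b assume "b \<in> {1..d}"
    from frame_closed[OF frame this] show "(\<lambda>f\<in>carrier D. f (u b)) \<in> carrier (dual_rep G D)"
      by (intro dual_restrict_mem[OF D_kspace]) (simp add: form.functional_def)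
  qed
  fix b c assume "b \<in> {1..d}" "c \<in> {1..d}"
  then show "(\<lambda>f\<in>carrier D. f (u b)) (\<phi> c) = (if b = c then 1 else 0)"
    using frame_delta[OF frame, of c b] frame_dual_closed[OF frame, of c] by auto
qed

definition row :: "(nat \<Rightarrow> nat \<Rightarrow> 'l) \<Rightarrow> nat \<Rightarrow> 'v \<Rightarrow> 'l" where
  "row \<alpha> i x = (\<Sum>b\<in>{1..d}. \<alpha> i b * \<kappa> (\<phi> b x))"

text \<open>The values \<open>f (u b)\<close> are the coordinates of \<open>f\<close> in the dual
  frame, just as the \<open>\<phi> b x\<close> in \<open>row\<close> are those of
  \<open>x\<close>.\<close>

definition dual_row :: "(nat \<Rightarrow> nat \<Rightarrow> 'l) \<Rightarrow> nat \<Rightarrow> ('v \<Rightarrow> 'k) \<Rightarrow> 'l" where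
  "dual_row \<beta> i f = (\<Sum>b\<in>{1..d}. \<beta> i b * \<kappa> (f (u b)))"

lemma row_functional: "functional V (row \<alpha> i)"
  unfolding row_def
  by (intro functional_sum functional_form dual_functional[OF frame_dual_closed[OF frame]])

lemma dual_row_functional: "functional D (dual_row \<beta> i)"
  unfolding dual_row_def
proof (intro functional_sum functional_form)
  fix b assume "b \<in> {1..d}"
  from frame_closed[OF frame this] show "form.functional D (\<lambda>f. f (u b))"
    by (simp add: form.functional_def)
qed

lemma row_frame: "b \<in> {1..d} \<Longrightarrow> row \<alpha> i (u b) = \<alpha> i b"
proof -
  assume b: "b \<in> {1..d}"
  have "row \<alpha> i (u b) = (\<Sum>c\<in>{1..d}. if c = b then \<alpha> i c else 0)"
    unfolding row_def by (rule sum.cong[OF refl]) (simp add: frame_delta[OF frame _ b])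
  then show ?thesis using b by simp
qed

lemma dual_row_frame: "b \<in> {1..d} \<Longrightarrow> dual_row \<beta> i (\<phi> b) = \<beta> i b"
proof -
  assume b: "b \<in> {1..d}"
  have "dual_row \<beta> i (\<phi> b) = (\<Sum>c\<in>{1..d}. if c = b then \<beta> i c else 0)"
    unfolding dual_row_def by (rule sum.cong[OF refl]) (auto simp: frame_delta[OF frame b])
  then show ?thesis using b by simp
qed

text \<open>Passing from \<open>u\<close> to \<open>z\<close> changes the two matrices by base
  changes that are inverse transposes of each other. So the values on \<open>z\<close> and on
  \<open>\<zeta>\<close> again form a dual pair.\<close>

lemma row_pairing:
  assumes F: "frame G d V z \<zeta>" and \<alpha>\<beta>: "dual_matrices d \<alpha> \<beta>" and ij: "i \<in> {1..d}" "j \<in> {1..d}"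
  shows "(\<Sum>b\<in>{1..d}. row \<alpha> i (z b) * dual_row \<beta> j (\<zeta> b)) = (if i = j then 1 else 0)"
proof -
  have "(\<Sum>b\<in>{1..d}. row \<alpha> i (z b) * dual_row \<beta> j (\<zeta> b)) =
      (\<Sum>b\<in>{1..d}. \<Sum>c\<in>{1..d}. \<beta> j c * (row \<alpha> i (z b) * \<kappa> (\<zeta> b (u c))))"
    unfolding dual_row_def by (simp add: sum_distrib_left mult.left_commute)
  also have "\<dots> = (\<Sum>c\<in>{1..d}. \<beta> j c * (\<Sum>b\<in>{1..d}. row \<alpha> i (z b) * \<kappa> (\<zeta> b (u c))))"
    unfolding sum_distrib_left by (rule sum.swap)
  also have "\<dots> = (\<Sum>c\<in>{1..d}. \<alpha> i c * \<beta> j c)"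
  proof (rule sum.cong[OF refl])
    fix c assume c: "c \<in> {1..d}"
    show "\<beta> j c * (\<Sum>b\<in>{1..d}. row \<alpha> i (z b) * \<kappa> (\<zeta> b (u c))) = \<alpha> i c * \<beta> j c"
      unfolding frame_expansion[OF V_kspace F row_functional frame_closed[OF frame c], symmetric]
        row_frame[OF c] by (rule mult.commute)
  qed
  also have "\<dots> = (if i = j then 1 else 0)"
    by (rule \<alpha>\<beta>[unfolded dual_matrices_def, rule_format, OF ij])
  finally show ?thesis .
qed

end

section \<open>Fillings of a shape and of its complement from one frame per column\<close>

locale framed_partition = framed_rep \<kappa> G V d u \<phi>
  for \<kappa> :: "'k::field \<Rightarrow> 'l::field" and G :: "('g, 'm) monoid_scheme" and V :: "('k, 'v, 'g) rep"
    and d :: nat and u :: "nat \<Rightarrow> 'v" and \<phi> :: "nat \<Rightarrow> 'v \<Rightarrow> 'k" +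
  fixes s :: nat and lam :: "nat list"
  assumes lam: "is_partition lam" "length lam \<le> d" "part lam 1 \<le> s"
begin

abbreviation lam' where "lam' \<equiv> complement d s lam"
abbreviation height where "height \<equiv> column_height d lam"

definition column_filling :: "(nat \<Rightarrow> nat \<Rightarrow> 'x) \<Rightarrow> nat \<times> nat \<Rightarrow> 'x" where
  "column_filling z = (\<lambda>(i, j). z j i)"

text \<open>The box \<open>(i, j)\<close> of the complement lies over the box \<open>(d + 1 - i, s + 1 - j)\<close> of the
  rectangle; the rows are rotated in the same way.\<close>

definition rotated_filling :: "(nat \<Rightarrow> nat \<Rightarrow> 'x) \<Rightarrow> nat \<times> nat \<Rightarrow> 'x" where
  "rotated_filling z = (\<lambda>(i, j). z (s + 1 - j) (d + 1 - i))"

definition rotated_row :: "(nat \<Rightarrow> nat \<Rightarrow> 'l) \<Rightarrow> nat \<Rightarrow> ('v \<Rightarrow> 'k) \<Rightarrow> 'l" where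
  "rotated_row \<beta> i = dual_row \<beta> (d + 1 - i)"

lemma rotated_row_functional: "functional D (rotated_row \<beta> i)"
  unfolding rotated_row_def by (rule dual_row_functional)

lemma young_mem: "(i, j) \<in> young lam \<Longrightarrow> i \<in> {1..height j} \<and> i \<in> {1..d} \<and> j \<in> {1..s}"
  unfolding young_columns[OF lam] using column_height_le[of d lam j] by auto

lemma young_complement_mem:
  "(i, j) \<in> young lam' \<Longrightarrow> d + 1 - i \<in> {height (s + 1 - j) + 1..d} \<and> s + 1 - j \<in> {1..s}"
  unfolding young_complement_columns[OF lam(1)] by auto

lemma column_filling_closed:
  assumes "\<And>j. j \<in> {1..s} \<Longrightarrow> z j ` {1..d} \<subseteq> A"
  shows "column_filling z \<in> young lam \<rightarrow> A"
proof (rule funcsetI)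
  fix b assume b: "b \<in> young lam"
  obtain i j where b': "b = (i, j)" by (cases b)
  from young_mem[OF b[unfolded b']] show "column_filling z b \<in> A"
    using assms[of j] unfolding b' column_filling_def by (auto simp: image_subset_iff)
qed

lemma rotated_filling_closed:
  assumes "\<And>j. j \<in> {1..s} \<Longrightarrow> z j ` {1..d} \<subseteq> A"
  shows "rotated_filling z \<in> young lam' \<rightarrow> A"
proof (rule funcsetI)
  fix b assume b: "b \<in> young lam'"
  obtain i j where b': "b = (i, j)" by (cases b)
  from young_complement_mem[OF b[unfolded b']] show "rotated_filling z b \<in> A"
    using assms[of "s + 1 - j"] unfolding b' rotated_filling_def by (auto simp: image_subset_iff)
qed

text \<open>Jacobi's theorem is applied in each column j to the values on its own frame, with
  \<open>{1..height j}\<close> as first index set. The complementary minor that remains is the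
  evaluation of column \<open>s + 1 - j\<close> of the complement.\<close>

lemma multi_val_column_filling:
  assumes F: "\<And>j. j \<in> {1..s} \<Longrightarrow> frame G d V (z j) (\<zeta> j)" and \<alpha>\<beta>: "dual_matrices d \<alpha> \<beta>"
  shows "multi_val lam (row \<alpha>) (e_gen lam V (column_filling z)) =
    multi_val lam' (rotated_row \<beta>) (e_gen lam' D (rotated_filling \<zeta>)) *
      (\<Prod>j\<in>{1..s}. ldet {1..d} (\<lambda>i b. row \<alpha> i (z j b)))"
proof -
  let ?L = "\<lambda>j. ldet {height j + 1..d} (\<lambda>i b. dual_row \<beta> i (\<zeta> j b))"
  have minor: "ldet {1..height j} (\<lambda>i b. row \<alpha> i (z j b)) =
      ldet {1..d} (\<lambda>i b. row \<alpha> i (z j b)) * ?L j" if j: "j \<in> {1..s}" for j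
  proof -
    have un: "{1..height j} \<union> {height j + 1..d} = {1..d}" using column_height_le[of d lam j] by auto
    have "ldet {1..height j} (\<lambda>i b. row \<alpha> i (z j b)) =
        ldet ({1..height j} \<union> {height j + 1..d}) (\<lambda>i b. row \<alpha> i (z j b)) * ?L j"
    proof (rule ldet_complementary_minor)
      fix i i' assume "i \<in> {1..height j} \<union> {height j + 1..d}" "i' \<in> {1..height j} \<union> {height j + 1..d}"
      then show "(\<Sum>b\<in>{1..height j} \<union> {height j + 1..d}. row \<alpha> i (z j b) * dual_row \<beta> i' (\<zeta> j b)) =
          (if i = i' then 1 else 0)"
        unfolding un by (rule row_pairing[OF F[OF j] \<alpha>\<beta>])
    qed auto
    then show ?thesis unfolding un .
  qed
  have "multi_val lam (row \<alpha>) (e_gen lam V (column_filling z)) =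
      (\<Prod>j\<in>{1..s}. ldet {1..height j} (\<lambda>i b. row \<alpha> i (column_filling z (b, j))))"
    by (rule multi_val_columns[OF V_kspace row_functional column_filling_closed[OF frame_subset[OF F]]
          young_columns[OF lam]])
  also have "\<dots> = (\<Prod>j\<in>{1..s}. ldet {1..d} (\<lambda>i b. row \<alpha> i (z j b)) * ?L j)"
    by (rule prod.cong[OF refl]) (simp only: column_filling_def prod.case minor)
  also have "\<dots> = (\<Prod>j\<in>{1..s}. ?L j) * (\<Prod>j\<in>{1..s}. ldet {1..d} (\<lambda>i b. row \<alpha> i (z j b)))"
    by (simp only: prod.distrib mult.commute)
  also have "(\<Prod>j\<in>{1..s}. ?L j) = multi_val lam' (rotated_row \<beta>) (e_gen lam' D (rotated_filling \<zeta>))"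
  proof -
    have "multi_val lam' (rotated_row \<beta>) (e_gen lam' D (rotated_filling \<zeta>)) =
        (\<Prod>j\<in>{1..s}. ldet {1..d - height (s + 1 - j)} (\<lambda>i b. rotated_row \<beta> i (rotated_filling \<zeta> (b, j))))"
      by (rule multi_val_columns[OF D_kspace rotated_row_functional
            rotated_filling_closed[OF frame_dual_subset[OF F]] young_complement_columns[OF lam(1)]])
    \<comment> \<open>The functionals and the entries are reversed by the same map
      \<open>d + 1 - i\<close>, so the reversal costs no sign.\<close>
    also have "\<dots> = (\<Prod>j\<in>{1..s}. ?L (s + 1 - j))"
      unfolding rotated_row_def rotated_filling_def prod.case
        ldet_reindex[OF complement_bij finite_atLeastAtMost] ..
    also have "\<dots> = (\<Prod>j\<in>{1..s}. ?L j)"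
      by (rule prod.reindex_bij_witness[of _ "\<lambda>j. s + 1 - j" "\<lambda>j. s + 1 - j"]) auto
    finally show ?thesis by simp
  qed
  finally show ?thesis .
qed

text \<open>A repeated entry in a column gives a minor with two equal columns. This disposes of the
  tableaux whose columns cannot be completed to frames.\<close>

lemma multi_val_repeated:
  assumes t: "t \<in> young lam \<rightarrow> {1..d}" and j: "j \<in> {1..s}"
    and ninj: "\<not> inj_on (\<lambda>i. t (i, j)) {1..height j}"
  shows "multi_val lam (row \<alpha>) (e_gen lam V (\<lambda>b. u (t b))) = 0"
proof -
  from ninj obtain i i' where i: "i \<in> {1..height j}" "i' \<in> {1..height j}" "i \<noteq> i'" "t (i, j) = t (i', j)"
    unfolding inj_on_def by blast
  have "multi_val lam (row \<alpha>) (e_gen lam V (\<lambda>b. u (t b))) =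
      (\<Prod>j\<in>{1..s}. ldet {1..height j} (\<lambda>i b. row \<alpha> i (u (t (b, j)))))"
    by (rule multi_val_columns[OF V_kspace row_functional _ young_columns[OF lam]])
      (use t frame_closed[OF frame] in \<open>simp add: Pi_iff\<close>)
  moreover have "ldet {1..height j} (\<lambda>i b. row \<alpha> i (u (t (b, j)))) = 0"
    by (rule ldet_identical_columns[OF finite_atLeastAtMost i(1-3)]) (simp add: i(4))
  ultimately show ?thesis using j by (auto simp: prod_zero_iff)
qed

lemma multi_val_repeated_dual:
  assumes t: "t \<in> young lam' \<rightarrow> {1..d}" and j: "j \<in> {1..s}"
    and ninj: "\<not> inj_on (\<lambda>i. t (i, j)) {1..d - height (s + 1 - j)}"
  shows "multi_val lam' (rotated_row \<beta>) (e_gen lam' D (\<lambda>b. \<phi> (t b))) = 0"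
proof -
  from ninj obtain i i' where i: "i \<in> {1..d - height (s + 1 - j)}" "i' \<in> {1..d - height (s + 1 - j)}"
    "i \<noteq> i'" "t (i, j) = t (i', j)"
    unfolding inj_on_def by blast
  have "multi_val lam' (rotated_row \<beta>) (e_gen lam' D (\<lambda>b. \<phi> (t b))) =
      (\<Prod>j\<in>{1..s}. ldet {1..d - height (s + 1 - j)} (\<lambda>i b. rotated_row \<beta> i (\<phi> (t (b, j)))))"
    by (rule multi_val_columns[OF D_kspace rotated_row_functional _ young_complement_columns[OF lam(1)]])
      (use t frame_dual_closed[OF frame] in \<open>simp add: Pi_iff\<close>)
  moreover have "ldet {1..d - height (s + 1 - j)} (\<lambda>i b. rotated_row \<beta> i (\<phi> (t (b, j)))) = 0"
    by (rule ldet_identical_columns[OF finite_atLeastAtMost i(1-3)]) (simp add: i(4))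
  ultimately show ?thesis using j by (auto simp: prod_zero_iff)
qed

text \<open>Each column is completed to a permuted frame on its own. Below the boxes of the column
  the completion is arbitrary, because any frame extending the column is matched correctly.\<close>

lemma tableau_frames:
  assumes t: "t \<in> young lam \<rightarrow> {1..d}"
    and inj: "\<And>j. j \<in> {1..s} \<Longrightarrow> inj_on (\<lambda>i. t (i, j)) {1..height j}"
  obtains z \<zeta> where "\<And>j. j \<in> {1..s} \<Longrightarrow> frame G d V (z j) (\<zeta> j)"
    "\<And>b. b \<in> young lam \<Longrightarrow> u (t b) = column_filling z b"
proof -
  have "\<exists>p. p permutes {1..d} \<and> (\<forall>i\<in>{1..height j}. p i = t (i, j))" if j: "j \<in> {1..s}" for j
  proof -
    have sub: "{1..height j} \<subseteq> {1..d}" using column_height_le[of d lam j] by auto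
    have im: "(\<lambda>i. t (i, j)) ` {1..height j} \<subseteq> {1..d}"
    proof (rule image_subsetI)
      fix i assume "i \<in> {1..height j}"
      then have "(i, j) \<in> young lam" using j unfolding young_columns[OF lam] by auto
      then show "t (i, j) \<in> {1..d}" by (rule funcset_mem[OF t])
    qed
    show ?thesis
      by (rule extend_to_permutation[OF sub finite_atLeastAtMost inj[OF j] im])
        (rule exI, intro conjI ballI)
  qed
  then obtain p where p: "\<And>j. j \<in> {1..s} \<Longrightarrow> p j permutes {1..d}"
    "\<And>i j. j \<in> {1..s} \<Longrightarrow> i \<in> {1..height j} \<Longrightarrow> p j i = t (i, j)" by metis
  show ?thesis
  proof (rule that)
    show "frame G d V (\<lambda>b. u (p j b)) (\<lambda>b. \<phi> (p j b))" if "j \<in> {1..s}" for j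
      by (rule frame_permute[OF frame p(1)[OF that]])
    fix b assume b: "b \<in> young lam"
    obtain i j where b': "b = (i, j)" by (cases b)
    from young_mem[OF b[unfolded b']] p(2)[of j i]
    show "u (t b) = column_filling (\<lambda>j b. u (p j b)) b" by (simp add: column_filling_def b')
  qed
qed

lemma dual_tableau_frames:
  assumes t: "t \<in> young lam' \<rightarrow> {1..d}"
    and inj: "\<And>j. j \<in> {1..s} \<Longrightarrow> inj_on (\<lambda>i. t (i, j)) {1..d - height (s + 1 - j)}"
  obtains z \<zeta> where "\<And>j. j \<in> {1..s} \<Longrightarrow> frame G d V (z j) (\<zeta> j)"
    "\<And>b. b \<in> young lam' \<Longrightarrow> \<phi> (t b) = rotated_filling \<zeta> b"
proof -
  have "\<exists>p. p permutes {1..d} \<and> (\<forall>i\<in>{1..d - height (s + 1 - j)}. p i = t (i, j))"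
    if j: "j \<in> {1..s}" for j
  proof -
    have sub: "{1..d - height (s + 1 - j)} \<subseteq> {1..d}" by auto
    have im: "(\<lambda>i. t (i, j)) ` {1..d - height (s + 1 - j)} \<subseteq> {1..d}"
    proof (rule image_subsetI)
      fix i assume "i \<in> {1..d - height (s + 1 - j)}"
      then have "(i, j) \<in> young lam'" using j unfolding young_complement_columns[OF lam(1)] by auto
      then show "t (i, j) \<in> {1..d}" by (rule funcset_mem[OF t])
    qed
    show ?thesis
      by (rule extend_to_permutation[OF sub finite_atLeastAtMost inj[OF j] im])
        (rule exI, intro conjI ballI)
  qed
  then obtain p where p: "\<And>j. j \<in> {1..s} \<Longrightarrow> p j permutes {1..d}"
    "\<And>i j. j \<in> {1..s} \<Longrightarrow> i \<in> {1..d - height (s + 1 - j)} \<Longrightarrow> p j i = t (i, j)" by metis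
  \<comment> \<open>A rotated filling reads the dual frame from its end. Composing with this
    reversal puts the prescribed entries there, in the right order.\<close>
  let ?r = "\<lambda>i. if i \<in> {1..d} then d + 1 - i else i"
  have "bij_betw ?r {1..d} {1..d}"
    by (rule bij_betw_byWitness[of _ ?r]) auto
  then have r: "?r permutes {1..d}" by (rule bij_imp_permutes) auto
  show ?thesis
  proof (rule that)
    show "frame G d V (\<lambda>b. u (p (s + 1 - j) (?r b))) (\<lambda>b. \<phi> (p (s + 1 - j) (?r b)))" if "j \<in> {1..s}" for j
      by (rule frame_permute[OF frame_permute[OF frame p(1)] r]) (use that in auto)
    fix b assume b: "b \<in> young lam'"
    obtain i j where b': "b = (i, j)" by (cases b)
    from b have ij: "j \<in> {1..s}" "i \<in> {1..d - height (s + 1 - j)}"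
      unfolding b' young_complement_columns[OF lam(1)] by auto
    then have "?r (d + 1 - i) = i" "s + 1 - (s + 1 - j) = j" by auto
    then show "\<phi> (t b) = rotated_filling (\<lambda>j b. \<phi> (p (s + 1 - j) (?r b))) b"
      unfolding rotated_filling_def b' prod.case using p(2)[OF ij] by (simp only:)
  qed
qed

end

subsection \<open>The Schur functors of a shape and of its complement\<close>

lemma schur_simps [simp]:
  "\<zero>\<^bsub>schur lam V B v\<^esub> = \<zero>\<^bsub>sym_multi lam V\<^esub>"
  "x \<oplus>\<^bsub>schur lam V B v\<^esub> y = x \<oplus>\<^bsub>sym_multi lam V\<^esub> y"
  "a \<odot>\<^bsub>schur lam V B v\<^esub> x = a \<odot>\<^bsub>sym_multi lam V\<^esub> x"
  "act (schur lam V B v) g x = act (sym_multi lam V) g x"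
  by (simp_all add: schur_def)

lemma
  fixes V :: "('k::field, 'v, 'g) rep"
  assumes V: "kspace V" and F: "frame G d V u \<phi>"
    and v: "v ` B \<subseteq> carrier V" "vs_span V (v ` B) = carrier V"
  shows schur_subset: "carrier (schur lam V B v) \<subseteq> carrier (sym_multi lam V)"
    and schur_e_gen: "x \<in> young lam \<rightarrow> carrier V \<Longrightarrow> e_gen lam V x \<in> carrier (schur lam V B v)"
proof -
  interpret kspace_rep V using V by (simp add: kspace_rep_def)
  interpret M: kspace "sym_multi lam V" by (rule multi_kspace)
  let ?C = "e_gen lam V ` (young lam \<rightarrow> carrier V)"
  have C: "?C \<subseteq> carrier (sym_multi lam V)" using e_gen_closed by blast
  have eq: "carrier (schur lam V B v) = vs_span (sym_multi lam V) ?C"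
    unfolding schur_eq[OF V F v] by simp
  show "carrier (schur lam V B v) \<subseteq> carrier (sym_multi lam V)"
    unfolding eq by (rule subsetI) (rule M.span_closed[OF C])
  show "e_gen lam V x \<in> carrier (schur lam V B v)" if "x \<in> young lam \<rightarrow> carrier V"
    unfolding eq by (rule M.span_base[OF C imageI[OF that]])
qed

lemma (in scalar_extension) functional_schur:
  assumes f: "functional (sym_multi lam V) f"
    and sub: "carrier (schur lam V B v) \<subseteq> carrier (sym_multi lam V)"
  shows "functional (schur lam V B v) f"
  unfolding functional_def schur_simps
  using functional_add[OF f] functional_smult[OF f] subsetD[OF sub] by blast

locale schur_complement = framed_partition generic_scalar G V d u \<phi> s lam
  for G :: "('g, 'm) monoid_scheme" and V :: "('k::field, 'v, 'g) rep"
    and d :: nat and u :: "nat \<Rightarrow> 'v" and \<phi> :: "nat \<Rightarrow> 'v \<Rightarrow> 'k" and s :: nat and lam :: "nat list" +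
  fixes B B' :: "nat set" and v :: "nat \<Rightarrow> 'v" and w :: "nat \<Rightarrow> 'v \<Rightarrow> 'k"
  assumes v: "v ` B \<subseteq> carrier V" "vs_span V (v ` B) = carrier V"
    and w: "w ` B' \<subseteq> carrier (dual_rep G V)" "vs_span (dual_rep G V) (w ` B') = carrier (dual_rep G V)"
begin

abbreviation X where "X \<equiv> schur lam V B v"
abbreviation X' where "X' \<equiv> schur lam' D B' w"
abbreviation L where "L \<equiv> tensor_power s (ext_power d V)"
abbreviation Y where "Y \<equiv> tensor_prod X' L"

lemmas X_rep = schur_representation[OF group rep frame v]
lemmas X'_rep = schur_representation[OF group D_rep dual_frame w]
lemmas L_rep = power_representation[OF group ext_representation[OF group rep]]
lemmas Y_rep = tensor_prod_representation[OF X'_rep L_rep]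
lemmas X_subset = schur_subset[OF V_kspace frame v]
lemmas X'_subset = schur_subset[OF D_kspace dual_frame w]
lemmas e_gen_X = schur_e_gen[OF V_kspace frame v]
lemmas e_gen_X' = schur_e_gen[OF D_kspace dual_frame w]

lemma X'_L: "kspace_pair X' L"
  by (rule kspace_pair.intro[OF representation_kspace[OF X'_rep] representation_kspace[OF L_rep]])

definition left_val :: "(nat \<Rightarrow> nat \<Rightarrow> 'k generic_field) \<Rightarrow>
    (('v list \<Rightarrow>\<^sub>0 'k) set set list \<Rightarrow>\<^sub>0 'k) set \<Rightarrow> 'k generic_field" where
  "left_val \<alpha> = multi_val lam (row \<alpha>)"

definition right_val where
  "right_val \<alpha> \<beta> = coset_val (free_val
    (\<lambda>(y, \<tau>). multi_val lam' (rotated_row \<beta>) y * det_power_val d s (row \<alpha>) \<tau>))"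

lemma left_val_functional: "functional X (left_val \<alpha>)"
  unfolding left_val_def
  by (rule functional_schur[OF multi_val_functional[OF V_kspace row_functional] X_subset])

lemma complement_val_functional: "functional X' (multi_val lam' (rotated_row \<beta>))"
  by (rule functional_schur[OF multi_val_functional[OF D_kspace rotated_row_functional] X'_subset])

lemma right_val_bilinear:
  "bilinear X' L (\<lambda>(y, \<tau>). multi_val lam' (rotated_row \<beta>) y * det_power_val d s (row \<alpha>) \<tau>)"
proof -
  have l: "functional X' (\<lambda>y. multi_val lam' (rotated_row \<beta>) y * c)" for c
    using complement_val_functional[of \<beta>] by (simp add: functional_def distrib_right mult.assoc)
  have r: "functional L (\<lambda>\<tau>. c * det_power_val d s (row \<alpha>) \<tau>)" for c
  proof -
    have "functional L (det_power_val d s (row \<alpha>))"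
      by (rule det_power_val_functional[OF V_kspace row_functional])
    then show ?thesis by (simp add: functional_def distrib_left mult.left_commute)
  qed
  show ?thesis unfolding bilinear_def prod.case using l r by blast
qed

lemma right_val_functional: "functional Y (right_val \<alpha> \<beta>)"
  unfolding right_val_def by (rule pair_val_functional[OF X'_L right_val_bilinear])

lemma right_val_pair:
  assumes "y \<in> carrier X'" "\<tau> \<in> carrier L"
  shows "right_val \<alpha> \<beta> (pure_pair X' L y \<tau>) =
    multi_val lam' (rotated_row \<beta>) y * det_power_val d s (row \<alpha>) \<tau>"
  unfolding right_val_def pair_val_pure[OF X'_L right_val_bilinear assms] prod.case ..

lemma matching:
  assumes F: "\<And>j. j \<in> {1..s} \<Longrightarrow> frame G d V (z j) (\<zeta> j)"
  defines "x \<equiv> e_gen lam V (column_filling z)" and "y \<equiv> e_gen lam' D (rotated_filling \<zeta>)"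
    and "\<tau> \<equiv> volumes V d s z"
  shows "x \<in> carrier X" "y \<in> carrier X'" "\<tau> \<in> carrier L"
    and "dual_matrices d \<alpha> \<beta> \<Longrightarrow> left_val \<alpha> x = right_val \<alpha> \<beta> (pure_pair X' L y \<tau>)"
proof -
  show "x \<in> carrier X" unfolding x_def
    by (rule e_gen_X[OF column_filling_closed[OF frame_subset[OF F]]])
  show y: "y \<in> carrier X'" unfolding y_def
    by (rule e_gen_X'[OF rotated_filling_closed[OF frame_dual_subset[OF F]]])
  show \<tau>: "\<tau> \<in> carrier L" unfolding \<tau>_def by (rule volumes_closed[OF V_kspace frame_subset[OF F]])
  assume \<alpha>\<beta>: "dual_matrices d \<alpha> \<beta>"
  have det: "det_power_val d s (row \<alpha>) \<tau> = (\<Prod>j\<in>{1..s}. ldet {1..d} (\<lambda>i b. row \<alpha> i (z j b)))"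
    unfolding \<tau>_def by (rule det_power_val_volumes[OF V_kspace row_functional frame_subset[OF F]])
  show "left_val \<alpha> x = right_val \<alpha> \<beta> (pure_pair X' L y \<tau>)"
    unfolding right_val_pair[OF y \<tau>] det unfolding left_val_def x_def y_def
    by (rule multi_val_column_filling[OF F \<alpha>\<beta>])
qed

text \<open>One pair is enough, that with \<open>\<alpha>\<close> the generic matrix; its partner
  exists because the generic determinant is nonzero.\<close>

lemma left_separates:
  assumes x: "x \<in> carrier X" and zero: "\<And>\<alpha> \<beta>. dual_matrices d \<alpha> \<beta> \<Longrightarrow> left_val \<alpha> x = 0"
  shows "x = \<zero>\<^bsub>X\<^esub>"
proof -
  obtain \<beta> where "dual_matrices d generic_entry (\<beta> :: nat \<Rightarrow> nat \<Rightarrow> 'k generic_field)"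
    by (rule dual_matrices_exist[OF generic_det_nonzero])
  from zero[OF this] have "multi_val lam (row generic_entry) x = 0" unfolding left_val_def .
  from generic_separates[OF V_kspace row_functional frame_subset[OF frame] frame_span[OF frame]
      row_frame subsetD[OF X_subset x] this]
  show ?thesis unfolding schur_simps .
qed

text \<open>Since \<open>L\<close> is a line, every element of \<open>Y\<close> is a pure pair with
  a fixed second factor. The value of that factor is a nonzero power of a determinant and can be
  cancelled; the first factor is then separated by the pair with generic
  \<open>\<beta>\<close>.\<close>

lemma right_separates:
  assumes y: "y \<in> carrier Y" and zero: "\<And>\<alpha> \<beta>. dual_matrices d \<alpha> \<beta> \<Longrightarrow> right_val \<alpha> \<beta> y = 0"
  shows "y = \<zero>\<^bsub>Y\<^esub>"
proof -
  interpret P: kspace_pair X' L by (rule X'_L)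
  interpret Y: kspace Y by (rule representation_kspace[OF Y_rep])
  let ?\<tau> = "volumes V d s (\<lambda>j. u)"
  have \<tau>: "?\<tau> \<in> carrier L" by (rule volumes_closed[OF V_kspace frame_subset[OF frame]])
  note hom = P.pure_pair_hom_left[OF \<tau>]
  have X'_span: "vs_span X' (carrier X') = carrier X'"
    using P.V.span_closed[OF subset_refl] P.V.span_base[OF subset_refl] by blast
  \<comment> \<open>Pure pairs with second factor \<open>?\<tau>\<close> are closed under addition
    and scaling, so they contain everything that they span, which is all of
    \<open>Y\<close>.\<close>
  have image: "submodule class_ring ((\<lambda>x. pure_pair X' L x ?\<tau>) ` carrier X') Y"
  proof (rule Y.submoduleI)
    show "(\<lambda>x. pure_pair X' L x ?\<tau>) ` carrier X' \<subseteq> carrier Y"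
      by (rule image_subsetI) (rule hom_k_closed[OF hom])
    show "\<zero>\<^bsub>Y\<^esub> \<in> (\<lambda>x. pure_pair X' L x ?\<tau>) ` carrier X'"
      using imageI[OF P.V.zero_closed, of "\<lambda>x. pure_pair X' L x ?\<tau>"]
      by (simp only: P.V.hom_zero[OF Y.kspace_axioms hom])
  next
    fix p q assume "p \<in> (\<lambda>x. pure_pair X' L x ?\<tau>) ` carrier X'" "q \<in> (\<lambda>x. pure_pair X' L x ?\<tau>) ` carrier X'"
    then obtain x x' where x: "x \<in> carrier X'" "x' \<in> carrier X'"
      "p = pure_pair X' L x ?\<tau>" "q = pure_pair X' L x' ?\<tau>" by blast
    show "p \<oplus>\<^bsub>Y\<^esub> q \<in> (\<lambda>x. pure_pair X' L x ?\<tau>) ` carrier X'"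
      unfolding x(3,4) hom_k_add[OF hom x(1,2), symmetric] by (rule imageI[OF P.V.a_closed[OF x(1,2)]])
  next
    fix p a assume "p \<in> (\<lambda>x. pure_pair X' L x ?\<tau>) ` carrier X'"
    then obtain x where x: "x \<in> carrier X'" "p = pure_pair X' L x ?\<tau>" by blast
    show "a \<odot>\<^bsub>Y\<^esub> p \<in> (\<lambda>x. pure_pair X' L x ?\<tau>) ` carrier X'"
      unfolding x(2) hom_k_smult[OF hom x(1), symmetric] by (rule imageI[OF P.V.smult_closed'[OF x(1)]])
  qed
  have "carrier Y = vs_span Y {pure_pair X' L x \<tau> | x \<tau>. x \<in> carrier X' \<and> \<tau> \<in> {?\<tau>}}"
    by (rule P.pair_span[symmetric, OF subset_refl X'_span _
          volumes_span[OF V_kspace, where z = "\<lambda>j. u" and \<zeta> = "\<lambda>j. \<phi>", OF frame]])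
      (use \<tau> in blast)
  also have "\<dots> \<subseteq> (\<lambda>x. pure_pair X' L x ?\<tau>) ` carrier X'"
    by (rule Y.span_minimal[OF image]) blast
  finally obtain x where x: "x \<in> carrier X'" "y = pure_pair X' L x ?\<tau>" using y by blast
  \<comment> \<open>The reversal of the rows undoes the one in \<open>rotated_row\<close>, and the
    reversal of the columns is matched by listing the dual frame backwards. The resulting values are
    the generic entries themselves.\<close>
  let ?\<beta> = "\<lambda>i b. generic_entry (d + 1 - i) (d + 1 - b) :: 'k generic_field"
  have "bij_betw (\<lambda>i. d + 1 - i) {1..d} {1..d}"
    using complement_bij[of d 0] by (simp del: One_nat_def)
  then have "ldet {1..d} ?\<beta> = ldet {1..d} generic_entry"
    by (rule ldet_reindex[OF _ finite_atLeastAtMost, symmetric])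
  with generic_det_nonzero have "ldet {1..d} ?\<beta> \<noteq> 0" by (rule back_subst[of "\<lambda>x. x \<noteq> 0", OF _ sym])
  then obtain \<alpha> where "dual_matrices d ?\<beta> \<alpha>" by (rule dual_matrices_exist)
  then have \<alpha>\<beta>: "dual_matrices d \<alpha> ?\<beta>" by (rule dual_matrices_sym)
  have "det_power_val d s (row \<alpha>) ?\<tau> = (\<Prod>j\<in>{1..s}. ldet {1..d} (\<lambda>i b. row \<alpha> i (u b)))"
    by (rule det_power_val_volumes[OF V_kspace row_functional frame_subset[OF frame]])
  also have "ldet {1..d} (\<lambda>i b. row \<alpha> i (u b)) = ldet {1..d} \<alpha>"
    by (rule ldet_cong) (rule row_frame)
  finally have nz: "det_power_val d s (row \<alpha>) ?\<tau> \<noteq> 0"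
    using dual_matrices_det[OF \<alpha>\<beta>] by simp
  have val: "multi_val lam' (rotated_row ?\<beta>) x = 0"
    using zero[OF \<alpha>\<beta>] nz unfolding x(2) right_val_pair[OF x(1) \<tau>] by (simp only: mult_eq_0_iff simp_thms)
  have x0: "x = \<zero>\<^bsub>X'\<^esub>"
    unfolding schur_simps
  proof (rule generic_separates[OF D_kspace rotated_row_functional _ _ _ subsetD[OF X'_subset x(1)] val])
    have im: "(\<lambda>b. \<phi> (d + 1 - b)) ` {1..d} = \<phi> ` {1..d}"
      using bij_betw_imp_surj_on[OF \<open>bij_betw (\<lambda>i. d + 1 - i) {1..d} {1..d}\<close>]
      by (metis image_image)
    show "(\<lambda>b. \<phi> (d + 1 - b)) ` {1..d} \<subseteq> carrier D" unfolding im by (rule frame_dual_subset[OF frame])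
    show "vs_span D ((\<lambda>b. \<phi> (d + 1 - b)) ` {1..d}) = carrier D"
      unfolding im by (rule frame_dual_span[OF V_kspace frame])
    fix i b assume i: "i \<in> {1..length lam'}" and b: "b \<in> {1..d}"
    have "d + 1 - (d + 1 - i) = i" "d + 1 - (d + 1 - b) = b" "d + 1 - b \<in> {1..d}"
      using i b length_complement[of d s lam] by auto
    then show "rotated_row ?\<beta> i (\<phi> (d + 1 - b)) = generic_entry i b"
      unfolding rotated_row_def by (simp only: dual_row_frame)
  qed
  show ?thesis unfolding x(2) x0
    by (rule P.V.hom_zero[OF Y.kspace_axioms hom])
qed

lemma left_match:
  assumes x: "x \<in> e_gen lam V ` (young lam \<rightarrow> u ` {1..d})"
  shows "\<exists>y\<in>carrier Y. (\<forall>\<alpha> \<beta>. dual_matrices d \<alpha> \<beta> \<longrightarrow> left_val \<alpha> x = right_val \<alpha> \<beta> y) \<and>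
    (\<forall>g\<in>carrier G. \<forall>\<alpha> \<beta>. dual_matrices d \<alpha> \<beta> \<longrightarrow> left_val \<alpha> (act X g x) = right_val \<alpha> \<beta> (act Y g y))"
proof -
  interpret Vs: kspace_rep V using V_kspace by (simp add: kspace_rep_def)
  interpret X: kspace X by (rule representation_kspace[OF X_rep])
  interpret Y: kspace Y by (rule representation_kspace[OF Y_rep])
  from x obtain f where f: "f \<in> young lam \<rightarrow> u ` {1..d}" "x = e_gen lam V f" by blast
  have "\<forall>b\<in>young lam. \<exists>c. c \<in> {1..d} \<and> u c = f b" 
    by (intro ballI, drule funcset_mem[OF f(1)], elim imageE) (rule exI, rule conjI, assumption, erule sym)
  then obtain t where t: "\<And>b. b \<in> young lam \<Longrightarrow> t b \<in> {1..d} \<and> u (t b) = f b" by metis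
  have t_mem: "t \<in> young lam \<rightarrow> {1..d}" using t by blast
  have ut: "(\<lambda>b. u (t b)) \<in> young lam \<rightarrow> carrier V" using t_mem frame_closed[OF frame] by (simp add: Pi_iff)
  have x_t: "x = e_gen lam V (\<lambda>b. u (t b))"
    unfolding f(2) by (rule Vs.e_gen_cong[OF ut]) (use t in simp)
  show ?thesis
  \<comment> \<open>If every column has distinct entries, the columns extend to frames, which
    provide the partner. Otherwise the element is zero.\<close>
  proof (cases "\<forall>j\<in>{1..s}. inj_on (\<lambda>i. t (i, j)) {1..height j}")
    case True
    show ?thesis
    proof (rule tableau_frames[OF t_mem])
      show "inj_on (\<lambda>i. t (i, j)) {1..height j}" if "j \<in> {1..s}" for j
        by (rule bspec[OF True that])
      fix z \<zeta>
      assume F: "\<And>j. j \<in> {1..s} \<Longrightarrow> frame G d V (z j) (\<zeta> j)"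
        and eq: "\<And>b. b \<in> young lam \<Longrightarrow> u (t b) = column_filling z b"
      have zc: "column_filling z \<in> young lam \<rightarrow> carrier V"
        by (rule column_filling_closed[OF frame_subset[OF F]])
      have \<zeta>c: "rotated_filling \<zeta> \<in> young lam' \<rightarrow> carrier D"
        by (rule rotated_filling_closed[OF frame_dual_subset[OF F]])
      have x_z: "x = e_gen lam V (column_filling z)"
        unfolding x_t by (rule Vs.e_gen_cong[OF zc eq])
      have M: "e_gen lam V (column_filling z) \<in> carrier X"
        "e_gen lam' D (rotated_filling \<zeta>) \<in> carrier X'" "volumes V d s z \<in> carrier L"
        by (rule matching[OF F], assumption)+
      have M4: "left_val \<alpha> (e_gen lam V (column_filling z)) =
          right_val \<alpha> \<beta> (pure_pair X' L (e_gen lam' D (rotated_filling \<zeta>)) (volumes V d s z))"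
        if "dual_matrices d \<alpha> \<beta>" for \<alpha> \<beta> by (rule matching(4)[OF F that])
      let ?y = "pure_pair X' L (e_gen lam' D (rotated_filling \<zeta>)) (volumes V d s z)"
      have y: "?y \<in> carrier Y" by (rule kspace_pair.pure_pair_closed[OF X'_L M(2,3)])
      \<comment> \<open>The translates of the frames are frames with the translated dual frames, so
        the identity for \<open>x\<close> applies verbatim to its image.\<close>
      have "left_val \<alpha> (act X g x) = right_val \<alpha> \<beta> (act Y g ?y)"
        if g: "g \<in> carrier G" and \<alpha>\<beta>: "dual_matrices d \<alpha> \<beta>" for g \<alpha> \<beta>
      proof -
        have F': "frame G d V ((\<lambda>j b. act V g (z j b)) j) ((\<lambda>j b. act D g (\<zeta> j b)) j)"
          if "j \<in> {1..s}" for j by (rule frame_act[OF rep F[OF that] g])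
        have 1: "act X g x = e_gen lam V (column_filling (\<lambda>j b. act V g (z j b)))"
          unfolding schur_simps x_z act_e_gen[OF group rep g zc]
          by (simp add: column_filling_def case_prod_unfold)
        have 2: "act Y g ?y = pure_pair X' L
            (e_gen lam' D (rotated_filling (\<lambda>j b. act D g (\<zeta> j b)))) (volumes V d s (\<lambda>j b. act V g (z j b)))"
        proof -
          have "act L g (volumes V d s z) = volumes V d s (\<lambda>j b. act V g (z j b))"
            by (rule act_volumes[OF group rep g frame_subset[OF F]])
          then show ?thesis
            unfolding act_pure_pair[OF X'_rep L_rep g M(2,3)] schur_simps act_e_gen[OF group D_rep g \<zeta>c]
            by (simp only: rotated_filling_def case_prod_unfold)
        qed
        show ?thesis unfolding 1 2 by (rule matching(4)[OF F' \<alpha>\<beta>])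
      qed
      then show ?thesis using y M4 unfolding x_z[symmetric] by blast
    qed
  next
    case False
    then obtain j where j: "j \<in> {1..s}" "\<not> inj_on (\<lambda>i. t (i, j)) {1..height j}" by blast
    have xX: "x \<in> carrier X" unfolding x_t by (rule e_gen_X[OF ut])
    \<comment> \<open>All its evaluations vanish. Knowing that \<open>x\<close> itself is zero, and
      not merely its values, is what controls its images under the group.\<close>
    have "x = \<zero>\<^bsub>X\<^esub>"
      by (rule left_separates[OF xX]) (unfold left_val_def x_t, rule multi_val_repeated[OF t_mem j])
    have "act X g x = \<zero>\<^bsub>X\<^esub>" if "g \<in> carrier G" for g
      unfolding \<open>x = \<zero>\<^bsub>X\<^esub>\<close>
      by (rule X.hom_zero[OF X.kspace_axioms representation.act_linear[OF X_rep that]])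
    moreover have "act Y g \<zero>\<^bsub>Y\<^esub> = \<zero>\<^bsub>Y\<^esub>" if "g \<in> carrier G" for g
      by (rule Y.hom_zero[OF Y.kspace_axioms representation.act_linear[OF Y_rep that]])
    moreover have "left_val \<alpha> \<zero>\<^bsub>X\<^esub> = 0" "right_val \<alpha> \<beta> \<zero>\<^bsub>Y\<^esub> = 0" for \<alpha> \<beta>
      by (rule functional_zero[OF X.kspace_axioms left_val_functional],
          rule functional_zero[OF Y.kspace_axioms right_val_functional])
    ultimately show ?thesis
      by (intro bexI[OF _ Y.zero_closed]) (simp only: \<open>x = \<zero>\<^bsub>X\<^esub>\<close> refl simp_thms ball_triv if_True, simp)
  qed
qed

lemma right_match:
  assumes y: "y \<in> {pure_pair X' L y \<tau> | y \<tau>. y \<in> e_gen lam' D ` (young lam' \<rightarrow> \<phi> ` {1..d}) \<and> \<tau> \<in> carrier L}"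
  shows "\<exists>x\<in>carrier X. \<forall>\<alpha> \<beta>. dual_matrices d \<alpha> \<beta> \<longrightarrow> left_val \<alpha> x = right_val \<alpha> \<beta> y"
proof -
  interpret Ds: kspace_rep D using D_kspace by (simp add: kspace_rep_def)
  interpret X: kspace X by (rule representation_kspace[OF X_rep])
  interpret L: kspace L by (rule representation_kspace[OF L_rep])
  from y obtain f \<tau> where f: "f \<in> young lam' \<rightarrow> \<phi> ` {1..d}" "y = pure_pair X' L (e_gen lam' D f) \<tau>"
    and \<tau>: "\<tau> \<in> carrier L" by blast
  have "\<forall>b\<in>young lam'. \<exists>c. c \<in> {1..d} \<and> \<phi> c = f b" 
    by (intro ballI, drule funcset_mem[OF f(1)], elim imageE) (rule exI, rule conjI, assumption, erule sym)
  then obtain t where t: "\<And>b. b \<in> young lam' \<Longrightarrow> t b \<in> {1..d} \<and> \<phi> (t b) = f b" by metis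
  have t_mem: "t \<in> young lam' \<rightarrow> {1..d}" using t by blast
  have \<phi>t: "(\<lambda>b. \<phi> (t b)) \<in> young lam' \<rightarrow> carrier D"
    using t_mem frame_dual_closed[OF frame] by (simp add: Pi_iff)
  have y_t: "y = pure_pair X' L (e_gen lam' D (\<lambda>b. \<phi> (t b))) \<tau>"
    unfolding f(2) by (rule arg_cong[OF Ds.e_gen_cong[OF \<phi>t]]) (use t in simp)
  show ?thesis
  proof (cases "\<forall>j\<in>{1..s}. inj_on (\<lambda>i. t (i, j)) {1..d - height (s + 1 - j)}")
    case True
    show ?thesis
    proof (rule dual_tableau_frames[OF t_mem])
      show "inj_on (\<lambda>i. t (i, j)) {1..d - height (s + 1 - j)}" if "j \<in> {1..s}" for j
        by (rule bspec[OF True that])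
      fix z \<zeta>
      assume F: "\<And>j. j \<in> {1..s} \<Longrightarrow> frame G d V (z j) (\<zeta> j)"
        and eq: "\<And>b. b \<in> young lam' \<Longrightarrow> \<phi> (t b) = rotated_filling \<zeta> b"
      have M: "e_gen lam V (column_filling z) \<in> carrier X"
        "e_gen lam' D (rotated_filling \<zeta>) \<in> carrier X'" "volumes V d s z \<in> carrier L"
        by (rule matching[OF F], assumption)+
      have M4: "left_val \<alpha> (e_gen lam V (column_filling z)) =
          right_val \<alpha> \<beta> (pure_pair X' L (e_gen lam' D (rotated_filling \<zeta>)) (volumes V d s z))"
        if "dual_matrices d \<alpha> \<beta>" for \<alpha> \<beta> by (rule matching(4)[OF F that])
      have e: "e_gen lam' D (\<lambda>b. \<phi> (t b)) = e_gen lam' D (rotated_filling \<zeta>)"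
        by (rule Ds.e_gen_cong[OF rotated_filling_closed[OF frame_dual_subset[OF F]] eq])
      \<comment> \<open>The volume element depends on the frames found for the tableau, but any
        \<open>\<tau>\<close> is a multiple of it.\<close>
      have "vs_span L {volumes V d s z} = carrier L" by (rule volumes_span[OF V_kspace F])
      with \<tau> have "\<tau> \<in> vs_span L {volumes V d s z}" by (simp only:)
      then obtain c where c: "\<tau> = c \<odot>\<^bsub>L\<^esub> volumes V d s z" by (rule L.span_singleton[OF _ M(3)])
      have "left_val \<alpha> (c \<odot>\<^bsub>X\<^esub> e_gen lam V (column_filling z)) = right_val \<alpha> \<beta> y"
        if \<alpha>\<beta>: "dual_matrices d \<alpha> \<beta>" for \<alpha> \<beta>
        unfolding functional_smult[OF left_val_functional M(1)] M4[OF \<alpha>\<beta>] y_t e c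
          right_val_pair[OF M(2,3)] right_val_pair[OF M(2) L.smult_closed'[OF M(3)]]
          functional_smult[OF det_power_val_functional[OF V_kspace row_functional] M(3)]
        by (rule mult.left_commute)
      then show ?thesis by (intro bexI[OF _ X.smult_closed'[OF M(1)]]) blast
    qed
  next
    case False
    then obtain j where j: "j \<in> {1..s}" "\<not> inj_on (\<lambda>i. t (i, j)) {1..d - height (s + 1 - j)}" by blast
    \<comment> \<open>In this direction only equality of values is required, so the vanishing of the
      evaluations suffices and zero is the partner.\<close>
    have "left_val \<alpha> \<zero>\<^bsub>X\<^esub> = right_val \<alpha> \<beta> y" for \<alpha> \<beta>
      unfolding functional_zero[OF X.kspace_axioms left_val_functional] y_t
        right_val_pair[OF e_gen_X'[OF \<phi>t] \<tau>] multi_val_repeated_dual[OF t_mem j] by simp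
    then show ?thesis by (intro bexI[OF _ X.zero_closed]) blast
  qed
qed

lemma schur_isomorphic: "isomorphic_reps G X Y"
proof -
  \<comment> \<open>All dual pairs are used, since the separation properties of the two sides rely
    on different ones.\<close>
  let ?P = "{(\<alpha>, \<beta> :: nat \<Rightarrow> nat \<Rightarrow> 'k generic_field). dual_matrices d \<alpha> \<beta>}"
  let ?S = "e_gen lam V ` (young lam \<rightarrow> u ` {1..d})"
  let ?T = "{pure_pair X' L y \<tau> | y \<tau>. y \<in> e_gen lam' D ` (young lam' \<rightarrow> \<phi> ` {1..d}) \<and> \<tau> \<in> carrier L}"
  interpret P: kspace_pair X' L by (rule X'_L)
  have subX': "e_gen lam' D ` (young lam' \<rightarrow> \<phi> ` {1..d}) \<subseteq> carrier X'"
    by (rule image_subsetI, rule e_gen_X')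
      (rule subsetD[OF Pi_mono[OF frame_dual_subset[OF frame]]])
  have L_span: "vs_span L (carrier L) = carrier L"
    using P.W.span_closed[OF subset_refl] P.W.span_base[OF subset_refl] by blast
  show ?thesis
  proof (rule isomorphic_repsI[where P = ?P and \<Phi> = "\<lambda>p. left_val (fst p)"
        and \<Psi> = "\<lambda>p. right_val (fst p) (snd p)" and S = ?S and T = ?T, OF X_rep Y_rep])
    show "functional X (left_val (fst p))" for p by (rule left_val_functional)
    show "functional Y (right_val (fst p) (snd p))" for p by (rule right_val_functional)
    show "x = \<zero>\<^bsub>X\<^esub>" if "x \<in> carrier X" "\<And>p. p \<in> ?P \<Longrightarrow> left_val (fst p) x = 0" for x
      by (rule left_separates[OF that(1)]) (use that(2) in force)
    show "y = \<zero>\<^bsub>Y\<^esub>" if "y \<in> carrier Y" "\<And>p. p \<in> ?P \<Longrightarrow> right_val (fst p) (snd p) y = 0" for y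
      by (rule right_separates[OF that(1)]) (use that(2) in force)
    show "?S \<subseteq> carrier X"
      by (rule image_subsetI, rule e_gen_X)
        (rule subsetD[OF Pi_mono[OF frame_subset[OF frame]]])
    show "vs_span X ?S = carrier X"
      by (rule schur_span[OF V_kspace frame v frame_subset[OF frame] frame_span[OF frame]])
    show "?T \<subseteq> carrier Y" using subX' P.pure_pair_closed by blast
    show "vs_span Y ?T = carrier Y"
      by (rule P.pair_span[OF subX' schur_span[OF D_kspace dual_frame w frame_dual_subset[OF frame]
              frame_dual_span[OF V_kspace frame]] subset_refl L_span])
    show "\<exists>y\<in>carrier Y. (\<forall>p\<in>?P. left_val (fst p) x = right_val (fst p) (snd p) y) \<and>
        (\<forall>g\<in>carrier G. \<forall>p\<in>?P. left_val (fst p) (act X g x) = right_val (fst p) (snd p) (act Y g y))"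
      if "x \<in> ?S" for x
      using left_match[OF that] by (elim bexE conjE) (rule bexI, auto)
    show "\<exists>x\<in>carrier X. \<forall>p\<in>?P. left_val (fst p) x = right_val (fst p) (snd p) y" if "y \<in> ?T" for y
      using right_match[OF that] by (elim bexE) (rule bexI, auto)
  qed
qed

end

theorem theorem1p2:
  fixes G :: "('g, 'm) monoid_scheme"
    and V :: "('k::field, 'v, 'g) rep"
    and d s :: nat and lam :: "nat list"
    and B B' :: "nat set" and v :: "nat \<Rightarrow> 'v" and w :: "nat \<Rightarrow> 'v \<Rightarrow> 'k"
  assumes "group G"
    and "representation G V"
    and "vectorspace.fin_dim class_ring V"
    and "vectorspace.dim class_ring V = d"
    and "is_partition lam"
    and "length lam \<le> d"
    and "part lam 1 \<le> s"
    and "indexed_basis V B v"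
    and "indexed_basis (dual_rep G V) B' w"
  shows "isomorphic_reps G (schur lam V B v)
    (tensor_prod (schur (complement d s lam) (dual_rep G V) B' w)
      (tensor_power s (det_rep V)))"
proof -
  note V = representation_kspace[OF assms(2)]
  interpret V: kspace V by (rule V)
  interpret D: kspace "dual_rep G V" by (rule dual_kspace[OF V])
  \<comment> \<open>The frame is obtained from the given basis of \<open>V\<close> and its dual is
    used on the other side; of the basis \<open>w\<close> only the spanning property will be used,
    by independence of the basis.\<close>
  obtain u \<phi> where F: "frame G d V u \<phi>" by (rule frame_of_basis[OF V assms(3,4,8)])
  have v: "v ` B \<subseteq> carrier V" "vs_span V (v ` B) = carrier V"
    using assms(8) unfolding indexed_basis_def V.basis_def by blast+
  have w: "w ` B' \<subseteq> carrier (dual_rep G V)" "vs_span (dual_rep G V) (w ` B') = carrier (dual_rep G V)"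
    using assms(9) unfolding indexed_basis_def D.basis_def by blast+
  have "schur_complement G V d u \<phi> s lam B B' v w"
    by (intro schur_complement.intro framed_partition.intro framed_rep.intro framed_rep_axioms.intro
        framed_partition_axioms.intro schur_complement_axioms.intro generic.scalar_extension_axioms)
      (rule assms F v w)+
  then show ?thesis unfolding det_rep_def assms(4) by (rule schur_complement.schur_isomorphic)
qed

end
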